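(* Let $C\subset\mathbb R^{n+1}$ be a good cone with defining normals $\nu_1,\dots,\nu_d\in\mathbb Z^{n+1}$ and let $W_C$ be the corresponding closed toric symplectic cone. The fundamental group of $W_C$ is a cyclic group of order $N$ where \[ N=\gcd\left\{\det\left[\,\nu_{i_1}\,|\,\cdots\,|\,\nu_{i_{n+1}}\right]: 1\le i_1<\ldots<i_{n+1}\le d\right\}. \] In particular, if $C$ is determined by a toric diagram $D=\mathrm{conv}(v_1,\ldots,v_d)\subset\mathbb R^n$ with vertices $v_1,\dots,v_d$ (i.e. $\nu_j=(v_j,1)$) then \[ N=\gcd\left\{n!\,\mathrm{Vol}(\mathrm{conv}(v_{i_1},\ldots,v_{i_{n+1}})): 1\le i_1<\ldots<i_{n+1}\le d\right\}, \] where $\mathrm{Vol}$ is the Euclidean volume in $\mathbb R^n$.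
   Context: A cone $C\subset\mathbb R^{n+1}$ is good if it is strictly convex and there is a minimal set of primitive vectors $\nu_1,\dots,\nu_d\in\mathbb Z^{n+1}$ (the defining normals), $d\ge n+1$, such that $C=\bigcap_{j=1}^d\{x\mid\langle x,\nu_j\rangle\ge0\}$ and any codimension-$k$ face of $C$, $1\le k\le n$, is the intersection of exactly $k$ facets whose set of normals can be completed to an integral basis of $\mathbb Z^{n+1}$. For each good cone there is a unique closed toric symplectic cone $W_C$ (of dimension $2(n+1)$, with effective Hamiltonian $\mathbb T^{n+1}$-action) with moment cone $C$. Explicitly, with $\mathbb T^k=\mathbb R^k/2\pi\mathbb Z^k$, $W_C$ is the symplectic reduction at level zero of $\mathbb C^d\setminus\{0\}$ with the standard symplectic form by the diagonal action of $K=\{[y]\in\mathbb T^d\mid\sum_jy_j\nu_j\in2\pi\mathbb Z^{n+1}\}$, i.e. the zero level set in $\mathbb C^d\setminus\{0\}$ of the (homogeneous quadratic) moment map of the $K$-action, divided by $K$. It is known (Lerman) that $\pi_1(W_C)\cong\mathbb Z^{n+1}/\mathcal N$, where $\mathcal N$ is the $\mathbb Z$-span of $\nu_1,\dots,\nu_d$. A toric diagram $D\subset\mathbb R^n$ is an integral simplicial polytope all of whose facets are equivalent under integral affine transformations to $\mathrm{conv}(e_1,\dots,e_n)$, where $e_1,\dots,e_n$ is the canonical basis of $\mathbb R^n$. *)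

theory Defs
  imports "HOL-Analysis.Analysis" "HOL-Algebra.Elementary_Groups"
begin

section \<open>Good cones\<close>

text \<open>
  Throughout, \<^typ>\<open>'n::finite\<close> indexes the coordinates of $R^n$ (so $n \ge 1$), the type
  \<^typ>\<open>'n option\<close> indexes those of $R^{n+1}$, with \<^term>\<open>None\<close> as the last coordinate, and
  \<^typ>\<open>'d::finite\<close> indexes the $d$ defining normals.
\<close>

definition of_int_vec :: "int ^ 'm \<Rightarrow> real ^ 'm" where
  "of_int_vec v = (\<chi> i. real_of_int (v $ i))"

definition primitive_vec :: "int ^ 'm \<Rightarrow> bool" where
  "primitive_vec v \<longleftrightarrow> Gcd (range (($) v)) = 1"

definition integral_basis :: "('m \<Rightarrow> int ^ 'm::finite) \<Rightarrow> bool" where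
  "integral_basis B \<longleftrightarrow> (\<forall>v. \<exists>!c :: int ^ 'm. v = (\<Sum>i\<in>UNIV. c $ i *s B i))"

definition halfspace_of :: "int ^ 'm::finite \<Rightarrow> (real ^ 'm) set" where
  "halfspace_of v = {x. x \<bullet> of_int_vec v \<ge> 0}"

definition normal_facet :: "('d \<Rightarrow> int ^ 'm::finite) \<Rightarrow> 'd \<Rightarrow> (real ^ 'm) set" where
  "normal_facet \<nu> j = (\<Inter>i. halfspace_of (\<nu> i)) \<inter> {x. x \<bullet> of_int_vec (\<nu> j) = 0}"

text \<open>
  A strictly convex cone is one containing no line through the origin. Moment cones are
  full-dimensional, so codimension in the cone and in the ambient space agree; together with
  minimality of the normals this makes the sets \<^term>\<open>normal_facet \<nu> j\<close> exactly the facets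
  of \<open>C\<close>, without repetition. A face of codimension \<open>k\<close> is required to lie on exactly \<open>k\<close> facets
  and to be their intersection.
\<close>

definition good_cone :: "(real ^ 'n::finite option) set \<Rightarrow> ('d::finite \<Rightarrow> int ^ 'n option) \<Rightarrow> bool" where
  "good_cone C \<nu> \<longleftrightarrow>
     C = (\<Inter>j. halfspace_of (\<nu> j)) \<and>
     interior C \<noteq> {} \<and>
     (\<forall>x. x \<in> C \<and> - x \<in> C \<longrightarrow> x = 0) \<and>
     CARD('d) \<ge> CARD('n) + 1 \<and>
     (\<forall>j. primitive_vec (\<nu> j)) \<and>
     (\<forall>j. (\<Inter>i\<in>- {j}. halfspace_of (\<nu> i)) \<noteq> C) \<and>
     (\<forall>k F. 1 \<le> k \<and> k \<le> CARD('n) \<and> F face_of C \<and> aff_dim F = int (CARD('n) + 1) - int k \<longrightarrow>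
        (let J = {j. F \<subseteq> normal_facet \<nu> j} in
           card J = k \<and> F = (\<Inter>j\<in>J. normal_facet \<nu> j) \<and>
           (\<exists>B. integral_basis B \<and> \<nu> ` J \<subseteq> range B)))"

section \<open>The toric symplectic cone of a good cone\<close>

text \<open>
  Reduction at level zero of $C^d \setminus \{0\}$ by the group
  $K = \{[y] \in T^d \mid \sum_j y_j \nu_j \in 2\pi Z^{n+1}\}$. Elements of $T^d = R^d / 2\pi Z^d$ are
  represented by their lifts to $R^d$; they act by $z_j \mapsto e^{i y_j} z_j$. The Lie algebra of $K$ is
  the kernel of $y \mapsto \sum_j y_j \nu_j$, and the moment map of the $K$-action is the restriction
  to it of the functional $y \mapsto \frac12 \sum_j y_j |z_j|^2$. Only the underlying topological
  space is recorded.
\<close>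

definition normal_map :: "('d::finite \<Rightarrow> int ^ 'm) \<Rightarrow> real ^ 'd \<Rightarrow> real ^ 'm" where
  "normal_map \<nu> y = (\<Sum>j\<in>UNIV. y $ j *\<^sub>R of_int_vec (\<nu> j))"

definition reduction_group :: "('d::finite \<Rightarrow> int ^ 'm) \<Rightarrow> (real ^ 'd) set" where
  "reduction_group \<nu> = {y. \<exists>w. normal_map \<nu> y = (2 * pi) *\<^sub>R of_int_vec w}"

definition reduction_algebra :: "('d::finite \<Rightarrow> int ^ 'm) \<Rightarrow> (real ^ 'd) set" where
  "reduction_algebra \<nu> = {y. normal_map \<nu> y = 0}"

definition torus_act :: "real ^ 'd \<Rightarrow> complex ^ 'd \<Rightarrow> complex ^ 'd" where
  "torus_act y z = (\<chi> j. cis (y $ j) * z $ j)"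

definition torus_moment_map :: "complex ^ 'd \<Rightarrow> real ^ 'd" where
  "torus_moment_map z = (\<chi> j. (cmod (z $ j))\<^sup>2 / 2)"

definition zero_level :: "('d::finite \<Rightarrow> int ^ 'm) \<Rightarrow> (complex ^ 'd) set" where
  "zero_level \<nu> = {z. z \<noteq> 0 \<and> (\<forall>y\<in>reduction_algebra \<nu>. y \<bullet> torus_moment_map z = 0)}"

definition reduction_orbit :: "('d::finite \<Rightarrow> int ^ 'm) \<Rightarrow> complex ^ 'd \<Rightarrow> (complex ^ 'd) set" where
  "reduction_orbit \<nu> z = (\<lambda>y. torus_act y z) ` reduction_group \<nu>"

definition quotient_topology :: "'a topology \<Rightarrow> ('a \<Rightarrow> 'b) \<Rightarrow> 'b topology" where
  "quotient_topology X f =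
     topology (\<lambda>U. U \<subseteq> f ` topspace X \<and> openin X {x \<in> topspace X. f x \<in> U})"

lemma openin_quotient_topology:
  "openin (quotient_topology X f) U \<longleftrightarrow>
     U \<subseteq> f ` topspace X \<and> openin X {x \<in> topspace X. f x \<in> U}"
proof -
  have "istopology (\<lambda>U. U \<subseteq> f ` topspace X \<and> openin X {x \<in> topspace X. f x \<in> U})"
    unfolding istopology_def
  proof (intro conjI allI impI)
    fix S T
    assume S: "S \<subseteq> f ` topspace X \<and> openin X {x \<in> topspace X. f x \<in> S}"
      and T: "T \<subseteq> f ` topspace X \<and> openin X {x \<in> topspace X. f x \<in> T}"
    show "S \<inter> T \<subseteq> f ` topspace X" using S by blast
    have "{x \<in> topspace X. f x \<in> S \<inter> T} =
            {x \<in> topspace X. f x \<in> S} \<inter> {x \<in> topspace X. f x \<in> T}" by blast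
    then show "openin X {x \<in> topspace X. f x \<in> S \<inter> T}" using S T by (simp add: openin_Int)
  next
    fix \<K>
    assume K: "\<forall>S\<in>\<K>. S \<subseteq> f ` topspace X \<and> openin X {x \<in> topspace X. f x \<in> S}"
    show "\<Union>\<K> \<subseteq> f ` topspace X" using K by blast
    have "{x \<in> topspace X. f x \<in> \<Union>\<K>} = (\<Union>S\<in>\<K>. {x \<in> topspace X. f x \<in> S})" by blast
    then show "openin X {x \<in> topspace X. f x \<in> \<Union>\<K>}" using K by auto
  qed
  then show ?thesis by (simp add: quotient_topology_def topology_inverse')
qed

lemma quotient_map_quotient_topology: "quotient_map X (quotient_topology X f) f"
proof -
  have "{x \<in> topspace X. f x \<in> f ` topspace X} = topspace X" by blast
  then have "openin (quotient_topology X f) (f ` topspace X)"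
    by (simp add: openin_quotient_topology)
  then have "topspace (quotient_topology X f) = f ` topspace X"
    by (metis openin_quotient_topology openin_subset openin_topspace subset_antisym)
  then show ?thesis by (simp add: quotient_map_def openin_quotient_topology)
qed

definition toric_symplectic_cone :: "('d::finite \<Rightarrow> int ^ 'm) \<Rightarrow> (complex ^ 'd) set topology" where
  "toric_symplectic_cone \<nu> = quotient_topology (top_of_set (zero_level \<nu>)) (reduction_orbit \<nu>)"

lemma topspace_toric_symplectic_cone:
  "topspace (toric_symplectic_cone \<nu>) = reduction_orbit \<nu> ` zero_level \<nu>"
  using quotient_map_quotient_topology[of "top_of_set (zero_level \<nu>)" "reduction_orbit \<nu>"]
  by (simp add: quotient_map_def toric_symplectic_cone_def)

lemma toric_symplectic_cone_nonempty:
  assumes "good_cone C \<nu>"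
  shows "topspace (toric_symplectic_cone \<nu>) \<noteq> {}"
proof -
  have C: "C = (\<Inter>j. halfspace_of (\<nu> j))" and int: "interior C \<noteq> {}"
    and pointed: "\<And>x. x \<in> C \<Longrightarrow> - x \<in> C \<Longrightarrow> x = 0"
    using assms by (auto simp: good_cone_def)
  have "\<not> C \<subseteq> {0}"
    using int interior_mono[of C "{0}"] by auto
  then obtain x where x: "x \<in> C" "x \<noteq> 0" by blast
  define z :: "complex ^ 'b" where "z = (\<chi> j. of_real (sqrt (x \<bullet> of_int_vec (\<nu> j))))"
  have nn: "x \<bullet> of_int_vec (\<nu> j) \<ge> 0" for j
    using x(1) by (auto simp: C halfspace_of_def)
  have "z \<noteq> 0"
  proof
    assume "z = 0"
    then have "x \<bullet> of_int_vec (\<nu> j) = 0" for j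
      by (simp add: z_def vec_eq_iff)
    then have "- x \<in> C" by (simp add: C halfspace_of_def)
    then show False using pointed x by blast
  qed
  moreover have "y \<bullet> torus_moment_map z = 0" if "y \<in> reduction_algebra \<nu>" for y
  proof -
    have "y \<bullet> torus_moment_map z = (x \<bullet> normal_map \<nu> y) / 2"
      using nn by (simp add: torus_moment_map_def z_def inner_vec_def[of y] normal_map_def
          inner_sum_right sum_divide_distrib)
    then show ?thesis using that by (simp add: reduction_algebra_def)
  qed
  ultimately have "z \<in> zero_level \<nu>" by (simp add: zero_level_def)
  then show ?thesis by (auto simp: topspace_toric_symplectic_cone)
qed

section \<open>The fundamental group of an abstract topological space\<close>

definition loops_at :: "'a topology \<Rightarrow> 'a \<Rightarrow> (real \<Rightarrow> 'a) set" where
  "loops_at X x = {p. pathin X p \<and> p 0 = x \<and> p 1 = x}"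

definition loop_homotopy :: "'a topology \<Rightarrow> 'a \<Rightarrow> ((real \<Rightarrow> 'a) \<times> (real \<Rightarrow> 'a)) set" where
  "loop_homotopy X x = {(p, q). p \<in> loops_at X x \<and> q \<in> loops_at X x \<and>
     homotopic_with (\<lambda>r. r 0 = x \<and> r 1 = x) (top_of_set {0..1}) X p q}"

text \<open>The library's \<^const>\<open>joinpaths\<close> needs a type of class \<^class>\<open>topological_space\<close>.\<close>

definition join_loops :: "(real \<Rightarrow> 'a) \<Rightarrow> (real \<Rightarrow> 'a) \<Rightarrow> real \<Rightarrow> 'a" where
  "join_loops p q = (\<lambda>t. if t \<le> 1 / 2 then p (2 * t) else q (2 * t - 1))"

definition fundamental_group :: "'a topology \<Rightarrow> 'a \<Rightarrow> (real \<Rightarrow> 'a) set monoid" where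
  "fundamental_group X x =
     \<lparr>carrier = loops_at X x // loop_homotopy X x,
      mult = (\<lambda>A B. \<Union>p\<in>A. \<Union>q\<in>B. loop_homotopy X x `` {join_loops p q}),
      one = loop_homotopy X x `` {\<lambda>_. x}\<rparr>"

section \<open>Toric diagrams\<close>

definition integral_affine_map :: "(real ^ 'n \<Rightarrow> real ^ 'n::finite) \<Rightarrow> bool" where
  "integral_affine_map T \<longleftrightarrow>
     (\<exists>(A :: int ^ 'n ^ 'n) b. invertible A \<and>
        (\<forall>x. T x = map_matrix real_of_int A *v x + of_int_vec b))"

text \<open>
  The dimension condition only excludes the empty set and single points, whose facets satisfy the
  remaining conditions vacuously.
\<close>

definition toric_diagram :: "(real ^ 'n::finite) set \<Rightarrow> bool" where
  "toric_diagram D \<longleftrightarrow>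
     polytope D \<and> aff_dim D = int CARD('n) \<and>
     (\<forall>v. v extreme_point_of D \<longrightarrow> v \<in> range of_int_vec) \<and>
     (\<forall>F. F facet_of D \<longrightarrow> (int CARD('n) - 1) simplex F) \<and>
     (\<forall>F. F facet_of D \<longrightarrow>
        (\<exists>T. integral_affine_map T \<and> F = T ` (convex hull (range (\<lambda>i. axis i 1)))))"

text \<open>The vector $(x,1)$.\<close>

definition lift_vec :: "real ^ 'n \<Rightarrow> real ^ 'n option" where
  "lift_vec x = (\<chi> k. case k of None \<Rightarrow> 1 | Some i \<Rightarrow> x $ i)"

text \<open>
  The matrix with columns \<^term>\<open>\<nu> (i c)\<close>. An injective \<open>i\<close> selects $n+1$ of the normals together with
  an order of the columns; the order only affects the sign of the determinant and hence
  not a greatest common divisor of such determinants.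
\<close>

definition normal_matrix :: "('d \<Rightarrow> int ^ 'm) \<Rightarrow> ('m \<Rightarrow> 'd) \<Rightarrow> int ^ 'm ^ 'm" where
  "normal_matrix \<nu> i = (\<chi> r c. \<nu> (i c) $ r)"

end

theory Submission
  imports Defs
begin

text \<open>
  Write $Z$ for the zero level set, so that $W_C = Z/K$. Goodness of the cone makes the action of
  $K$ on $Z$ free, $Z$ is simply connected, and $K$ has identity component the torus with Lie
  algebra $\ker(y \mapsto \sum_j y_j \nu_j)$. Hence $\pi_1(W_C)$ is the group of components of $K$,
  and $[y] \mapsto \frac{1}{2\pi}\sum_j y_j \nu_j$ identifies that group with the quotient of
  $Z^{n+1}$ by the lattice spanned by the normals. Four ingredients make this argument concrete.

  \<^item> \<^emph>\<open>Simple connectedness of $Z$.\<close> A point of $Z$ satisfies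
    $\frac12|z_j|^2 = \langle x,\nu_j\rangle$ for a nonzero $x \in C$, so its vanishing coordinates
    are the facets through $x$. Call a set of facets admissible if it arises in this way. A radial
    rescaling of the coordinates, built from one chosen point in each face, contracts the open set
    of all $z$ with admissible vanishing set onto $Z$ up to homotopy. The complement of that open
    set is a union of coordinate subspaces of complex codimension at least two, because every
    single facet is admissible; and a loop avoiding such subspaces can be coned off from a
    generic point (\<open>simply_connected_coordinate_complement\<close>, \<open>simply_connected_zero_level\<close>).

  \<^item> \<^emph>\<open>Lifting.\<close> The quotient map has local sections (\<open>local_section\<close>), and two lifts of the
    same path differ by a continuous path in the compact group $K$
    (\<open>continuous_lift_difference\<close>). A homotopy therefore lifts over a thin strip
    (\<open>strip_lift\<close>), and the component of $K$ that relates the two ends of a lifted loop is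
    locally constant in a family of loops.

  \<^item> \<^emph>\<open>A complete invariant.\<close> This component, the monodromy of the loop, is additive; it takes
    every value because $Z$ is path connected; and it determines the loop up to homotopy because $Z$
    is simply connected. An additive complete invariant with values in a cyclic group already
    forces the group axioms and the isomorphism type
    (\<open>fundamental_group_cyclic_by_invariant\<close>), so associativity and inverses of loops
    are never treated separately.

  \<^item> \<^emph>\<open>Arithmetic.\<close> At an extreme ray of the cone, $n$ of the normals extend to an integral basis by
    one further vector. Let $\beta$ be the coordinate along that vector. Modulo the $n$ normals,
    everything happens in this one coordinate, so the lattice is $\{v \mid N \mathrel{|} \beta(v)\}$
    with $N$ the greatest common divisor of the $\beta(\nu_j)$. This $N$ divides all maximal minors,
    and each $\beta(\nu_j)$ is either zero or, up to sign, the minor of the $n$ normals and $\nu_j$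
    (\<open>good_cone_lattice_functional\<close>).

  The volume formula is independent of the topology: $n!$ times the volume of a simplex is the
  absolute value of the determinant of its lifted vertices (\<open>measure_simplex_lift_vec\<close>).
\<close>

section \<open>Complements of coordinate subspaces of codimension at least two\<close>

definition coordinate_complement :: "'d::finite set set \<Rightarrow> (complex ^ 'd) set" where
  "coordinate_complement \<B> = {z. \<forall>J\<in>\<B>. \<exists>k\<in>J. z $ k \<noteq> 0}"

text \<open>
  When \<open>g t\<close> is outside the subspace \<open>{z. \<forall>k\<in>J. z $ k = 0}\<close>, the segment from \<open>g t\<close> to \<open>c\<close>
  can meet it only if the \<open>J\<close>-coordinates of \<open>c\<close> are a multiple of those of \<open>g t\<close>. Such \<open>c\<close> depend on the coordinates outside
  \<open>J\<close> and on the two real parameters \<open>r\<close> and \<open>t\<close>, while \<open>J\<close> has at least four real coordinates; so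
  they form the smooth image of a set of lower dimension.
\<close>

lemma negligible_cone_points:
  fixes g :: "real \<Rightarrow> complex ^ 'd::finite"
  assumes g: "polynomial_function g" and ij: "i \<in> J" "j \<in> J" "i \<noteq> j"
  shows "negligible {c. \<exists>t r. \<forall>k\<in>J. c $ k = (r *\<^sub>R g t) $ k}"
proof -
  \<comment> \<open>The parameters \<open>r\<close> and \<open>t\<close> are stored in the real parts of the coordinates \<open>i\<close> and \<open>j\<close> of \<open>J\<close>,
    so that the bad points are an image of the hyperplane where coordinate \<open>i\<close> is real.\<close>
  define S where "S = {z :: complex ^ 'd. axis i \<i> \<bullet> z = 0}"
  define f where "f z = (\<chi> k. if k \<in> J then 0 else z $ k) + Re (z $ i) *\<^sub>R g (Re (z $ j))"
    for z :: "complex ^ 'd"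
  have negS: "negligible S"
    unfolding S_def by (rule negligible_hyperplane) (auto simp: axis_eq_0_iff)
  have lin: "linear (\<lambda>z :: complex ^ 'd. (\<chi> k. if k \<in> J then 0 else z $ k))"
    by (rule linearI) (auto simp: vec_eq_iff)
  have lin1: "linear (\<lambda>z :: complex ^ 'd. Re (z $ k))" for k
    by (rule linearI) auto
  have gd: "(\<lambda>z. g (Re (z $ j))) differentiable (at z)" for z
    using differentiable_chain_at[OF linear_imp_differentiable[OF lin1] 
        differentiable_at_polynomial_function[OF g]] by (simp add: o_def)
  have "f differentiable_on S"
    unfolding f_def differentiable_on_def
    by (intro ballI differentiable_at_withinI[OF differentiable_add]
        differentiable_scaleR linear_imp_differentiable[OF lin] linear_imp_differentiable[OF lin1] gd)
  then have neg: "negligible (f ` S)"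
    using negligible_differentiable_image_negligible negS by blast
  have "{c. \<exists>t r. \<forall>k\<in>J. c $ k = (r *\<^sub>R g t) $ k} \<subseteq> f ` S"
  proof clarify
    fix c :: "complex ^ 'd" and t r :: real assume c: "\<forall>k\<in>J. c $ k = (r *\<^sub>R g t) $ k"
    define z :: "complex ^ 'd" where "z = (\<chi> k. if k \<in> J then (if k = i then of_real r else if k = j then of_real t else 0)
            else c $ k - (r *\<^sub>R g t) $ k)"
    have "f z = c"
      using c ij by (auto simp: f_def z_def vec_eq_iff)
    moreover have "z \<in> S"
      using ij by (auto simp: S_def z_def inner_axis' inner_complex_def)
    ultimately show "c \<in> f ` S" by blast
  qed
  then show ?thesis using neg negligible_subset by blast
qed

text \<open>
  Two curves are treated at once so that constant curves also give path connectedness.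
\<close>

lemma generic_cone_point:
  fixes g h :: "real \<Rightarrow> complex ^ 'd::finite"
  assumes g: "polynomial_function g" "g ` {0..1} \<subseteq> coordinate_complement \<B>" 
    and h: "polynomial_function h" "h ` {0..1} \<subseteq> coordinate_complement \<B>"
    and \<B>: "\<And>J. J \<in> \<B> \<Longrightarrow> \<exists>i\<in>J. \<exists>j\<in>J. i \<noteq> j"
  obtains c where "c \<in> coordinate_complement \<B>"
    "\<And>t. t \<in> {0..1} \<Longrightarrow> closed_segment (g t) c \<subseteq> coordinate_complement \<B>"
    "\<And>t. t \<in> {0..1} \<Longrightarrow> closed_segment (h t) c \<subseteq> coordinate_complement \<B>"
proof -
  define bad where "bad f J = {c. \<exists>t r. \<forall>k\<in>J. c $ k = (r *\<^sub>R f t) $ k}" 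
    for f :: "real \<Rightarrow> complex ^ 'd" and J
  have "negligible (bad g J \<union> bad h J)" if "J \<in> \<B>" for J
    unfolding bad_def using \<B>[OF that] g(1) h(1) by (blast intro: negligible_Un negligible_cone_points)
  then have "negligible (\<Union>J\<in>\<B>. bad g J \<union> bad h J)"
    by (intro negligible_Union) auto
  then have "(\<Union>J\<in>\<B>. bad g J \<union> bad h J) \<noteq> UNIV"
    using non_negligible_UNIV by metis
  then obtain c where c: "\<And>J. J \<in> \<B> \<Longrightarrow> c \<notin> bad g J \<and> c \<notin> bad h J" by blast
  have seg: "closed_segment (f t) c \<subseteq> coordinate_complement \<B>"
    if f: "f t \<in> coordinate_complement \<B>" and cf: "\<And>J. J \<in> \<B> \<Longrightarrow> c \<notin> bad f J" for f t
  proof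
    fix x assume "x \<in> closed_segment (f t) c"
    then obtain u where u: "0 \<le> u" "u \<le> 1" "x = (1 - u) *\<^sub>R f t + u *\<^sub>R c"
      by (auto simp: closed_segment_def)
    show "x \<in> coordinate_complement \<B>"
    proof (cases "u = 0")
      case True then show ?thesis using u f by simp
    next
      case False
      have "\<exists>k\<in>J. x $ k \<noteq> 0" if J: "J \<in> \<B>" for J
      proof (rule ccontr)
        assume "\<not> (\<exists>k\<in>J. x $ k \<noteq> 0)"
        then have 0: "u *\<^sub>R c $ k = - ((1 - u) *\<^sub>R f t $ k)" if "k \<in> J" for k
          using that u by (simp add: eq_neg_iff_add_eq_0 add.commute)
        have "c $ k = ((- (1 - u) / u) *\<^sub>R f t) $ k" if "k \<in> J" for k
        proof -
          have "c $ k = (1 / u) *\<^sub>R (u *\<^sub>R c $ k)" using False by simp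
          also have "\<dots> = ((- (1 - u) / u) *\<^sub>R f t) $ k" 
            unfolding 0[OF that] using False by (simp add: scaleR_diff_right scaleR_diff_left diff_divide_distrib)
          finally show ?thesis .
        qed
        then have "c \<in> bad f J" unfolding bad_def by blast
        then show False using cf J by blast
      qed
      then show ?thesis by (auto simp: coordinate_complement_def)
    qed
  qed
  have gseg: "closed_segment (g t) c \<subseteq> coordinate_complement \<B>" if "t \<in> {0..1}" for t
    using seg[of g t] g(2) c that by blast
  have hseg: "closed_segment (h t) c \<subseteq> coordinate_complement \<B>" if "t \<in> {0..1}" for t
    using seg[of h t] h(2) c that by blast
  show ?thesis
    by (rule that[OF _ gseg hseg]) (use gseg[of 0] in auto)
qed

lemma open_coordinate_complement: "open (coordinate_complement \<B>)"
proof -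
  have eq: "coordinate_complement \<B> = (\<Inter>J\<in>\<B>. \<Union>k\<in>J. {z. z $ k \<noteq> 0})"
    by (auto simp: coordinate_complement_def)
  show ?thesis unfolding eq
    by (intro open_INT open_UN ballI open_Collect_neq continuous_intros) auto
qed

text \<open>
  Each removed subspace has real codimension at least four. A loop is replaced by a nearby
  polynomial loop, whose cone from a generic point avoids all removed subspaces.
\<close>

theorem simply_connected_coordinate_complement:
  assumes \<B>: "\<And>J. J \<in> \<B> \<Longrightarrow> \<exists>i\<in>J. \<exists>j\<in>J. i \<noteq> j"
  shows "simply_connected (coordinate_complement \<B>)" (is "simply_connected ?U")
  unfolding simply_connected_eq_contractible_loop_some
proof (intro conjI allI impI)
  show "path_connected ?U"
    unfolding path_connected_def
  proof (intro ballI)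
    fix a b assume ab: "a \<in> ?U" "b \<in> ?U"
    obtain c where c: "closed_segment a c \<subseteq> ?U" "closed_segment b c \<subseteq> ?U"
    proof (rule generic_cone_point[of "\<lambda>_. a" \<B> "\<lambda>_. b"])
      fix c assume "\<And>t::real. t \<in> {0..1} \<Longrightarrow> closed_segment a c \<subseteq> ?U"
        and "\<And>t::real. t \<in> {0..1} \<Longrightarrow> closed_segment b c \<subseteq> ?U"
      from this[of 0] show thesis using that by simp
    qed (use ab \<B> in auto)
    have "path_component ?U a c" "path_component ?U b c"
      unfolding path_component_def 
      using c by (force intro: exI[of _ "linepath a c"], force intro: exI[of _ "linepath b c"])
    then show "\<exists>g. path g \<and> path_image g \<subseteq> ?U \<and> pathstart g = a \<and> pathfinish g = b"
      by (metis path_component_def path_component_sym path_component_trans)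
  qed
next
  fix p assume "path p \<and> path_image p \<subseteq> ?U \<and> pathfinish p = pathstart p"
  then have p: "path p" "path_image p \<subseteq> ?U" "pathfinish p = pathstart p" by auto
  obtain e where e: "e > 0" "\<And>h. path h \<Longrightarrow> pathfinish h = pathstart h \<Longrightarrow>
      (\<forall>t\<in>{0..1}. norm (h t - p t) < e) \<Longrightarrow> homotopic_loops ?U p h"
    using homotopic_nearby_loops[OF p(1) open_coordinate_complement p(2,3)] by metis
  obtain g where g: "polynomial_function g" "pathstart g = pathstart p" "pathfinish g = pathfinish p"
      "\<And>t. t \<in> {0..1} \<Longrightarrow> norm (g t - p t) < e"
    using path_approx_polynomial_function[OF p(1) e(1)] by metis
  have pg: "path g" using g(1) by (rule path_polynomial_function)
  have hom: "homotopic_loops ?U p g" using e(2)[OF pg] g p(3) by auto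
  then have gU: "g ` {0..1} \<subseteq> ?U"
    using homotopic_loops_imp_subset path_image_def by metis
  obtain c where c: "c \<in> ?U" "\<And>t. t \<in> {0..1} \<Longrightarrow> closed_segment (g t) c \<subseteq> ?U"
    using generic_cone_point[OF g(1) gU g(1) gU \<B>] by metis
  have "homotopic_loops ?U g (linepath c c)"
    using c(2) by (intro homotopic_loops_linear) (use pg g p(3) in auto)
  then show "\<exists>a. a \<in> ?U \<and> homotopic_loops ?U p (linepath a a)"
    using c(1) hom homotopic_loops_trans by blast
qed

section \<open>Determinants with identity rows\<close>

text \<open>
  In the Leibniz expansion only permutations fixing the indices outside \<open>range g\<close> survive. The
  index types of the two matrices differ, so this also serves to rename and to delete indices.
\<close>

lemma det_identity_rows_minor:
  fixes A :: "'c::comm_ring_1 ^ 'b ^ 'b" and g :: "'a::finite \<Rightarrow> 'b::finite"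
  assumes g: "inj g" and A: "\<And>i j. i \<notin> range g \<Longrightarrow> A $ i $ j = (if i = j then 1 else 0)"
  shows "det A = det (\<chi> i j. A $ g i $ g j)"
proof -
  have 0: "of_int (sign p) * (\<Prod>i\<in>UNIV. A $ i $ p i) = 0"
    if p: "p permutes UNIV" "\<not> p permutes range g" for p
  proof -
    obtain i where "i \<notin> range g" "p i \<noteq> i"
      using p by (metis permutes_superset subset_UNIV DiffD2)
    then have "(\<Prod>i\<in>UNIV. A $ i $ p i) = 0"
      using A by (metis (no_types) UNIV_I finite_code prod_zero)
    then show ?thesis by simp
  qed
  have "det A = (\<Sum>p | p permutes range g. of_int (sign p) * (\<Prod>i\<in>UNIV. A $ i $ p i))"
    unfolding det_def using 0
    by (intro sum.mono_neutral_right) (auto intro: permutes_subset finite_permutations)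
  also have "\<dots> = (\<Sum>p | p permutes (UNIV :: 'a set).
      of_int (sign p) * (\<Prod>i\<in>UNIV. (\<chi> i j. A $ g i $ g j) $ i $ p i))"
  proof (rule sum.reindex_bij_witness[where j = "map_permutation (range g) (inv_into UNIV g)"
        and i = "map_permutation UNIV g"])
    fix p assume "p \<in> {p. p permutes range g}"
    then have p: "p permutes range g" by simp
    have invg: "inj_on (inv_into UNIV g) (range g)" by (simp add: inj_on_inv_into)
    show "map_permutation UNIV g (map_permutation (range g) (inv_into UNIV g) p) = p"
      using p g by (intro map_permutation_compose_inv) (auto simp: bij_betw_def invg f_inv_into_f)
    let ?q = "map_permutation (range g) (inv_into UNIV g) p"
    show "?q \<in> {p. p permutes UNIV}"
      using map_permutation_permutes[OF _ p, of "inv_into UNIV g" UNIV] g by (auto simp: bij_betw_def invg)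
    have gq: "g (?q i) = p (g i)" for i
    proof -
      have "?q (inv_into UNIV g (g i)) = inv_into UNIV g (p (g i))"
        by (rule map_permutation_apply[OF invg]) simp
      moreover have "p (g i) \<in> range g" using permutes_in_image[OF p] by auto
      ultimately show ?thesis using g by (simp add: f_inv_into_f)
    qed
    have "(\<Prod>i\<in>UNIV. A $ i $ p i) = (\<Prod>i\<in>range g. A $ i $ p i)"
      using A by (intro prod.mono_neutral_right) (auto simp: permutes_not_in[OF p])
    also have "\<dots> = (\<Prod>i\<in>UNIV. A $ g i $ p (g i))"
      using g by (simp add: prod.reindex)
    finally show "of_int (sign ?q) * (\<Prod>i\<in>UNIV. (\<chi> i j. A $ g i $ g j) $ i $ ?q i) =
        of_int (sign p) * (\<Prod>i\<in>UNIV. A $ i $ p i)"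
      using sign_map_permutation[OF invg p] by (simp add: gq)
  next
    fix q assume "q \<in> {p. p permutes (UNIV :: 'a set)}"
    then have q: "q permutes UNIV" by simp
    show "map_permutation (range g) (inv_into UNIV g) (map_permutation UNIV g q) = q"
      using q g by (intro map_permutation_compose_inv) (auto simp: bij_betw_def)
    show "map_permutation UNIV g q \<in> {p. p permutes range g}"
      using map_permutation_permutes[OF _ q, of g "range g"] g by (auto simp: bij_betw_def)
  qed
  finally show ?thesis by (simp add: det_def)
qed

lemma det_identity_rows_except_one:
  fixes A :: "'c::comm_ring_1 ^ 'b ^ 'b::finite"
  assumes "\<And>i j. i \<noteq> k \<Longrightarrow> A $ i $ j = (if i = j then 1 else 0)"
  shows "det A = A $ k $ k"
  using det_identity_rows_minor[of "\<lambda>_ :: 1. k" A] assms by (simp add: inj_on_def det_1)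

section \<open>The volume of a simplex\<close>

text \<open>
  The formula \<open>content_simplex\<close> concerns coordinates indexed by a well-ordered type. This copy of a
  finite type carries the order of the natural numbers; volumes are transported along a bijection
  of the indices.
\<close>

typedef (overloaded) 'n ordered_copy = "{..<CARD('n::finite)}"
  by (rule exI[of _ 0]) simp

setup_lifting type_definition_ordered_copy

instantiation ordered_copy :: (finite) linorder
begin
lift_definition less_eq_ordered_copy :: "'a ordered_copy \<Rightarrow> 'a ordered_copy \<Rightarrow> bool" is "(\<le>)" .
lift_definition less_ordered_copy :: "'a ordered_copy \<Rightarrow> 'a ordered_copy \<Rightarrow> bool" is "(<)" .
instance by (standard; transfer; auto)
end

instance ordered_copy :: (finite) finite
proof
  have "finite (Rep_ordered_copy ` (UNIV :: 'a ordered_copy set))"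
    by (rule finite_subset[of _ "{..<CARD('a)}"]) (use Rep_ordered_copy in auto)
  then show "finite (UNIV :: 'a ordered_copy set)"
    by (rule finite_imageD) (simp add: Rep_ordered_copy_inject inj_on_def)
qed

instance ordered_copy :: (finite) wellorder
proof
  fix P :: "'a ordered_copy \<Rightarrow> bool" and a
  assume *: "\<And>x. (\<And>y. y < x \<Longrightarrow> P y) \<Longrightarrow> P x"
  show "P a"
  proof (induction "Rep_ordered_copy a" arbitrary: a rule: less_induct)
    case less
    show ?case by (rule *) (auto intro: less simp: less_ordered_copy.rep_eq)
  qed
qed

lemma card_ordered_copy: "CARD('n ordered_copy) = CARD('n::finite)"
  using type_definition.card[OF type_definition_ordered_copy[where 'n = 'n]] by simp

lemma prod_Basis_cart:
  fixes h :: "real ^ 'n::finite \<Rightarrow> 'b::comm_monoid_mult"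
  shows "(\<Prod>b\<in>Basis. h b) = (\<Prod>i\<in>UNIV. h (axis i 1))"
proof -
  have B: "(Basis :: (real ^ 'n) set) = range (\<lambda>i. axis i 1)" by (auto simp: Basis_vec_def)
  have "prod h Basis = prod h (range (\<lambda>i. axis i 1))" using B by (rule arg_cong)
  also have "\<dots> = (\<Prod>i\<in>UNIV. h (axis i 1))" 
    by (subst prod.reindex) (auto simp: inj_on_def axis_eq_axis)
  finally show ?thesis .
qed

lemma measure_lebesgue_reindex:
  fixes e :: "'m::finite \<Rightarrow> 'n::finite" and S :: "(real ^ 'n) set"
  assumes e: "bij e" and S: "compact S"
  shows "measure lebesgue ((\<lambda>x. \<chi> i. x $ e i) ` S) = measure lebesgue S"
proof -
  define f where "f x = (\<chi> i. x $ (inv_into UNIV e i))" for x :: "real ^ 'm"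
  have f: "f \<in> borel_measurable borel"
    unfolding f_def by (intro borel_measurable_continuous_onI continuous_intros)
  have "lborel = distr lborel borel f"
  proof (rule lborel_eqI)
    fix l u :: "real ^ 'n"
    assume lu: "\<And>b. b \<in> Basis \<Longrightarrow> l \<bullet> b \<le> u \<bullet> b"
    have lu': "l $ i \<le> u $ i" for i using lu[of "axis i 1"] by (simp add: inner_axis)
    define l' u' where "l' = (\<chi> i. l $ e i)" and "u' = (\<chi> i. u $ e i)"
    have "f -` box l u = box l' u'"
    proof (rule Set.set_eqI)
      fix x
      have "x \<in> f -` box l u \<longleftrightarrow> (\<forall>i. l $ i < x $ (inv_into UNIV e i) \<and> x $ (inv_into UNIV e i) < u $ i)"
        by (auto simp: f_def mem_box_cart)
      also have "\<dots> \<longleftrightarrow> (\<forall>i. l $ e i < x $ i \<and> x $ i < u $ e i)"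
        using e by (metis bij_inv_eq_iff)
      finally show "x \<in> f -` box l u \<longleftrightarrow> x \<in> box l' u'" by (simp add: mem_box_cart l'_def u'_def)
    qed
    then have "emeasure (distr lborel borel f) (box l u) = emeasure lborel (box l' u')"
      using f by (simp add: emeasure_distr)
    also have "\<dots> = ennreal (\<Prod>b\<in>Basis. (u' - l') \<bullet> b)"
      by (rule emeasure_lborel_box) (auto simp: Basis_vec_def inner_axis l'_def u'_def lu')
    also have "(\<Prod>b\<in>Basis. (u' - l') \<bullet> b) = (\<Prod>i\<in>UNIV. u' $ i - l' $ i)"
      by (simp add: prod_Basis_cart inner_axis)
    also have "\<dots> = (\<Prod>i\<in>UNIV. u $ i - l $ i)"
      unfolding l'_def u'_def using prod.reindex_bij_betw[OF e, of "\<lambda>i. u $ i - l $ i"] by simp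
    also have "\<dots> = (\<Prod>b\<in>Basis. (u - l) \<bullet> b)"
      by (simp add: prod_Basis_cart inner_axis)
    finally show "emeasure (distr lborel borel f) (box l u) = ennreal (\<Prod>b\<in>Basis. (u - l) \<bullet> b)" .
  qed simp
  then have "measure lborel S = measure (distr lborel borel f) S" by simp
  also have "\<dots> = measure lborel (f -` S)"
    using f S by (subst measure_distr) (auto simp: borel_compact)
  also have "f -` S = (\<lambda>x. \<chi> i. x $ e i) ` S"
    using e by (auto simp: f_def image_iff vec_eq_iff bij_is_surj surj_f_inv_f bij_is_inj
      intro!: bexI[of _ "f _"])
  also have "measure lborel \<dots> = measure lebesgue \<dots>"
  proof -
    have "compact ((\<lambda>x. \<chi> i. x $ e i) ` S)"
      using S by (intro compact_continuous_image continuous_intros)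
    then show ?thesis by (simp add: borel_compact)
  qed
  also have "measure lborel S = measure lebesgue S"
    using S by (simp add: borel_compact)
  finally show ?thesis by simp
qed

text \<open>
  Subtracting one column of the matrix of lifted vertices from all others clears the row of ones
  and leaves the matrix of edge vectors from one vertex.
\<close>

theorem measure_simplex_lift_vec:
  fixes p :: "'n::finite option \<Rightarrow> real ^ 'n"
  assumes p: "inj p"
  shows "fact CARD('n) * measure lebesgue (convex hull (range p)) =
    \<bar>det (\<chi> r c. lift_vec (p c) $ r)\<bar>"
proof -
  obtain e :: "'n ordered_copy \<Rightarrow> 'n" where e: "bij e"
    using finite_same_card_bij[of "UNIV :: 'n ordered_copy set" "UNIV :: 'n set"] by (auto simp: card_ordered_copy)
  define L where "L x = (\<chi> i. x $ e i)" for x :: "real ^ 'n"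
  have L: "linear L" unfolding L_def by (rule linearI) (auto simp: vec_eq_iff)
  have injL: "inj L"
    using e by (auto simp: inj_on_def L_def vec_eq_iff) (metis bij_pointE)
  define q where "q = L \<circ> p"
  have q: "inj q" unfolding q_def using injL p by (rule inj_compose)
  have cq: "card (range q) = Suc CARD('n ordered_copy)"
    using q by (simp add: card_image card_ordered_copy)
  define A where "A = (\<chi> r c. lift_vec (p c) $ r)"
  \<comment> \<open>Right multiplication by \<open>E\<close> subtracts column \<open>None\<close> from every other column.\<close>
  define E :: "real ^ 'n option ^ 'n option" where
    "E = (\<chi> r c. if r = c then 1 else if r = None then -1 else 0)"
  define A' where "A' = A ** E"
  have A': "A' $ r $ c = (if c = None then A $ r $ None else A $ r $ c - A $ r $ None)" for r c
  proof -
    have "A' $ r $ c = A $ r $ None * E $ None $ c + (\<Sum>i\<in>UNIV. A $ r $ Some i * E $ Some i $ c)"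
      by (simp add: A'_def matrix_matrix_mult_def UNIV_option_conv sum.reindex)
    then show ?thesis
    proof (cases c)
      case (Some j)
      have "(\<Sum>i\<in>UNIV. A $ r $ Some i * E $ Some i $ Some j) = 
          (\<Sum>i\<in>UNIV. if i = j then A $ r $ Some i else 0)"
        by (intro sum.cong) (auto simp: E_def)
      also have "\<dots> = A $ r $ Some j" by (simp only: sum.delta finite) simp
      finally show ?thesis 
        using \<open>A' $ r $ c = _\<close> Some by (simp add: E_def)
    qed (simp add: E_def)
  qed
  have "det E = 1"
    by (subst det_identity_rows_except_one[of None]) (auto simp: E_def)
  then have "det A = det A'" by (simp add: A'_def det_mul)
  also have "\<dots> = det (\<chi> i j. A' $ (Some \<circ> e) i $ (Some \<circ> e) j)"
  proof (rule det_identity_rows_minor)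
    show "inj (Some \<circ> e)" using e by (auto simp: bij_def inj_on_def)
    fix i j assume "i \<notin> range (Some \<circ> e)"
    then have "i = None" 
      using e by (cases i) (auto simp: bij_def surj_def image_iff)
    then show "A' $ i $ j = (if i = j then 1 else 0)" by (auto simp: A' A_def lift_vec_def)
  qed
  also have "(\<chi> i j. A' $ (Some \<circ> e) i $ (Some \<circ> e) j) =
      (\<chi> i. \<chi> j. (q \<circ> Some \<circ> e) j $ i - q None $ i)"
    by (simp add: vec_eq_iff A' A_def lift_vec_def q_def L_def)
  finally have det: "det A = det (\<chi> i. \<chi> j. (q \<circ> Some \<circ> e) j $ i - q None $ i)" .
  have "bij_betw (q \<circ> Some \<circ> e) UNIV (range q - {q None})"
  proof (rule bij_betw_imageI)
    show "inj (q \<circ> Some \<circ> e)" using q e by (auto simp: bij_def inj_on_def)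
    have "range (q \<circ> Some \<circ> e) = q ` Some ` range e" by auto
    also have "\<dots> = q ` (UNIV - {None})" using e by (auto simp: bij_def UNIV_option_conv)
    also have "\<dots> = range q - {q None}" using q by (auto simp: inj_on_def)
    finally show "range (q \<circ> Some \<circ> e) = range q - {q None}" .
  qed
  then have "measure lborel (convex hull (range q)) = \<bar>det A\<bar> / fact CARD('n)"
    using content_simplex[of "range q" "q None" "q \<circ> Some \<circ> e"] cq
    by (simp add: det card_ordered_copy)
  moreover have "compact (convex hull (range q))" "compact (convex hull (range p))"
    by (intro finite_imp_compact_convex_hull; simp)+
  moreover have "convex hull (range q) = L ` (convex hull (range p))"
    using convex_hull_linear_image[OF L] by (simp add: q_def image_comp)
  ultimately have "measure lebesgue (convex hull (range p)) = \<bar>det A\<bar> / fact CARD('n)"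
    using measure_lebesgue_reindex[OF e, of "convex hull (range p)"]
    by (simp add: borel_compact L_def[abs_def])
  then show ?thesis by (simp add: A_def)
qed

section \<open>Integer pairings\<close>

definition int_dot :: "int ^ 'm \<Rightarrow> int ^ 'm \<Rightarrow> int" where
  "int_dot a v = (\<Sum>r\<in>UNIV. a $ r * v $ r)"

lemma inner_of_int_vec: "of_int_vec a \<bullet> of_int_vec v = real_of_int (int_dot a v)"
  by (simp add: int_dot_def of_int_vec_def inner_vec_def)

lemma int_dot_add: "int_dot a (v + w) = int_dot a v + int_dot a w"
  by (simp add: int_dot_def algebra_simps sum.distrib)

lemma int_dot_smult: "int_dot a (c *s v) = c * int_dot a v"
  by (simp add: int_dot_def sum_distrib_left algebra_simps)

lemma int_dot_diff: "int_dot a (v - w) = int_dot a v - int_dot a w"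
  by (simp add: int_dot_def algebra_simps sum_subtractf)

lemma int_dot_sum: "int_dot a (\<Sum>i\<in>S. f i) = (\<Sum>i\<in>S. int_dot a (f i))"
  by (induction S rule: infinite_finite_induct) (simp_all add: int_dot_add, simp_all add: int_dot_def)

lemma of_int_vec_add: "of_int_vec (v + w) = of_int_vec v + of_int_vec w"
  by (simp add: of_int_vec_def vec_eq_iff)

lemma of_int_vec_diff: "of_int_vec (v - w) = of_int_vec v - of_int_vec w"
  by (simp add: of_int_vec_def vec_eq_iff)

lemma of_int_vec_smult: "of_int_vec (c *s v) = real_of_int c *\<^sub>R of_int_vec v"
  by (simp add: of_int_vec_def vec_eq_iff)

lemma of_int_vec_0 [simp]: "of_int_vec 0 = 0"
  by (simp add: of_int_vec_def vec_eq_iff)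

lemma of_int_vec_sum: "of_int_vec (\<Sum>i\<in>S. f i) = (\<Sum>i\<in>S. of_int_vec (f i))"
  by (induction S rule: infinite_finite_induct) (simp_all add: of_int_vec_add)

lemma of_int_vec_eq_iff [simp]: "of_int_vec v = of_int_vec w \<longleftrightarrow> v = w"
  by (simp add: of_int_vec_def vec_eq_iff)

text \<open>
  For normals belonging to an integral basis, the dual basis supplies such integral functionals.
  Goodness enters the analysis of the group action in this form.
\<close>

definition dual_on :: "('d \<Rightarrow> int ^ 'm) \<Rightarrow> 'd set \<Rightarrow> ('d \<Rightarrow> int ^ 'm) \<Rightarrow> bool" where
  "dual_on \<nu> J \<mu> \<longleftrightarrow> (\<forall>i\<in>J. \<forall>j\<in>J. int_dot (\<mu> i) (\<nu> j) = (if i = j then 1 else 0))"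

text \<open>
  The coordinates of \<open>v\<close> are additive in \<open>v\<close> by uniqueness, hence are given by the coordinates
  of the unit vectors.
\<close>

lemma integral_basis_dual:
  fixes B :: "'m::finite \<Rightarrow> int ^ 'm"
  assumes "integral_basis B"
  obtains D where "\<forall>v. v = (\<Sum>i\<in>UNIV. int_dot (D i) v *s B i)" "dual_on B UNIV D"
proof -
  obtain c where c: "\<And>v. v = (\<Sum>i\<in>UNIV. c v $ i *s B i)"
    and uniq: "\<And>v c'. v = (\<Sum>i\<in>UNIV. c' $ i *s B i) \<Longrightarrow> c' = c v"
    using assms unfolding integral_basis_def by metis
  define D where "D i = (\<chi> r. c (axis r 1) $ i)" for i
  have D: "v = (\<Sum>i\<in>UNIV. int_dot (D i) v *s B i)" for v
  proof -
    have "v = (\<Sum>r\<in>UNIV. v $ r *s axis r 1)" by (rule basis_expansion[symmetric])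
    also have "\<dots> = (\<Sum>r\<in>UNIV. v $ r *s (\<Sum>i\<in>UNIV. c (axis r 1) $ i *s B i))"
      using c by simp
    also have "\<dots> = (\<Sum>r\<in>UNIV. \<Sum>i\<in>UNIV. (v $ r * c (axis r 1) $ i) *s B i)"
      by (simp add: vec_eq_iff sum_distrib_left mult.assoc)
    also have "\<dots> = (\<Sum>i\<in>UNIV. int_dot (D i) v *s B i)"
      by (subst sum.swap) (simp add: int_dot_def D_def vec_eq_iff sum_distrib_left sum_distrib_right mult_ac)
    finally show ?thesis .
  qed
  have "int_dot (D i) (B k) = (if i = k then 1 else 0)" for i k
  proof -
    have "(\<chi> i. int_dot (D i) (B k)) = c (B k)" by (rule uniq) (simp add: D[symmetric])
    moreover have "axis k 1 = c (B k)"
      by (rule uniq) (simp add: axis_def if_distrib[of "\<lambda>x. x *s _"] sum.delta cong: if_cong)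
    ultimately have "(\<chi> i. int_dot (D i) (B k)) = axis k 1" by simp
    then show ?thesis by (auto simp: vec_eq_iff axis_def)
  qed
  then have "dual_on B UNIV D" by (simp add: dual_on_def)
  moreover have "\<forall>v. v = (\<Sum>i\<in>UNIV. int_dot (D i) v *s B i)" using D by (rule allI)
  ultimately show ?thesis using that by blast
qed

section \<open>Faces of a good cone\<close>

text \<open>
  The facets containing \<open>x\<close>, when \<open>x\<close> lies in the cone.
\<close>

definition tight :: "('d \<Rightarrow> int ^ 'm::finite) \<Rightarrow> real ^ 'm \<Rightarrow> 'd set" where
  "tight \<nu> x = {j. x \<bullet> of_int_vec (\<nu> j) = 0}"

lemma mem_good_cone:
  "good_cone C \<nu> \<Longrightarrow> x \<in> C \<longleftrightarrow> (\<forall>j. 0 \<le> x \<bullet> of_int_vec (\<nu> j))"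
  by (auto simp: good_cone_def halfspace_of_def)

lemma good_cone_pointed: "good_cone C \<nu> \<Longrightarrow> x \<in> C \<Longrightarrow> - x \<in> C \<Longrightarrow> x = 0"
  by (simp add: good_cone_def)

lemma good_cone_nonzero_normal: "good_cone C \<nu> \<Longrightarrow> \<nu> j \<noteq> 0"
proof
  assume "good_cone C \<nu>" "\<nu> j = 0"
  then have "primitive_vec (0 :: int ^ 'a option)" unfolding good_cone_def by metis
  then show False by (simp add: primitive_vec_def image_constant_conv)
qed

lemma good_cone_card: "good_cone C (\<nu> :: 'd::finite \<Rightarrow> int ^ 'n::finite option) \<Longrightarrow> CARD('n) + 1 \<le> CARD('d)"
  by (simp add: good_cone_def)

lemma good_cone_convex:
  assumes "good_cone C \<nu>"
  shows "convex C"
proof -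
  have "C = (\<Inter>j. {x. of_int_vec (\<nu> j) \<bullet> x \<ge> 0})"
    using mem_good_cone[OF assms] by (auto simp: inner_commute)
  also have "convex \<dots>" by (intro convex_INT convex_halfspace_ge)
  finally show ?thesis .
qed

lemma good_cone_irredundant:
  assumes "good_cone C \<nu>"
  obtains q where "\<And>i. i \<noteq> j \<Longrightarrow> 0 \<le> q \<bullet> of_int_vec (\<nu> i)" "q \<bullet> of_int_vec (\<nu> j) < 0"
proof -
  have "(\<Inter>i\<in>- {j}. halfspace_of (\<nu> i)) \<noteq> C" "C \<subseteq> (\<Inter>i\<in>- {j}. halfspace_of (\<nu> i))"
    using assms by (auto simp: good_cone_def)
  then obtain q where q: "q \<in> (\<Inter>i\<in>- {j}. halfspace_of (\<nu> i))" "q \<notin> C" by blast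
  then have 1: "0 \<le> q \<bullet> of_int_vec (\<nu> i)" if "i \<noteq> j" for i using that by (auto simp: halfspace_of_def)
  moreover have "q \<bullet> of_int_vec (\<nu> j) < 0"
    using q(2) mem_good_cone[OF assms] 1 by (metis not_le)
  ultimately show ?thesis using that by blast
qed

lemma good_cone_inj:
  assumes "good_cone C \<nu>"
  shows "inj \<nu>"
proof (rule injI, rule ccontr)
  fix i j assume ij: "\<nu> i = \<nu> j" "i \<noteq> j"
  obtain q where "\<And>i. i \<noteq> j \<Longrightarrow> 0 \<le> q \<bullet> of_int_vec (\<nu> i)" "q \<bullet> of_int_vec (\<nu> j) < 0"
    using good_cone_irredundant[OF assms, where j = j] by metis
  from this(1)[OF ij(2)] this(2) ij(1) show False by simp
qed

lemma good_cone_interior_point: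
  assumes "good_cone C \<nu>"
  obtains p where "\<And>j. 0 < p \<bullet> of_int_vec (\<nu> j)"
proof -
  obtain p where p: "p \<in> interior C" using assms by (auto simp: good_cone_def)
  have "0 < p \<bullet> of_int_vec (\<nu> j)" for j
  proof -
    have "C \<subseteq> {x. of_int_vec (\<nu> j) \<bullet> x \<ge> 0}"
      using mem_good_cone[OF assms] by (auto simp: inner_commute)
    then have "p \<in> interior {x. of_int_vec (\<nu> j) \<bullet> x \<ge> 0}" using p interior_mono by blast
    moreover have "of_int_vec (\<nu> j) \<noteq> 0"
      using good_cone_nonzero_normal[OF assms, of j] of_int_vec_eq_iff[of "\<nu> j" 0] by simp
    ultimately show ?thesis by (subst inner_commute) simp
  qed
  then show ?thesis using that by blast
qed

text \<open>
  The smallest face containing \<open>x\<close> is cut out of the cone by the sum of the normals tight at \<open>x\<close>.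
  It contains \<open>0\<close> and \<open>x\<close> and lies in a hyperplane, so its codimension is between \<open>1\<close> and \<open>n\<close> and
  the definition of a good cone applies to it.
\<close>

lemma good_cone_tight_face:
  fixes C :: "(real ^ 'n::finite option) set"
  assumes good: "good_cone C \<nu>" and x: "x \<in> C" "x \<noteq> 0" and ne: "tight \<nu> x \<noteq> {}"
  obtains B where "integral_basis B" "\<nu> ` tight \<nu> x \<subseteq> range B" "card (tight \<nu> x) \<le> CARD('n)"
proof -
  let ?J = "tight \<nu> x"
  define a where "a = (\<Sum>j\<in>?J. of_int_vec (\<nu> j))"
  define F where "F = C \<inter> {y. a \<bullet> y = 0}"
  have a: "a \<bullet> y = (\<Sum>j\<in>?J. y \<bullet> of_int_vec (\<nu> j))" for y
    by (simp add: a_def inner_commute[of _ y] inner_sum_right)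
  have F: "y \<in> F \<longleftrightarrow> y \<in> C \<and> (\<forall>j\<in>?J. y \<bullet> of_int_vec (\<nu> j) = 0)" for y
    by (auto simp: F_def a mem_good_cone[OF good] sum_nonneg_eq_0_iff)
  have face: "F face_of C"
    unfolding F_def using good_cone_convex[OF good]
    by (rule face_of_Int_supporting_hyperplane_ge) (auto simp: a mem_good_cone[OF good] intro!: sum_nonneg)
  have "{0, x} \<subseteq> F"
    using x by (auto simp: F tight_def mem_good_cone[OF good])
  then have "aff_dim {0, x} \<le> aff_dim F" by (rule aff_dim_subset)
  then have dim1: "1 \<le> aff_dim F" using x by (simp add: aff_dim_2)
  obtain j where j: "j \<in> ?J" using ne by blast
  have "F \<subseteq> {y. of_int_vec (\<nu> j) \<bullet> y = 0}" using j by (auto simp: F inner_commute)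
  moreover have "of_int_vec (\<nu> j) \<noteq> 0"
    using good_cone_nonzero_normal[OF good, of j] of_int_vec_eq_iff[of "\<nu> j" 0] by simp
  ultimately have dim2: "aff_dim F \<le> int CARD('n)"
    using aff_dim_subset[of F "{y. of_int_vec (\<nu> j) \<bullet> y = 0}"] by simp
  define k where "k = nat (int (CARD('n) + 1) - aff_dim F)"
  have k: "1 \<le> k" "k \<le> CARD('n)" "aff_dim F = int (CARD('n) + 1) - int k"
    using dim1 dim2 by (auto simp: k_def)
  have facets: "{j. F \<subseteq> normal_facet \<nu> j} = ?J"
  proof -
    have "C = (\<Inter>i. halfspace_of (\<nu> i))" using good by (simp add: good_cone_def)
    then have "normal_facet \<nu> j = C \<inter> {y. y \<bullet> of_int_vec (\<nu> j) = 0}" for j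
      by (simp add: normal_facet_def)
    then show ?thesis using \<open>{0, x} \<subseteq> F\<close> F by (auto simp: tight_def)
  qed
  have "let J = {j. F \<subseteq> normal_facet \<nu> j} in
           card J = k \<and> F = (\<Inter>j\<in>J. normal_facet \<nu> j) \<and>
           (\<exists>B. integral_basis B \<and> \<nu> ` J \<subseteq> range B)"
    using good[unfolded good_cone_def, THEN conjunct2, THEN conjunct2, THEN conjunct2, THEN conjunct2,
        THEN conjunct2, THEN conjunct2, rule_format, of k F] k face by simp
  then have *: "card ?J = k" "\<exists>B. integral_basis B \<and> \<nu> ` ?J \<subseteq> range B"
    unfolding facets Let_def by blast+
  then obtain B where "integral_basis B" "\<nu> ` ?J \<subseteq> range B" by blast
  then show ?thesis by (rule that) (use *(1) k(2) in linarith)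
qed

lemma good_cone_tight_dual:
  fixes C :: "(real ^ 'n::finite option) set"
  assumes good: "good_cone C \<nu>" and x: "x \<in> C" "x \<noteq> 0"
  obtains \<mu> where "dual_on \<nu> (tight \<nu> x) \<mu>"
proof (cases "tight \<nu> x = {}")
  case True
  then show ?thesis using that by (auto simp: dual_on_def)
next
  case False
  obtain B where B: "integral_basis B" "\<nu> ` tight \<nu> x \<subseteq> range B"
    by (rule good_cone_tight_face[OF good x False])
  obtain D where D: "dual_on B UNIV D" by (rule integral_basis_dual[OF B(1)])
  have "\<forall>j\<in>tight \<nu> x. \<exists>k. \<nu> j = B k" using B(2) by blast
  then obtain k where k: "\<And>j. j \<in> tight \<nu> x \<Longrightarrow> \<nu> j = B (k j)" by metis
  have "dual_on \<nu> (tight \<nu> x) (D \<circ> k)"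
    using D k good_cone_inj[OF good] by (auto simp: dual_on_def inj_def)
  then show ?thesis by (rule that)
qed

text \<open>
  The sets of facets of the faces of dimension at least one.
\<close>

definition admissible :: "(real ^ 'm::finite) set \<Rightarrow> ('d \<Rightarrow> int ^ 'm) \<Rightarrow> 'd set set" where
  "admissible C \<nu> = tight \<nu> ` (C - {0})"

text \<open>
  Since the tight normals have dual functionals, a small displacement of \<open>x\<close> leaves any prescribed
  part of the facets through \<open>x\<close> while staying on the others.
\<close>

lemma admissible_subset:
  fixes C :: "(real ^ 'n::finite option) set" and \<nu> :: "'d::finite \<Rightarrow> int ^ 'n option"
  assumes good: "good_cone C \<nu>" and J: "J \<in> admissible C \<nu>" and I: "I \<subseteq> J"
  shows "I \<in> admissible C \<nu>"
proof (cases "I = J")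
  case False
  obtain x where x: "x \<in> C" "x \<noteq> 0" "J = tight \<nu> x" using J by (auto simp: admissible_def)
  obtain \<mu> where \<mu>: "dual_on \<nu> J \<mu>" using good_cone_tight_dual[OF good x(1,2)] x(3) by metis
  define u where "u = (\<Sum>i\<in>J - I. of_int_vec (\<mu> i))"
  have u: "u \<bullet> of_int_vec (\<nu> j) = (if j \<in> I then 0 else 1)" if "j \<in> J" for j
  proof -
    have "u \<bullet> of_int_vec (\<nu> j) = (\<Sum>i\<in>J - I. if i = j then 1 else 0)"
      unfolding u_def inner_sum_left inner_of_int_vec
      using \<mu> that by (intro sum.cong) (auto simp: dual_on_def)
    then show ?thesis using that by simp
  qed
  have pos: "0 < x \<bullet> of_int_vec (\<nu> j)" if "j \<notin> J" for j
    using x(1,3) that mem_good_cone[OF good] by (force simp: tight_def order_less_le)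
  have "\<forall>\<^sub>F e in at_right 0. \<forall>j\<in>- J. 0 < (x + e *\<^sub>R u) \<bullet> of_int_vec (\<nu> j)"
  proof (intro eventually_ball_finite ballI)
    fix j assume "j \<in> - J"
    have "0 < (x + 0 *\<^sub>R u) \<bullet> of_int_vec (\<nu> j)" using pos \<open>j \<in> - J\<close> by simp
    moreover have "((\<lambda>e. (x + e *\<^sub>R u) \<bullet> of_int_vec (\<nu> j)) \<longlongrightarrow> (x + 0 *\<^sub>R u) \<bullet> of_int_vec (\<nu> j)) (at_right 0)"
      by (intro tendsto_intros)
    ultimately show "\<forall>\<^sub>F e in at_right 0. 0 < (x + e *\<^sub>R u) \<bullet> of_int_vec (\<nu> j)"
      by (rule order_tendstoD(1)[rotated])
  qed simp
  moreover have "\<forall>\<^sub>F e in at_right (0::real). 0 < e" by (rule eventually_at_right_less)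
  ultimately obtain e :: real where e: "0 < e" "\<And>j. j \<notin> J \<Longrightarrow> 0 < (x + e *\<^sub>R u) \<bullet> of_int_vec (\<nu> j)"
    using eventually_happens'[OF trivial_limit_at_right_real eventually_conj] by blast
  define y where "y = x + e *\<^sub>R u"
  have yJ: "y \<bullet> of_int_vec (\<nu> j) = (if j \<in> I then 0 else e)" if "j \<in> J" for j
    using that x(3) by (simp add: y_def inner_add_left u tight_def)
  have ynJ: "0 < y \<bullet> of_int_vec (\<nu> j)" if "j \<notin> J" for j
    using e(2)[OF that] by (simp add: y_def)
  have "0 \<le> y \<bullet> of_int_vec (\<nu> j)" for j
    using yJ[of j] ynJ[of j] e(1) by (cases "j \<in> J") simp_all
  then have "y \<in> C" by (simp add: mem_good_cone[OF good])
  moreover have "j \<in> tight \<nu> y \<longleftrightarrow> j \<in> I" for j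
    using yJ[of j] ynJ[of j] e(1) I by (cases "j \<in> J") (auto simp: tight_def)
  then have "tight \<nu> y = I" by blast
  moreover have "y \<noteq> 0"
  proof
    assume "y = 0"
    obtain j where "j \<in> J" "j \<notin> I" using False I by blast
    then show False using yJ[of j] e \<open>y = 0\<close> by simp
  qed
  ultimately show ?thesis by (auto simp: admissible_def)
qed (use J in simp)

text \<open>
  The normal \<open>j\<close> is not redundant, so the segment from an interior point \<open>p\<close> to a point \<open>q\<close>
  violating only that normal crosses its facet away from the others.
\<close>

lemma admissible_singleton:
  fixes C :: "(real ^ 'n::finite option) set" and \<nu> :: "'d::finite \<Rightarrow> int ^ 'n option"
  assumes good: "good_cone C \<nu>"
  shows "{j} \<in> admissible C \<nu>"
proof -
  obtain p where p: "\<And>i. 0 < p \<bullet> of_int_vec (\<nu> i)" using good_cone_interior_point[OF good] by blast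
  obtain q where q: "\<And>i. i \<noteq> j \<Longrightarrow> 0 \<le> q \<bullet> of_int_vec (\<nu> i)" "q \<bullet> of_int_vec (\<nu> j) < 0"
    using good_cone_irredundant[OF good] by metis
  define s where "s = - (q \<bullet> of_int_vec (\<nu> j))"
  define t where "t = p \<bullet> of_int_vec (\<nu> j)"
  have st: "s > 0" "t > 0" using p q by (auto simp: s_def t_def)
  \<comment> \<open>A positive multiple of the crossing point of the segment with the facet.\<close>
  define x where "x = s *\<^sub>R p + t *\<^sub>R q"
  have xj: "x \<bullet> of_int_vec (\<nu> j) = 0" by (simp add: x_def inner_add_left inner_diff_left s_def t_def)
  have xi: "0 < x \<bullet> of_int_vec (\<nu> i)" if "i \<noteq> j" for i
    using p[of i] q(1)[OF that] st by (simp add: x_def inner_add_left add_pos_nonneg)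
  have "\<exists>i. i \<noteq> j"
  proof (rule ccontr)
    assume "\<not> (\<exists>i. i \<noteq> j)"
    then have "(UNIV :: 'd set) = {j}" by auto
    then have "card (UNIV :: 'd set) = card {j}" by (rule arg_cong)
    then show False using good_cone_card[OF good] by simp
  qed
  then have "x \<noteq> 0" using xi by (metis inner_zero_left less_irrefl)
  moreover have "x \<in> C" using xj xi by (metis mem_good_cone[OF good] less_eq_real_def)
  moreover have "tight \<nu> x = {j}" using xj xi by (force simp: tight_def)
  ultimately show ?thesis by (auto simp: admissible_def)
qed

lemma not_admissible_two_elements:
  fixes C :: "(real ^ 'n::finite option) set" and \<nu> :: "'d::finite \<Rightarrow> int ^ 'n option"
  assumes good: "good_cone C \<nu>" and J: "J \<notin> admissible C \<nu>"
  shows "\<exists>i\<in>J. \<exists>j\<in>J. i \<noteq> j"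
proof (rule ccontr)
  assume "\<not> ?thesis"
  then have "\<exists>i. J \<subseteq> {i}" by blast
  then show False using J admissible_subset[OF good admissible_singleton[OF good]] by blast
qed

text \<open>
  A nonzero point lying on as many facets as possible. If these were fewer than \<open>n\<close>, one could
  move within all of them in a direction orthogonal to the point itself; as the cone contains no
  line, the motion runs into a further facet, and orthogonality keeps the point nonzero.
\<close>

lemma good_cone_ray:
  fixes C :: "(real ^ 'n::finite option) set" and \<nu> :: "'d::finite \<Rightarrow> int ^ 'n option"
  assumes good: "good_cone C \<nu>"
  obtains x where "x \<in> C" "x \<noteq> 0" "card (tight \<nu> x) = CARD('n)"
proof -
  have "admissible C \<nu> \<noteq> {}" using admissible_singleton[OF good] by blast
  then have "C - {0} \<noteq> {}" by (auto simp: admissible_def)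
  then obtain x0 where "x0 \<in> C - {0}" by blast
  moreover have "\<forall>y. y \<in> C - {0} \<longrightarrow> card (tight \<nu> y) < Suc CARD('d)"
    by (simp add: less_Suc_eq_le card_mono)
  ultimately have "\<exists>x. x \<in> C - {0} \<and> (\<forall>y. y \<in> C - {0} \<longrightarrow> card (tight \<nu> y) \<le> card (tight \<nu> x))"
    by (rule ex_has_greatest_nat)
  then obtain x where x: "x \<in> C - {0}"
    and max: "\<And>y. y \<in> C - {0} \<Longrightarrow> card (tight \<nu> y) \<le> card (tight \<nu> x)"
    by blast
  let ?J = "tight \<nu> x"
  have le: "card ?J \<le> CARD('n)"
  proof (cases "?J = {}")
    case False
    show ?thesis by (rule good_cone_tight_face[OF good _ _ False]) (use x in auto)
  qed simp
  have "\<not> card ?J < CARD('n)"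
  proof
    assume less: "card ?J < CARD('n)"
    have "dim (insert x ((\<lambda>j. of_int_vec (\<nu> j)) ` ?J)) \<le> card (insert x ((\<lambda>j. of_int_vec (\<nu> j)) ` ?J))"
      by (rule dim_le_card') simp
    also have "\<dots> \<le> Suc (card ((\<lambda>j. of_int_vec (\<nu> j)) ` ?J))"
      by (simp add: card_insert_if)
    also have "\<dots> \<le> Suc (card ?J)" by (simp add: card_image_le)
    finally have "dim (insert x ((\<lambda>j. of_int_vec (\<nu> j)) ` ?J)) < DIM(real ^ 'n option)"
      using less by simp
    then obtain u0 where u0: "u0 \<noteq> 0" "\<And>y. y \<in> span (insert x ((\<lambda>j. of_int_vec (\<nu> j)) ` ?J)) \<Longrightarrow> orthogonal u0 y"
      using orthogonal_to_subspace_exists by metis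
    obtain u where u: "u \<noteq> 0" "u = u0 \<or> u = - u0" "u \<notin> C"
      using good_cone_pointed[OF good, of u0] u0(1) by (metis neg_equal_0_iff_equal)
    have ux: "u \<bullet> x = 0" 
      using u0(2)[OF span_base, of x] u(2) by (auto simp: orthogonal_def)
    have uJ: "u \<bullet> of_int_vec (\<nu> j) = 0" if "j \<in> ?J" for j
      using u0(2)[OF span_base, of "of_int_vec (\<nu> j)"] u(2) that by (auto simp: orthogonal_def)
    \<comment> \<open>The normals that eventually become negative along \<open>x + t u\<close>, and the time \<open>r j\<close> when each of them vanishes.\<close>
    define K where "K = {j. u \<bullet> of_int_vec (\<nu> j) < 0}"
    have K: "K \<noteq> {}" using u(3) by (auto simp: K_def mem_good_cone[OF good] not_le)
    define r where "r j = x \<bullet> of_int_vec (\<nu> j) / - (u \<bullet> of_int_vec (\<nu> j))" for j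
    define t where "t = Min (r ` K)"
    have "t \<in> r ` K" unfolding t_def by (rule Min_in) (use K in auto)
    then obtain k where k: "k \<in> K" "t = r k" by blast
    have t: "t \<le> r j" if "j \<in> K" for j unfolding t_def using that by simp
    have xC: "0 \<le> x \<bullet> of_int_vec (\<nu> j)" for j using x mem_good_cone[OF good] by blast
    have t0: "0 \<le> t" using k xC by (simp add: r_def K_def divide_nonneg_neg)
    define y where "y = x + t *\<^sub>R u"
    have yj: "y \<bullet> of_int_vec (\<nu> j) = x \<bullet> of_int_vec (\<nu> j) + t * (u \<bullet> of_int_vec (\<nu> j))" for j
      by (simp add: y_def inner_add_left)
    have "0 \<le> y \<bullet> of_int_vec (\<nu> j)" for j
    proof (cases "j \<in> K")
      case True
      then show ?thesis using t[OF True] by (simp add: yj r_def K_def field_simps)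
    next
      case False
      then show ?thesis using t0 xC[of j] by (simp add: yj K_def)
    qed
    then have "y \<in> C" by (simp add: mem_good_cone[OF good])
    moreover have "y \<bullet> x = x \<bullet> x" by (simp add: y_def inner_add_left ux)
    then have "y \<noteq> 0" using x by auto
    moreover have "insert k ?J \<subseteq> tight \<nu> y"
      using k uJ by (auto simp: tight_def yj r_def K_def)
    moreover have "k \<notin> ?J" using uJ k by (auto simp: K_def)
    ultimately show False
      using max[of y] card_mono[of "tight \<nu> y" "insert k ?J"] by auto
  qed
  then show ?thesis using le x that by auto
qed

section \<open>The lattice spanned by the normals\<close>

definition normal_lattice :: "('d::finite \<Rightarrow> int ^ 'm) \<Rightarrow> (int ^ 'm) set" where
  "normal_lattice \<nu> = range (\<lambda>a :: int ^ 'd. \<Sum>j\<in>UNIV. a $ j *s \<nu> j)"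

lemma normal_lattice_add: "v \<in> normal_lattice \<nu> \<Longrightarrow> w \<in> normal_lattice \<nu> \<Longrightarrow> v + w \<in> normal_lattice \<nu>"
proof -
  assume "v \<in> normal_lattice \<nu>" "w \<in> normal_lattice \<nu>"
  then obtain a b where "v = (\<Sum>j\<in>UNIV. a $ j *s \<nu> j)" "w = (\<Sum>j\<in>UNIV. b $ j *s \<nu> j)"
    by (auto simp: normal_lattice_def)
  then have "v + w = (\<Sum>j\<in>UNIV. (a + b) $ j *s \<nu> j)"
    by (simp add: vec_eq_iff algebra_simps sum.distrib)
  then show ?thesis unfolding normal_lattice_def by (rule image_eqI) simp
qed

lemma normal_lattice_smult: "v \<in> normal_lattice \<nu> \<Longrightarrow> c *s v \<in> normal_lattice \<nu>"
proof -
  assume "v \<in> normal_lattice \<nu>"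
  then obtain a where "v = (\<Sum>j\<in>UNIV. a $ j *s \<nu> j)" by (auto simp: normal_lattice_def)
  then have "c *s v = (\<Sum>j\<in>UNIV. (c *s a) $ j *s \<nu> j)"
    by (simp add: vec_eq_iff sum_distrib_left mult.assoc)
  then show ?thesis unfolding normal_lattice_def by (rule image_eqI) simp
qed

lemma normal_lattice_0: "0 \<in> normal_lattice \<nu>"
  unfolding normal_lattice_def by (auto simp: image_iff vec_eq_iff intro!: exI[of _ 0])

lemma normal_lattice_sum:
  "(\<And>i. i \<in> S \<Longrightarrow> f i \<in> normal_lattice \<nu>) \<Longrightarrow> (\<Sum>i\<in>S. f i) \<in> normal_lattice \<nu>"
  by (induction S rule: infinite_finite_induct) (auto simp: normal_lattice_0 normal_lattice_add)

lemma normal_in_normal_lattice: "\<nu> j \<in> normal_lattice \<nu>"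
proof -
  have "(\<Sum>i\<in>UNIV. axis j 1 $ i *s \<nu> i) = (\<Sum>i\<in>UNIV. if i = j then \<nu> i else 0)"
    by (intro sum.cong) (auto simp: axis_def)
  also have "\<dots> = \<nu> j" by simp
  finally show ?thesis unfolding normal_lattice_def by (intro image_eqI[of _ _ "axis j 1"]) simp_all
qed

lemma Gcd_bezout:
  fixes f :: "'a \<Rightarrow> int"
  assumes "finite S"
  shows "\<exists>c. (\<Sum>s\<in>S. c s * f s) = Gcd (f ` S)"
  using assms
proof (induction S rule: finite_induct)
  case (insert s S)
  obtain c where c: "(\<Sum>s\<in>S. c s * f s) = Gcd (f ` S)" using insert.IH by blast
  obtain u v where uv: "u * f s + v * Gcd (f ` S) = gcd (f s) (Gcd (f ` S))"
    using bezout_int by blast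
  have "(\<Sum>x\<in>insert s S. (if x = s then u else v * c x) * f x) = u * f s + (\<Sum>x\<in>S. v * c x * f x)"
    using insert.hyps by (subst sum.insert) (auto intro!: sum.cong)
  also have "(\<Sum>x\<in>S. v * c x * f x) = v * Gcd (f ` S)"
    by (simp add: c[symmetric] sum_distrib_left mult.assoc)
  finally show ?case using uv by (intro exI) simp
qed simp

text \<open>
  Choose an extreme ray. Its \<open>n\<close> normals together with one vector \<open>B k0\<close> form an integral basis,
  and \<open>\<beta>\<close> is the coordinate along \<open>B k0\<close>. Subtracting a combination of all normals with the right
  value of \<open>\<beta>\<close> leaves a combination of the \<open>n\<close> normals, so membership in the lattice is divisibility
  of \<open>\<beta> v\<close> by the greatest common divisor \<open>g\<close> of the values \<open>\<beta> (\<nu> j)\<close>. In the coordinates of this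
  basis a maximal minor has a row of values of \<open>\<beta>\<close>, hence is divisible by \<open>g\<close>; and taking the \<open>n\<close>
  normals of the ray with \<open>\<nu> j\<close> in the remaining column gives \<open>\<beta> (\<nu> j)\<close> itself up to sign.
\<close>

theorem good_cone_lattice_functional:
  fixes C :: "(real ^ 'n::finite option) set" and \<nu> :: "'d::finite \<Rightarrow> int ^ 'n option"
  assumes good: "good_cone C \<nu>"
    and N: "int N = Gcd {det (normal_matrix \<nu> i) | i. inj i}"
  obtains \<beta> where "\<And>v. v \<in> normal_lattice \<nu> \<longleftrightarrow> int N dvd int_dot \<beta> v" "\<exists>b. int_dot \<beta> b = 1" "N > 0"
proof -
  obtain x where x: "x \<in> C" "x \<noteq> 0" "card (tight \<nu> x) = CARD('n)" by (rule good_cone_ray[OF good])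
  let ?J = "tight \<nu> x"
  have "?J \<noteq> {}" using x(3) by auto
  then obtain B where B: "integral_basis B" "\<nu> ` ?J \<subseteq> range B"
    by (rule good_cone_tight_face[OF good x(1,2)])
  obtain D where D: "\<forall>v. v = (\<Sum>i\<in>UNIV. int_dot (D i) v *s B i)" "dual_on B UNIV D"
    by (rule integral_basis_dual[OF B(1)])
  have DB: "int_dot (D i) (B k) = (if i = k then 1 else 0)" for i k
    using D(2) by (simp add: dual_on_def)
  have injB: "inj B"
  proof (rule injI)
    fix a b assume "B a = B b"
    then have "int_dot (D a) (B a) = int_dot (D a) (B b)" by simp
    then show "a = b" by (simp add: DB split: if_splits)
  qed
  have "card (B -` (\<nu> ` ?J)) = card (\<nu> ` ?J)"
    by (rule card_vimage_inj[OF injB B(2)])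
  also have "\<dots> = CARD('n)"
    using good_cone_inj[OF good] x(3) by (simp add: card_image inj_on_subset)
  finally have "card (- (B -` (\<nu> ` ?J))) = 1" 
    by (simp add: Compl_eq_Diff_UNIV card_Diff_subset)
  then obtain k0 where k0: "- (B -` (\<nu> ` ?J)) = {k0}" by (auto simp: card_1_singleton_iff)
  then have "\<forall>k. \<exists>j. k \<noteq> k0 \<longrightarrow> j \<in> ?J \<and> B k = \<nu> j" by blast
  then obtain e where e: "\<And>k. k \<noteq> k0 \<Longrightarrow> e k \<in> ?J" "\<And>k. k \<noteq> k0 \<Longrightarrow> \<nu> (e k) = B k" by metis
  have \<beta>J: "int_dot (D k0) (\<nu> j) = 0" if "j \<in> ?J" for j
  proof -
    obtain k where k: "\<nu> j = B k" using B(2) \<open>j \<in> ?J\<close> by blast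
    moreover have "k \<notin> {k0}" using \<open>j \<in> ?J\<close> by (auto simp: k0[symmetric] k[symmetric])
    ultimately show ?thesis by (simp add: DB)
  qed
  define \<beta> where "\<beta> = D k0"
  define g where "g = Gcd (range (\<lambda>j. int_dot \<beta> (\<nu> j)))"
  have g: "g dvd int_dot \<beta> (\<nu> j)" for j unfolding g_def by simp
  \<comment> \<open>The change of coordinates to the basis \<open>B\<close>; its determinant is a unit.\<close>
  define Dm where "Dm = (\<chi> i r. D i $ r)"
  define M where "M = (\<chi> r c. B c $ r)"
  have "Dm ** M = mat 1"
    using DB by (simp add: vec_eq_iff Dm_def M_def matrix_matrix_mult_def mat_def int_dot_def)
  then have detDM: "det Dm * det M = 1" using det_mul[of Dm M] by simp
  have coef: "(Dm ** normal_matrix \<nu> i) $ k $ c = int_dot (D k) (\<nu> (i c))" for i k c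
    by (simp add: Dm_def normal_matrix_def matrix_matrix_mult_def int_dot_def)
  have minor: "det (normal_matrix \<nu> i) = det M * det (Dm ** normal_matrix \<nu> i)" for i
    using detDM by (simp add: det_mul mult.assoc[symmetric] mult.commute)
  have "g dvd det (normal_matrix \<nu> i)" for i
  proof -
    have "g dvd (\<Prod>k\<in>UNIV. (Dm ** normal_matrix \<nu> i) $ k $ p k)" for p
      by (rule dvd_trans[of _ "(Dm ** normal_matrix \<nu> i) $ k0 $ p k0"])
        (use g in \<open>auto simp: coef \<beta>_def intro: dvd_prodI\<close>)
    then have "g dvd det (Dm ** normal_matrix \<nu> i)"
      unfolding det_def by (intro dvd_sum dvd_mult)
    then show ?thesis unfolding minor by (rule dvd_mult)
  qed
  then have 1: "g dvd int N" unfolding N by (intro Gcd_greatest) auto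
  have "int N dvd int_dot \<beta> (\<nu> j)" for j
  proof (cases "j \<in> ?J")
    case False
    let ?i = "e(k0 := j)"
    \<comment> \<open>The columns of \<open>?i\<close> are the normals of the ray, with \<open>\<nu> j\<close> in the column \<open>k0\<close>.\<close>
    have "inj ?i"
    proof (rule injI)
      fix a b assume ab: "?i a = ?i b"
      have "e a \<noteq> e b" if "a \<noteq> k0" "b \<noteq> k0" "a \<noteq> b"
        using e(2)[OF that(1)] e(2)[OF that(2)] that(3) injB by (metis injD)
      then show "a = b" using ab e(1) False by (auto split: if_splits)
    qed
    then have "int N dvd det (normal_matrix \<nu> ?i)" unfolding N by (intro Gcd_dvd) auto
    then have "int N dvd det Dm * det (normal_matrix \<nu> ?i)" by (rule dvd_mult)
    also have "\<dots> = det (transpose (Dm ** normal_matrix \<nu> ?i))" by (simp add: det_mul)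
    also have "\<dots> = int_dot \<beta> (\<nu> j)"
      by (subst det_identity_rows_except_one[of k0]) (auto simp: transpose_def coef e DB \<beta>_def)
    finally show ?thesis .
  qed (simp add: \<beta>J \<beta>_def)
  then have 2: "int N dvd g" unfolding g_def by (intro Gcd_greatest) auto
  have gN: "g = int N" using 1 2 by (intro zdvd_antisym_nonneg) (simp_all add: g_def)
  have lattice: "v \<in> normal_lattice \<nu> \<longleftrightarrow> int N dvd int_dot \<beta> v" for v
  proof
    assume "v \<in> normal_lattice \<nu>"
    then obtain a where "v = (\<Sum>j\<in>UNIV. a $ j *s \<nu> j)" by (auto simp: normal_lattice_def)
    then show "int N dvd int_dot \<beta> v"
      using g gN by (auto simp: int_dot_sum int_dot_smult intro!: dvd_sum)
  next
    assume "int N dvd int_dot \<beta> v"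
    then obtain q where q: "int_dot \<beta> v = g * q" unfolding gN by blast
    obtain c where c: "(\<Sum>j\<in>UNIV. c j * int_dot \<beta> (\<nu> j)) = g"
      using Gcd_bezout[of UNIV "\<lambda>j. int_dot \<beta> (\<nu> j)"] unfolding g_def by auto
    define w where "w = q *s (\<Sum>j\<in>UNIV. c j *s \<nu> j)"
    have w: "w \<in> normal_lattice \<nu>"
      unfolding w_def by (intro normal_lattice_smult normal_lattice_sum normal_in_normal_lattice)
    have "int_dot \<beta> w = q * g" by (simp add: w_def int_dot_smult int_dot_sum c)
    then have 0: "int_dot (D k0) (v - w) = 0" using q by (simp add: int_dot_diff \<beta>_def)
    have "(\<Sum>i\<in>UNIV. int_dot (D i) (v - w) *s B i) \<in> normal_lattice \<nu>"
    proof (rule normal_lattice_sum)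
      fix i
      show "int_dot (D i) (v - w) *s B i \<in> normal_lattice \<nu>"
      proof (cases "i = k0")
        case True
        then show ?thesis using 0 normal_lattice_0 by simp
      next
        case False
        then show ?thesis
          using normal_lattice_smult[OF normal_in_normal_lattice, of _ \<nu> "e i"] by (simp add: e(2))
      qed
    qed
    then have "v - w \<in> normal_lattice \<nu>" using D(1) by metis
    then show "v \<in> normal_lattice \<nu>" using normal_lattice_add[OF _ w, of "v - w"] by simp
  qed
  \<comment> \<open>Otherwise both \<open>\<beta>\<close> and \<open>- \<beta>\<close> would lie in the cone.\<close>
  have "N \<noteq> 0"
  proof
    assume "N = 0"
    then have "int_dot \<beta> (\<nu> j) = 0" for j using g[of j] gN by simp
    then have "of_int_vec \<beta> \<bullet> of_int_vec (\<nu> j) = 0" for j by (simp add: inner_of_int_vec)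
    then have "of_int_vec \<beta> = 0"
      by (intro good_cone_pointed[OF good]) (simp_all add: mem_good_cone[OF good])
    then have "\<beta> = 0" using of_int_vec_eq_iff[of \<beta> 0] by simp
    then show False using DB[of k0 k0] by (simp add: \<beta>_def int_dot_def)
  qed
  then show ?thesis using that[OF lattice] DB[of k0 k0] by (auto simp: \<beta>_def)
qed

section \<open>The zero level set\<close>

lemma linear_normal_map: "linear (normal_map \<nu>)"
  by (rule linearI) (simp_all add: normal_map_def algebra_simps sum.distrib scaleR_sum_right)

lemma inner_normal_map: "x \<bullet> normal_map \<nu> y = y \<bullet> (\<chi> j. x \<bullet> of_int_vec (\<nu> j))"
  by (simp add: normal_map_def inner_sum_right inner_vec_def[of y])

text \<open>
  The orthogonal complement of the kernel of a linear map is the range of its adjoint.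
\<close>

lemma zero_level_iff:
  "z \<in> zero_level \<nu> \<longleftrightarrow> z \<noteq> 0 \<and> (\<exists>x. \<forall>j. (cmod (z $ j))\<^sup>2 / 2 = x \<bullet> of_int_vec (\<nu> j))"
proof -
  let ?T = "\<lambda>x. \<chi> j. x \<bullet> of_int_vec (\<nu> j)"
  have adj: "adjoint (normal_map \<nu>) = ?T"
    by (rule adjoint_unique) (simp add: inner_commute[of "normal_map \<nu> _"] inner_normal_map)
  have "linear ?T" using adjoint_linear[OF linear_normal_map, of \<nu>] by (simp add: adj)
  then have sub: "subspace (range ?T)" by (rule linear_subspace_image) simp
  have "(\<forall>y\<in>reduction_algebra \<nu>. y \<bullet> torus_moment_map z = 0) \<longleftrightarrow>
      torus_moment_map z \<in> orthogonal_comp (normal_map \<nu> -` {0})"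
    by (auto simp: reduction_algebra_def orthogonal_comp_def orthogonal_def)
  also have "normal_map \<nu> -` {0} = orthogonal_comp (range ?T)"
    using ker_orthogonal_comp_adjoint[OF linear_normal_map, of \<nu>] by (simp add: adj)
  also have "orthogonal_comp (orthogonal_comp (range ?T)) = range ?T"
    using sub by (rule orthogonal_comp_self)
  finally show ?thesis by (auto simp: zero_level_def torus_moment_map_def vec_eq_iff)
qed

definition zero_set :: "complex ^ 'd \<Rightarrow> 'd set" where
  "zero_set z = {j. z $ j = 0}"

lemma zero_set_zero_level:
  assumes good: "good_cone C \<nu>" and z: "z \<in> zero_level \<nu>"
  shows "zero_set z \<in> admissible C \<nu>"
proof -
  obtain x where x: "\<And>j. (cmod (z $ j))\<^sup>2 / 2 = x \<bullet> of_int_vec (\<nu> j)"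
    using z by (auto simp: zero_level_iff)
  have "x \<in> C" unfolding mem_good_cone[OF good] x[symmetric] by simp
  moreover have "x \<noteq> 0"
  proof
    assume "x = 0"
    then have "z $ j = 0" for j using x[of j] by simp
    then have "z = 0" by (simp add: vec_eq_iff)
    then show False using z by (simp add: zero_level_def)
  qed
  moreover have "zero_set z = tight \<nu> x" by (auto simp: zero_set_def tight_def x[symmetric])
  ultimately show ?thesis by (auto simp: admissible_def)
qed

lemma zero_set_dual:
  fixes C :: "(real ^ 'n::finite option) set"
  assumes good: "good_cone C \<nu>" and z: "z \<in> zero_level \<nu>"
  obtains \<mu> where "dual_on \<nu> (zero_set z) \<mu>"
proof -
  obtain x where "x \<in> C" "x \<noteq> 0" "zero_set z = tight \<nu> x"
    using zero_set_zero_level[OF good z] by (auto simp: admissible_def)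
  then show ?thesis using good_cone_tight_dual[OF good] that by metis
qed

text \<open>
  Admissible sets are closed under subsets, so a vanishing set is admissible as soon as it contains
  no set that fails to be admissible.
\<close>

lemma coordinate_complement_not_admissible:
  fixes C :: "(real ^ 'n::finite option) set"
  assumes good: "good_cone C \<nu>"
  shows "coordinate_complement (- admissible C \<nu>) = {z. zero_set z \<in> admissible C \<nu>}"
proof -
  have "z \<in> coordinate_complement (- admissible C \<nu>) \<longleftrightarrow> zero_set z \<in> admissible C \<nu>" for z
  proof
    assume "z \<in> coordinate_complement (- admissible C \<nu>)"
    then show "zero_set z \<in> admissible C \<nu>"
      by (auto simp: coordinate_complement_def zero_set_def)
  next
    assume z: "zero_set z \<in> admissible C \<nu>"
    have "\<exists>k\<in>J. z $ k \<noteq> 0" if "J \<notin> admissible C \<nu>" for J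
    proof (rule ccontr)
      assume "\<not> (\<exists>k\<in>J. z $ k \<noteq> 0)"
      then have "J \<subseteq> zero_set z" by (auto simp: zero_set_def)
      then show False using admissible_subset[OF good z] that by blast
    qed
    then show "z \<in> coordinate_complement (- admissible C \<nu>)"
      by (simp add: coordinate_complement_def)
  qed
  then show ?thesis by blast
qed

definition face_point :: "(real ^ 'm::finite) set \<Rightarrow> ('d \<Rightarrow> int ^ 'm) \<Rightarrow> 'd set \<Rightarrow> real ^ 'm" where
  "face_point C \<nu> J = (SOME x. x \<in> C \<and> x \<noteq> 0 \<and> tight \<nu> x = J)"

lemma face_point:
  assumes "J \<in> admissible C \<nu>"
  shows "face_point C \<nu> J \<in> C" "face_point C \<nu> J \<noteq> 0" "tight \<nu> (face_point C \<nu> J) = J"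
proof -
  have "\<exists>x. x \<in> C \<and> x \<noteq> 0 \<and> tight \<nu> x = J" using assms by (auto simp: admissible_def)
  then have "face_point C \<nu> J \<in> C \<and> face_point C \<nu> J \<noteq> 0 \<and> tight \<nu> (face_point C \<nu> J) = J"
    unfolding face_point_def by (rule someI_ex)
  then show "face_point C \<nu> J \<in> C" "face_point C \<nu> J \<noteq> 0" "tight \<nu> (face_point C \<nu> J) = J" by auto
qed

text \<open>
  The factor by which the squared radius of \<open>z $ j\<close> must change so that the radii come from the point
  \<open>cone_point C \<nu> z\<close> of the cone. That point is a sum over all faces of a chosen point of the face,
  weighted by the squares of the coordinates off that face; when the vanishing set of \<open>z\<close> is
  admissible, it lies on the facet \<open>j\<close> exactly when \<open>z $ j = 0\<close>. Its pairing with \<open>\<nu> j\<close> is \<open>(cmod (z $ j))\<^sup>2 / 2\<close> times \<open>radial_scale C \<nu> j z\<close>. Factoring out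
  \<open>(cmod (z $ j))\<^sup>2\<close> makes the rescaled coordinate \<open>sqrt (radial_scale C \<nu> j z) * z $ j\<close> continuous
  also where \<open>z $ j\<close> vanishes.
\<close>

definition radial_scale :: "(real ^ 'm::finite) set \<Rightarrow> ('d::finite \<Rightarrow> int ^ 'm) \<Rightarrow> 'd \<Rightarrow> complex ^ 'd \<Rightarrow> real" where
  "radial_scale C \<nu> j z = 2 * (\<Sum>J | J \<in> admissible C \<nu> \<and> j \<notin> J.
     (\<Prod>i\<in>- J - {j}. (cmod (z $ i))\<^sup>2) * (face_point C \<nu> J \<bullet> of_int_vec (\<nu> j)))"

definition cone_point :: "(real ^ 'm::finite) set \<Rightarrow> ('d::finite \<Rightarrow> int ^ 'm) \<Rightarrow> complex ^ 'd \<Rightarrow> real ^ 'm" where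
  "cone_point C \<nu> z = (\<Sum>J\<in>admissible C \<nu>. (\<Prod>i\<in>- J. (cmod (z $ i))\<^sup>2) *\<^sub>R face_point C \<nu> J)"

lemma radial_scale_cone_point:
  "(cmod (z $ j))\<^sup>2 * radial_scale C \<nu> j z / 2 = cone_point C \<nu> z \<bullet> of_int_vec (\<nu> j)"
proof -
  have "cone_point C \<nu> z \<bullet> of_int_vec (\<nu> j) =
      (\<Sum>J\<in>admissible C \<nu>. (\<Prod>i\<in>- J. (cmod (z $ i))\<^sup>2) * (face_point C \<nu> J \<bullet> of_int_vec (\<nu> j)))"
    by (simp add: cone_point_def inner_sum_left)
  also have "\<dots> = (\<Sum>J | J \<in> admissible C \<nu> \<and> j \<notin> J.
      (\<Prod>i\<in>- J. (cmod (z $ i))\<^sup>2) * (face_point C \<nu> J \<bullet> of_int_vec (\<nu> j)))"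
    using face_point(3) by (intro sum.mono_neutral_right) (auto simp: tight_def)
  also have "\<dots> = (\<Sum>J | J \<in> admissible C \<nu> \<and> j \<notin> J. (cmod (z $ j))\<^sup>2 *
      ((\<Prod>i\<in>- J - {j}. (cmod (z $ i))\<^sup>2) * (face_point C \<nu> J \<bullet> of_int_vec (\<nu> j))))"
    by (intro sum.cong) (auto simp: prod.remove[of "- _" j])
  finally show ?thesis by (simp add: radial_scale_def sum_distrib_left[symmetric])
qed

lemma radial_scale_nonneg: "good_cone C \<nu> \<Longrightarrow> 0 \<le> radial_scale C \<nu> j z"
  unfolding radial_scale_def using face_point(1) mem_good_cone
  by (intro mult_nonneg_nonneg sum_nonneg prod_nonneg) (auto, blast)

lemma radial_scale_pos:
  assumes good: "good_cone C \<nu>" and z: "zero_set z \<in> admissible C \<nu>" "z $ j \<noteq> 0"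
  shows "0 < radial_scale C \<nu> j z"
proof -
  let ?f = "\<lambda>J. (\<Prod>i\<in>- J - {j}. (cmod (z $ i))\<^sup>2) * (face_point C \<nu> J \<bullet> of_int_vec (\<nu> j))"
  have nn: "0 \<le> face_point C \<nu> J \<bullet> of_int_vec (\<nu> j)" if "J \<in> admissible C \<nu>" for J
    using face_point(1)[OF that] mem_good_cone[OF good] by blast
  have "face_point C \<nu> (zero_set z) \<bullet> of_int_vec (\<nu> j) \<noteq> 0"
    using face_point(3)[OF z(1)] z(2) by (auto simp: tight_def zero_set_def)
  then have "0 < face_point C \<nu> (zero_set z) \<bullet> of_int_vec (\<nu> j)" using nn[OF z(1)] by simp
  then have "0 < ?f (zero_set z)"
    by (intro mult_pos_pos prod_pos) (auto simp: zero_set_def)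
  moreover have "?f (zero_set z) \<le> (\<Sum>J | J \<in> admissible C \<nu> \<and> j \<notin> J. ?f J)"
    by (rule member_le_sum) (use z nn in \<open>auto simp: zero_set_def intro!: mult_nonneg_nonneg prod_nonneg\<close>)
  ultimately show ?thesis by (simp add: radial_scale_def)
qed

text \<open>
  The factor interpolates between the squared radii of \<open>z\<close> and those prescribed by \<open>cone_point\<close>,
  so the linear moment map condition persists for \<open>z\<close> in the zero level; as long as the vanishing
  set is admissible, the factor is positive and no coordinate starts to vanish.
\<close>

definition scale_homotopy :: "(real ^ 'm::finite) set \<Rightarrow> ('d::finite \<Rightarrow> int ^ 'm) \<Rightarrow> real \<times> (complex ^ 'd) \<Rightarrow> complex ^ 'd" where
  "scale_homotopy C \<nu> = (\<lambda>(s, z). \<chi> j. of_real (sqrt (1 - s + s * radial_scale C \<nu> j z)) * z $ j)"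

lemma continuous_scale_homotopy: "continuous_on S (scale_homotopy C \<nu>)"
  unfolding scale_homotopy_def radial_scale_def case_prod_beta by (intro continuous_intros)

lemma zero_set_scale_homotopy:
  assumes good: "good_cone C \<nu>" and z: "zero_set z \<in> admissible C \<nu>" and s: "s \<in> {0..1}"
  shows "zero_set (scale_homotopy C \<nu> (s, z)) = zero_set z"
proof -
  have "1 - s + s * radial_scale C \<nu> j z \<noteq> 0" if "z $ j \<noteq> 0" for j
  proof (cases "s = 1")
    case False
    then have "0 < 1 - s" "0 \<le> s * radial_scale C \<nu> j z" using s radial_scale_nonneg[OF good] by auto
    then show ?thesis by linarith
  qed (use radial_scale_pos[OF good z that] in simp)
  then show ?thesis by (auto simp: zero_set_def scale_homotopy_def)
qed

lemma scale_homotopy_moment: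
  assumes good: "good_cone C \<nu>" and s: "s \<in> {0..1}"
  shows "(cmod (scale_homotopy C \<nu> (s, z) $ j))\<^sup>2 / 2 =
    (1 - s) * ((cmod (z $ j))\<^sup>2 / 2) + s * (cone_point C \<nu> z \<bullet> of_int_vec (\<nu> j))"
proof -
  have "0 \<le> 1 - s + s * radial_scale C \<nu> j z" using s radial_scale_nonneg[OF good, of j z] by simp
  then have "(cmod (scale_homotopy C \<nu> (s, z) $ j))\<^sup>2 = (1 - s + s * radial_scale C \<nu> j z) * (cmod (z $ j))\<^sup>2"
    by (simp add: scale_homotopy_def norm_mult power_mult_distrib)
  then show ?thesis by (simp add: radial_scale_cone_point[symmetric] field_simps)
qed

lemma zero_set_admissible_nonzero:
  assumes good: "good_cone C \<nu>" and z: "zero_set z \<in> admissible C \<nu>"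
  shows "z \<noteq> 0"
proof
  assume "z = 0"
  then have "tight \<nu> (face_point C \<nu> (zero_set z)) = UNIV"
    using face_point(3)[OF z] by (auto simp: zero_set_def)
  then have "face_point C \<nu> (zero_set z) \<bullet> of_int_vec (\<nu> j) = 0" for j
    unfolding tight_def by blast
  then have "face_point C \<nu> (zero_set z) = 0"
    by (intro good_cone_pointed[OF good]) (simp_all add: mem_good_cone[OF good])
  then show False using face_point(2)[OF z] by simp
qed

text \<open>
  The homotopy \<open>scale_homotopy\<close> preserves both the zero level and the open set of points with
  admissible vanishing set, and at time \<open>1\<close> it maps the latter into the former. Hence the inclusion
  is a homotopy equivalence.
\<close>

theorem simply_connected_zero_level:
  fixes C :: "(real ^ 'n::finite option) set"
  assumes good: "good_cone C \<nu>"
  shows "simply_connected (zero_level \<nu>)"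
proof -
  let ?Z = "zero_level \<nu>" and ?h = "scale_homotopy C \<nu>"
  let ?U = "coordinate_complement (- admissible C \<nu>)"
  have U: "z \<in> ?U \<longleftrightarrow> zero_set z \<in> admissible C \<nu>" for z
    using coordinate_complement_not_admissible[OF good] by simp
  have ZU: "?Z \<subseteq> ?U" using zero_set_zero_level[OF good] U by blast
  have hU: "?h (s, z) \<in> ?U" if "s \<in> {0..1}" "z \<in> ?U" for s z
    using zero_set_scale_homotopy[OF good] that by (simp add: U)
  have hZ: "?h (s, z) \<in> ?Z" if sz: "s \<in> {0..1}" "z \<in> ?Z" for s z
  proof -
    obtain x where x: "\<And>j. (cmod (z $ j))\<^sup>2 / 2 = x \<bullet> of_int_vec (\<nu> j)"
      using sz by (auto simp: zero_level_iff)
    have "(cmod (?h (s, z) $ j))\<^sup>2 / 2 = ((1 - s) *\<^sub>R x + s *\<^sub>R cone_point C \<nu> z) \<bullet> of_int_vec (\<nu> j)" for j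
      unfolding scale_homotopy_moment[OF good sz(1)] x by (simp add: inner_add_left)
    moreover have "?h (s, z) \<noteq> 0"
      using hU[OF sz(1)] sz ZU zero_set_admissible_nonzero[OF good] U by blast
    ultimately show ?thesis unfolding zero_level_iff by blast
  qed
  have h1: "?h (1, z) \<in> ?Z" if "z \<in> ?U" for z
  proof -
    have "(cmod (?h (1, z) $ j))\<^sup>2 / 2 = cone_point C \<nu> z \<bullet> of_int_vec (\<nu> j)" for j
      using scale_homotopy_moment[OF good, of 1 z j] by simp
    moreover have "?h (1, z) \<noteq> 0"
      using hU[of 1 z] that zero_set_admissible_nonzero[OF good] U by simp
    ultimately show ?thesis unfolding zero_level_iff by blast
  qed
  have hom: "homotopic_with_canon (\<lambda>_. True) S S id (\<lambda>z. ?h (1, z))"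
    if "\<And>s z. s \<in> {0..1} \<Longrightarrow> z \<in> S \<Longrightarrow> ?h (s, z) \<in> S" for S
    unfolding homotopic_with_def
  proof (intro exI conjI)
    show "continuous_map (prod_topology (top_of_set {0..1}) (top_of_set S)) (top_of_set S) ?h"
      using that continuous_scale_homotopy by (auto simp: prod_topology_subtopology_eu)
  qed (auto simp: scale_homotopy_def vec_eq_iff)
  have "?Z homotopy_eqv ?U"
    unfolding homotopy_equivalent_space_def
  proof (intro exI conjI)
    show "continuous_map (top_of_set ?Z) (top_of_set ?U) id" using ZU by auto
    show "continuous_map (top_of_set ?U) (top_of_set ?Z) (\<lambda>z. ?h (1, z))"
      using h1 by (auto intro!: continuous_on_compose2[OF continuous_scale_homotopy] continuous_intros)
    show "homotopic_with_canon (\<lambda>_. True) ?Z ?Z ((\<lambda>z. ?h (1, z)) \<circ> id) id"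
      using hom[OF hZ] by (simp add: homotopic_with_sym)
    show "homotopic_with_canon (\<lambda>_. True) ?U ?U (id \<circ> (\<lambda>z. ?h (1, z))) id"
      using hom[OF hU] by (simp add: homotopic_with_sym)
  qed
  moreover have "simply_connected ?U"
    using not_admissible_two_elements[OF good]
    by (intro simply_connected_coordinate_complement) auto
  ultimately show ?thesis using homotopy_eqv_simple_connectedness by blast
qed

section \<open>The torus action\<close>

text \<open>
  With unit complex numbers in place of angles the reduction group becomes the compact set
  \<open>phase_group \<nu>\<close>, as the closed graph argument for differences of lifts requires.
\<close>

definition phase :: "real ^ 'd \<Rightarrow> complex ^ 'd" where
  "phase y = (\<chi> j. cis (y $ j))"

definition phase_act :: "complex ^ 'd \<Rightarrow> complex ^ 'd \<Rightarrow> complex ^ 'd" where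
  "phase_act u z = (\<chi> j. u $ j * z $ j)"

definition phase_group :: "('d::finite \<Rightarrow> int ^ 'm) \<Rightarrow> (complex ^ 'd) set" where
  "phase_group \<nu> = phase ` reduction_group \<nu>"

lemma torus_act_phase: "torus_act y z = phase_act (phase y) z"
  by (simp add: torus_act_def phase_act_def phase_def)

lemma phase_add: "phase (x + y) = phase_act (phase x) (phase y)"
  by (simp add: phase_def phase_act_def vec_eq_iff cis_mult)

lemma phase_act_assoc: "phase_act (phase_act u v) z = phase_act u (phase_act v z)"
  by (simp add: phase_act_def vec_eq_iff mult.assoc)

lemma torus_act_add: "torus_act (x + y) z = torus_act x (torus_act y z)"
  by (simp add: torus_act_phase phase_add phase_act_assoc)

lemma torus_act_0 [simp]: "torus_act 0 z = z"
  by (simp add: torus_act_def vec_eq_iff)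

lemma phase_eq_iff: "phase x = phase y \<longleftrightarrow> (\<exists>a. x = y + (2 * pi) *\<^sub>R of_int_vec a)"
proof -
  have "cis s = cis t \<longleftrightarrow> (\<exists>n::int. s = t + 2 * pi * n)" for s t
    using sin_cos_eq_iff[of s t] by (auto simp: complex_eq_iff mult.commute)
  then have "phase x = phase y \<longleftrightarrow> (\<forall>j. \<exists>n::int. x $ j = y $ j + 2 * pi * n)"
    by (simp add: phase_def vec_eq_iff)
  also have "\<dots> \<longleftrightarrow> (\<exists>a :: int ^ 'a. \<forall>j. x $ j = y $ j + 2 * pi * (a $ j))"
    by (auto simp: choice_iff intro: exI[of _ "vec_lambda _"])
  finally show ?thesis by (simp add: vec_eq_iff of_int_vec_def)
qed

lemma normal_map_of_int_vec: "normal_map \<nu> (of_int_vec a) = of_int_vec (\<Sum>j\<in>UNIV. a $ j *s \<nu> j)"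
  by (simp add: normal_map_def of_int_vec_sum of_int_vec_smult) (simp add: of_int_vec_def)

lemma normal_map_add: "normal_map \<nu> (x + y) = normal_map \<nu> x + normal_map \<nu> y"
  using linear_normal_map by (rule linear_add)

lemma normal_map_scaleR: "normal_map \<nu> (c *\<^sub>R x) = c *\<^sub>R normal_map \<nu> x"
  using linear_normal_map by (rule linear_scale)

lemma normal_map_minus: "normal_map \<nu> (- x) = - normal_map \<nu> x"
  using linear_normal_map by (rule linear_neg)

lemma reduction_group_add:
  "x \<in> reduction_group \<nu> \<Longrightarrow> y \<in> reduction_group \<nu> \<Longrightarrow> x + y \<in> reduction_group \<nu>"
  by (auto simp: reduction_group_def normal_map_add scaleR_add_right[symmetric] of_int_vec_add[symmetric])

lemma reduction_group_minus: "x \<in> reduction_group \<nu> \<Longrightarrow> - x \<in> reduction_group \<nu>"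
proof -
  assume "x \<in> reduction_group \<nu>"
  then obtain w where "normal_map \<nu> x = (2 * pi) *\<^sub>R of_int_vec w" by (auto simp: reduction_group_def)
  then have "normal_map \<nu> (- x) = (2 * pi) *\<^sub>R of_int_vec (- w)"
    by (simp add: normal_map_minus) (simp add: of_int_vec_def vec_eq_iff)
  then show ?thesis by (auto simp: reduction_group_def)
qed

lemma reduction_algebra_subset: "reduction_algebra \<nu> \<subseteq> reduction_group \<nu>"
proof
  fix x assume "x \<in> reduction_algebra \<nu>"
  then have "normal_map \<nu> x = (2 * pi) *\<^sub>R of_int_vec 0" by (simp add: reduction_algebra_def)
  then show "x \<in> reduction_group \<nu>" unfolding reduction_group_def by blast
qed

lemma reduction_group_lattice: "(2 * pi) *\<^sub>R of_int_vec a \<in> reduction_group \<nu>"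
  by (auto simp: reduction_group_def normal_map_scaleR normal_map_of_int_vec)

lemma reduction_group_phase_cong:
  "phase x = phase y \<Longrightarrow> y \<in> reduction_group \<nu> \<Longrightarrow> x \<in> reduction_group \<nu>"
  by (auto simp: phase_eq_iff intro: reduction_group_add reduction_group_lattice)

lemma phase_group_phase_iff [simp]: "phase y \<in> phase_group \<nu> \<longleftrightarrow> y \<in> reduction_group \<nu>"
  by (auto simp: phase_group_def intro: reduction_group_phase_cong)

lemma subspace_reduction_algebra: "subspace (reduction_algebra \<nu>)"
  unfolding reduction_algebra_def using linear_normal_map by (rule linear_subspace_kernel)

lemma torus_act_zero_level: "z \<in> zero_level \<nu> \<Longrightarrow> torus_act y z \<in> zero_level \<nu>"
proof -
  assume z: "z \<in> zero_level \<nu>"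
  have "torus_act y z \<noteq> 0" using z
    by (auto simp: zero_level_def torus_act_def vec_eq_iff)
  moreover have "torus_moment_map (torus_act y z) = torus_moment_map z"
    by (simp add: torus_moment_map_def torus_act_def norm_mult)
  ultimately show ?thesis using z by (simp add: zero_level_def)
qed

lemma reduction_orbit_eq_iff:
  "reduction_orbit \<nu> z = reduction_orbit \<nu> z' \<longleftrightarrow> (\<exists>y\<in>reduction_group \<nu>. z' = torus_act y z)"
proof
  have "0 \<in> reduction_group \<nu>" using subspace_0[OF subspace_reduction_algebra] reduction_algebra_subset by blast
  then have "z' \<in> reduction_orbit \<nu> z'" unfolding reduction_orbit_def by (rule rev_image_eqI) simp
  moreover assume "reduction_orbit \<nu> z = reduction_orbit \<nu> z'"
  ultimately show "\<exists>y\<in>reduction_group \<nu>. z' = torus_act y z" by (auto simp: reduction_orbit_def)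
next
  have sub: "reduction_orbit \<nu> (torus_act y z) \<subseteq> reduction_orbit \<nu> z" if "y \<in> reduction_group \<nu>" for y z
    using that by (auto simp: reduction_orbit_def torus_act_add[symmetric] intro: reduction_group_add)
  assume "\<exists>y\<in>reduction_group \<nu>. z' = torus_act y z"
  then obtain y where y: "y \<in> reduction_group \<nu>" "z' = torus_act y z" by blast
  then have "z = torus_act (- y) z'" by (simp add: torus_act_add[symmetric])
  then show "reduction_orbit \<nu> z = reduction_orbit \<nu> z'"
    using sub[OF y(1), of z] sub[OF reduction_group_minus[OF y(1)], of z'] y(2) by auto
qed

lemma int_inner_normal_map:
  assumes "normal_map \<nu> y = (2 * pi) *\<^sub>R of_int_vec w"
  shows "(\<Sum>i\<in>UNIV. y $ i * of_int (int_dot m (\<nu> i))) = 2 * pi * of_int (int_dot m w)"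
proof -
  have "(\<Sum>i\<in>UNIV. y $ i * of_int (int_dot m (\<nu> i))) = of_int_vec m \<bullet> normal_map \<nu> y"
    by (simp add: normal_map_def inner_sum_right inner_of_int_vec)
  then show ?thesis by (simp add: assms inner_of_int_vec)
qed

text \<open>
  Pairing the defining equation of the group with a dual functional isolates one coordinate.
\<close>

lemma dual_on_coordinate:
  assumes \<mu>: "dual_on \<nu> J \<mu>" and j: "j \<in> J"
    and w: "normal_map \<nu> y = (2 * pi) *\<^sub>R of_int_vec w"
  shows "y $ j = 2 * pi * of_int (int_dot (\<mu> j) w) - (\<Sum>i\<in>- J. y $ i * of_int (int_dot (\<mu> j) (\<nu> i)))"
proof -
  have "(\<Sum>i\<in>J. y $ i * of_int (int_dot (\<mu> j) (\<nu> i))) = (\<Sum>i\<in>J. if i = j then y $ i else 0)"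
    using \<mu> j by (intro sum.cong) (auto simp: dual_on_def)
  also have "\<dots> = y $ j" using j by simp
  finally have J: "(\<Sum>i\<in>J. y $ i * of_int (int_dot (\<mu> j) (\<nu> i))) = y $ j" .
  have "(\<Sum>i\<in>UNIV. y $ i * of_int (int_dot (\<mu> j) (\<nu> i))) =
      (\<Sum>i\<in>J. y $ i * of_int (int_dot (\<mu> j) (\<nu> i))) + (\<Sum>i\<in>- J. y $ i * of_int (int_dot (\<mu> j) (\<nu> i)))"
    by (subst sum.union_disjoint[symmetric]) (auto simp: Compl_partition)
  then show ?thesis using int_inner_normal_map[OF w, of "\<mu> j"] J by simp
qed

text \<open>
  The coordinates of the group element at which \<open>z\<close> does not vanish are visible in the action; by
  duality the defining equation of the group then determines the others modulo \<open>2\<pi>\<close>.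
\<close>

lemma reduction_group_free:
  fixes C :: "(real ^ 'n::finite option) set" and \<nu> :: "'d::finite \<Rightarrow> int ^ 'n option"
  assumes good: "good_cone C \<nu>" and z: "z \<in> zero_level \<nu>"
    and x: "x \<in> reduction_group \<nu>" and y: "y \<in> reduction_group \<nu>"
    and eq: "torus_act x z = torus_act y z"
  shows "phase x = phase y"
proof -
  obtain \<mu> where \<mu>: "dual_on \<nu> (zero_set z) \<mu>" by (rule zero_set_dual[OF good z])
  define k where "k = x - y"
  have "k \<in> reduction_group \<nu>"
    using reduction_group_add[OF x reduction_group_minus[OF y]] by (simp add: k_def)
  then obtain w where w: "normal_map \<nu> k = (2 * pi) *\<^sub>R of_int_vec w" by (auto simp: reduction_group_def)
  have off: "\<exists>n::int. k $ i = 2 * pi * n" if "i \<notin> zero_set z" for i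
  proof -
    have "cis (x $ i) * z $ i = cis (y $ i) * z $ i" using eq by (simp add: torus_act_def vec_eq_iff)
    then have "cis (x $ i) = cis (y $ i)" using that by (simp add: zero_set_def)
    then show ?thesis using sin_cos_eq_iff[of "x $ i" "y $ i"]
      by (auto simp: complex_eq_iff k_def mult.commute)
  qed
  have on: "\<exists>n::int. k $ j = 2 * pi * n" if j: "j \<in> zero_set z" for j
  proof -
    obtain n :: "'d \<Rightarrow> int" where n: "\<And>i. i \<notin> zero_set z \<Longrightarrow> k $ i = 2 * pi * n i" using off by metis
    have "k $ j = 2 * pi * of_int (int_dot (\<mu> j) w) -
        (\<Sum>i\<in>- zero_set z. 2 * pi * of_int (n i) * of_int (int_dot (\<mu> j) (\<nu> i)))"
      unfolding dual_on_coordinate[OF \<mu> j w] by (simp add: n)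
    also have "\<dots> = 2 * pi * of_int (int_dot (\<mu> j) w - (\<Sum>i\<in>- zero_set z. n i * int_dot (\<mu> j) (\<nu> i)))"
      by (simp add: algebra_simps sum_distrib_left)
    finally show ?thesis by blast
  qed
  have "\<forall>j. \<exists>n::int. k $ j = 2 * pi * n" using off on by blast
  then obtain n :: "'d \<Rightarrow> int" where "\<And>j. k $ j = 2 * pi * n j" by metis
  then have "x = y + (2 * pi) *\<^sub>R of_int_vec (vec_lambda n)"
    by (simp add: vec_eq_iff of_int_vec_def k_def algebra_simps)
  then show ?thesis unfolding phase_eq_iff by blast
qed

text \<open>
  An element of the group whose coordinates outside \<open>J\<close> are small lies, modulo \<open>2\<pi>\<close>, in the
  Lie algebra: its \<open>J\<close>-coordinates can be made small by integral shifts, and then its image under the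
  normal map is \<open>2\<pi>\<close> times a small integral vector, hence zero. With \<open>J\<close> empty this says that the group
  meets a neighbourhood of the identity in its identity component.
\<close>

lemma reduction_group_small:
  assumes \<mu>: "dual_on \<nu> J \<mu>"
  obtains \<epsilon> where "\<epsilon> > 0" "\<And>k. k \<in> reduction_group \<nu> \<Longrightarrow> (\<And>j. j \<notin> J \<Longrightarrow> \<bar>k $ j\<bar> < \<epsilon>) \<Longrightarrow>
     \<exists>l\<in>reduction_algebra \<nu>. (\<forall>j. j \<notin> J \<longrightarrow> l $ j = k $ j) \<and> phase l = phase k"
proof -
  \<comment> \<open>The \<open>J\<close>-coordinates as the linear functions of the others that \<open>dual_on_coordinate\<close> dictates modulo \<open>2\<pi>\<close>.\<close>
  define R :: "real ^ 'a \<Rightarrow> real ^ 'a" where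
    "R k = (\<chi> j. if j \<in> J then - (\<Sum>i\<in>- J. k $ i * of_int (int_dot (\<mu> j) (\<nu> i))) else k $ j)" for k
  have "linear R"
    by (rule linearI)
      (auto simp: R_def vec_eq_iff sum.distrib distrib_right sum_distrib_left mult.assoc)
  then have lin: "linear (\<lambda>k. normal_map \<nu> (R k))"
    using linear_compose[OF _ linear_normal_map] by (simp add: o_def)
  have "\<exists>\<delta>>0. \<forall>k. norm k < \<delta> \<longrightarrow> norm (normal_map \<nu> (R k)) < 2 * pi"
  proof -
    have "isCont (\<lambda>k. normal_map \<nu> (R k)) 0" using linear_continuous_at[OF lin[unfolded linear_conv_bounded_linear]] .
    then have "\<exists>\<delta>>0. \<forall>k. norm (k - 0) < \<delta> \<longrightarrow> norm (normal_map \<nu> (R k) - normal_map \<nu> (R 0)) < 2 * pi"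
      unfolding continuous_at_eps_delta dist_norm using pi_gt_zero by (metis mult_pos_pos zero_less_numeral)
    then show ?thesis using linear_0[OF lin] by simp
  qed
  then obtain \<delta> where \<delta>: "\<delta> > 0" "\<And>k. norm k < \<delta> \<Longrightarrow> norm (normal_map \<nu> (R k)) < 2 * pi" by blast
  define \<epsilon> where "\<epsilon> = \<delta> / CARD('a)"
  have "\<epsilon> > 0" using \<delta>(1) by (simp add: \<epsilon>_def)
  moreover have "\<exists>l\<in>reduction_algebra \<nu>. (\<forall>j. j \<notin> J \<longrightarrow> l $ j = k $ j) \<and> phase l = phase k"
    if k: "k \<in> reduction_group \<nu>" "\<And>j. j \<notin> J \<Longrightarrow> \<bar>k $ j\<bar> < \<epsilon>" for k
  proof (intro bexI conjI allI impI)
    obtain w where w: "normal_map \<nu> k = (2 * pi) *\<^sub>R of_int_vec w" using k by (auto simp: reduction_group_def)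
    define b :: "int ^ 'a" where "b = (\<chi> j. if j \<in> J then int_dot (\<mu> j) w else 0)"
    have kR: "k = R k + (2 * pi) *\<^sub>R of_int_vec b"
      using dual_on_coordinate[OF \<mu> _ w] by (auto simp: vec_eq_iff R_def b_def of_int_vec_def)
    then have "phase k = phase (R k)" unfolding phase_eq_iff by blast
    then show "phase (R k) = phase k" by (rule sym)
    define k0 where "k0 = (\<chi> j. if j \<in> J then 0 else k $ j)"
    have "R k0 = R k" by (auto simp: R_def k0_def vec_eq_iff intro!: sum.cong)
    have "norm k0 \<le> (\<Sum>j\<in>UNIV. \<bar>k0 $ j\<bar>)" by (rule norm_le_l1_cart)
    also have "\<dots> < (\<Sum>j\<in>(UNIV :: 'a set). \<epsilon>)"
      by (rule sum_strict_mono) (use k(2) \<open>\<epsilon> > 0\<close> in \<open>auto simp: k0_def\<close>)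
    also have "\<dots> = \<delta>" by (simp add: \<epsilon>_def)
    finally have small: "norm (normal_map \<nu> (R k)) < 2 * pi" using \<delta>(2) \<open>R k0 = R k\<close> by metis
    define v where "v = w - (\<Sum>j\<in>UNIV. b $ j *s \<nu> j)"
    have "normal_map \<nu> (R k) = normal_map \<nu> k - normal_map \<nu> ((2 * pi) *\<^sub>R of_int_vec b)"
      using normal_map_add[of \<nu> "R k" "(2 * pi) *\<^sub>R of_int_vec b"] kR by simp
    then have v: "normal_map \<nu> (R k) = (2 * pi) *\<^sub>R of_int_vec v"
      by (simp add: w normal_map_scaleR normal_map_of_int_vec v_def of_int_vec_diff algebra_simps)
    have "v $ r = 0" for r
    proof -
      have "\<bar>normal_map \<nu> (R k) $ r\<bar> < 2 * pi" using small component_le_norm_cart le_less_trans by blast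
      then have "2 * pi * \<bar>real_of_int (v $ r)\<bar> < 2 * pi * 1" by (simp add: v of_int_vec_def abs_mult)
      then have "\<bar>real_of_int (v $ r)\<bar> < 1" by (subst (asm) mult_less_cancel_left_pos) simp_all
      then show ?thesis by linarith
    qed
    then have "v = 0" by (simp add: vec_eq_iff)
    then show "R k \<in> reduction_algebra \<nu>" by (simp add: reduction_algebra_def v)
  qed (simp add: R_def)
  ultimately show ?thesis using that by blast
qed

section \<open>Differences of lifts\<close>

lemma continuous_phase_act [continuous_intros]:
  "continuous_on S f \<Longrightarrow> continuous_on S g \<Longrightarrow> continuous_on S (\<lambda>x. phase_act (f x) (g x))"
  unfolding phase_act_def by (intro continuous_intros)

lemma continuous_phase [continuous_intros]:
  "continuous_on S f \<Longrightarrow> continuous_on S (\<lambda>x. phase (f x))"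
  unfolding phase_def by (intro continuous_intros)

lemma reduction_orbit_phase_act:
  "u \<in> phase_group \<nu> \<Longrightarrow> reduction_orbit \<nu> (phase_act u z) = reduction_orbit \<nu> z"
  by (rule sym) (auto simp: reduction_orbit_eq_iff phase_group_def torus_act_phase)

lemma phase_act_zero_level: "u \<in> phase_group \<nu> \<Longrightarrow> z \<in> zero_level \<nu> \<Longrightarrow> phase_act u z \<in> zero_level \<nu>"
  by (auto simp: phase_group_def torus_act_phase[symmetric] torus_act_zero_level)

lemma phase_group_mult: "u \<in> phase_group \<nu> \<Longrightarrow> v \<in> phase_group \<nu> \<Longrightarrow> phase_act u v \<in> phase_group \<nu>"
  by (auto simp: phase_group_def phase_add[symmetric] intro!: imageI reduction_group_add)

lemma compact_phase_group: "compact (phase_group \<nu>)"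
proof -
  have "y \<in> reduction_group \<nu> \<longleftrightarrow> phase (normal_map \<nu> y) = phase 0" for y
    by (simp add: phase_eq_iff reduction_group_def)
  then have "reduction_group \<nu> = (\<lambda>y. phase (normal_map \<nu> y)) -` {phase 0}" by auto
  moreover have "closed \<dots>"
    using linear_continuous_on[OF linear_normal_map[unfolded linear_conv_bounded_linear]]
    by (intro closed_vimage closed_singleton continuous_intros)
  ultimately have "closed (reduction_group \<nu>)" by simp
  then have "compact (reduction_group \<nu> \<inter> cbox 0 (\<chi> j. 2 * pi))" by (intro closed_Int_compact compact_cbox)
  then have "compact (phase ` (reduction_group \<nu> \<inter> cbox 0 (\<chi> j. 2 * pi)))"
    by (intro compact_continuous_image continuous_intros)
  also have "phase ` (reduction_group \<nu> \<inter> cbox 0 (\<chi> j. 2 * pi)) = phase_group \<nu>"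
  proof
    show "phase_group \<nu> \<subseteq> phase ` (reduction_group \<nu> \<inter> cbox 0 (\<chi> j. 2 * pi))"
    proof
      fix u assume "u \<in> phase_group \<nu>"
      then obtain y where y: "y \<in> reduction_group \<nu>" "u = phase y" by (auto simp: phase_group_def)
      define x where "x = (\<chi> j. 2 * pi * frac (y $ j / (2 * pi)))"
      have "x = y + (2 * pi) *\<^sub>R of_int_vec (\<chi> j. - \<lfloor>y $ j / (2 * pi)\<rfloor>)"
        by (simp add: x_def vec_eq_iff of_int_vec_def frac_def algebra_simps)
      then have "phase x = phase y" unfolding phase_eq_iff by blast
      moreover have "x \<in> cbox 0 (\<chi> j. 2 * pi)"
        by (auto simp: mem_box_cart x_def less_imp_le[OF frac_lt_1])
      ultimately show "u \<in> phase ` (reduction_group \<nu> \<inter> cbox 0 (\<chi> j. 2 * pi))"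
        using y reduction_group_phase_cong by (metis IntI imageI)
    qed
  qed (auto simp: phase_group_def)
  finally show ?thesis .
qed

text \<open>
  The difference is unique because the action is free, so its graph is the closed set of solutions
  of an equation; compactness of the group makes a map with closed graph continuous.
\<close>

lemma continuous_lift_difference:
  fixes C :: "(real ^ 'n::finite option) set" and \<nu> :: "'d::finite \<Rightarrow> int ^ 'n option"
    and f g :: "real \<Rightarrow> complex ^ 'd"
  assumes good: "good_cone C \<nu>"
    and f: "continuous_on T f" "f ` T \<subseteq> zero_level \<nu>" and g: "continuous_on T g"
    and eq: "\<And>t. t \<in> T \<Longrightarrow> reduction_orbit \<nu> (f t) = reduction_orbit \<nu> (g t)"
  obtains u where "continuous_on T u" "u ` T \<subseteq> phase_group \<nu>" "\<And>t. t \<in> T \<Longrightarrow> g t = phase_act (u t) (f t)"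
proof -
  have "\<exists>u\<in>phase_group \<nu>. g t = phase_act u (f t)" if "t \<in> T" for t
    using eq[OF that] by (auto simp: reduction_orbit_eq_iff phase_group_def torus_act_phase)
  then obtain u where u: "\<And>t. t \<in> T \<Longrightarrow> u t \<in> phase_group \<nu>" "\<And>t. t \<in> T \<Longrightarrow> g t = phase_act (u t) (f t)"
    by metis
  have uniq: "v = u t" if tv: "t \<in> T" "v \<in> phase_group \<nu>" "g t = phase_act v (f t)" for t v
  proof -
    obtain x y where xy: "x \<in> reduction_group \<nu>" "v = phase x" "y \<in> reduction_group \<nu>" "u t = phase y"
      using tv(2) u(1)[OF tv(1)] by (auto simp: phase_group_def)
    have "torus_act x (f t) = torus_act y (f t)"
      using tv(3) u(2)[OF tv(1)] xy by (simp add: torus_act_phase)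
    moreover have "f t \<in> zero_level \<nu>" using f(2) tv(1) by blast
    ultimately show ?thesis using reduction_group_free[OF good _ xy(1,3)] xy by simp
  qed
  have "(\<lambda>t. (t, u t)) ` T = {p \<in> T \<times> phase_group \<nu>. g (fst p) - phase_act (snd p) (f (fst p)) = 0}"
    using u uniq by force
  moreover have "closedin (top_of_set (T \<times> phase_group \<nu>)) \<dots>"
    by (intro continuous_closedin_preimage_constant continuous_intros
        continuous_on_compose2[OF f(1)] continuous_on_compose2[OF g]) auto
  ultimately have "closedin (top_of_set (T \<times> phase_group \<nu>)) ((\<lambda>t. (t, u t)) ` T)" by simp
  then have "continuous_on T u"
    using continuous_closed_graph_eq[OF compact_phase_group, of u T \<nu>] u(1) by auto
  then show ?thesis using that u by blast
qed

section \<open>Local sections of the reduction\<close>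

lemma openin_reduction_orbit_image:
  assumes V: "openin (top_of_set (zero_level \<nu>)) V"
  shows "openin (toric_symplectic_cone \<nu>) (reduction_orbit \<nu> ` V)"
proof -
  have VZ: "V \<subseteq> zero_level \<nu>" using V openin_imp_subset by blast
  have "{x \<in> zero_level \<nu>. reduction_orbit \<nu> x \<in> reduction_orbit \<nu> ` V} =
      (\<Union>u\<in>phase_group \<nu>. zero_level \<nu> \<inter> phase_act u -` V)"
  proof (intro equalityI subsetI)
    fix x assume x: "x \<in> {x \<in> zero_level \<nu>. reduction_orbit \<nu> x \<in> reduction_orbit \<nu> ` V}"
    then obtain v where "v \<in> V" "reduction_orbit \<nu> x = reduction_orbit \<nu> v" by auto
    then show "x \<in> (\<Union>u\<in>phase_group \<nu>. zero_level \<nu> \<inter> phase_act u -` V)"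
      using x by (auto simp: reduction_orbit_eq_iff phase_group_def torus_act_phase)
  next
    fix x assume "x \<in> (\<Union>u\<in>phase_group \<nu>. zero_level \<nu> \<inter> phase_act u -` V)"
    then obtain u where u: "u \<in> phase_group \<nu>" "x \<in> zero_level \<nu>" "phase_act u x \<in> V" by auto
    then show "x \<in> {x \<in> zero_level \<nu>. reduction_orbit \<nu> x \<in> reduction_orbit \<nu> ` V}"
      using reduction_orbit_phase_act[OF u(1), of x] by (auto intro: rev_image_eqI)
  qed
  moreover have "openin (top_of_set (zero_level \<nu>)) (zero_level \<nu> \<inter> phase_act u -` V)"
    if "u \<in> phase_group \<nu>" for u
    by (rule continuous_openin_preimage[OF _ _ V])
      (use phase_act_zero_level[OF that] in \<open>auto intro!: continuous_intros\<close>)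
  then have "openin (top_of_set (zero_level \<nu>)) (\<Union>u\<in>phase_group \<nu>. zero_level \<nu> \<inter> phase_act u -` V)"
    by (intro openin_Union) blast
  ultimately have "openin (top_of_set (zero_level \<nu>)) {x \<in> zero_level \<nu>. reduction_orbit \<nu> x \<in> reduction_orbit \<nu> ` V}"
    by (simp only:)
  then show ?thesis
    using VZ by (auto simp: toric_symplectic_cone_def openin_quotient_topology)
qed

lemma continuous_map_reduction_orbit:
  "continuous_map (top_of_set (zero_level \<nu>)) (toric_symplectic_cone \<nu>) (reduction_orbit \<nu>)"
  unfolding toric_symplectic_cone_def
  by (rule quotient_imp_continuous_map[OF quotient_map_quotient_topology])

text \<open>
  Near \<open>z0\<close> the arguments of the coordinates at which \<open>z0\<close> does not vanish are continuous. A linear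
  map \<open>P\<close> recovers an element of the Lie algebra from these coordinates, so rotating \<open>z\<close> back by
  \<open>P (a z)\<close> gives a representative of the orbit of \<open>z\<close>. Two nearby points of one orbit differ by an
  element with small coordinates, hence by one of the Lie algebra, and have the same
  representative.
\<close>

lemma local_slice:
  fixes C :: "(real ^ 'n::finite option) set" and \<nu> :: "'d::finite \<Rightarrow> int ^ 'n option"
  assumes good: "good_cone C \<nu>" and z0: "z0 \<in> zero_level \<nu>"
  obtains N s where "openin (top_of_set (zero_level \<nu>)) N" "z0 \<in> N" "continuous_on N s"
    "\<And>z. z \<in> N \<Longrightarrow> reduction_orbit \<nu> (s z) = reduction_orbit \<nu> z"
    "s ` N \<subseteq> zero_level \<nu>"
    "\<And>z z'. z \<in> N \<Longrightarrow> z' \<in> N \<Longrightarrow> reduction_orbit \<nu> z = reduction_orbit \<nu> z' \<Longrightarrow> s z = s z'"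
proof -
  let ?J = "zero_set z0"
  let ?L = "reduction_algebra \<nu>"
  obtain \<mu> where \<mu>: "dual_on \<nu> ?J \<mu>" by (rule zero_set_dual[OF good z0])
  obtain \<epsilon> where \<epsilon>: "\<epsilon> > 0" and small: "\<And>k. k \<in> reduction_group \<nu> \<Longrightarrow> (\<And>j. j \<notin> ?J \<Longrightarrow> \<bar>k $ j\<bar> < \<epsilon>) \<Longrightarrow>
     \<exists>l\<in>?L. (\<forall>j. j \<notin> ?J \<longrightarrow> l $ j = k $ j) \<and> phase l = phase k"
    by (rule reduction_group_small[OF \<mu>]) blast
  define \<rho> :: "real ^ 'd \<Rightarrow> real ^ 'd" where "\<rho> y = (\<chi> j. if j \<in> ?J then 0 else y $ j)" for y
  have lin\<rho>: "linear \<rho>" by (rule linearI) (auto simp: \<rho>_def vec_eq_iff)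
  have inj\<rho>: "inj_on \<rho> ?L"
  proof (subst linear_injective_on_subspace_0[OF lin\<rho> subspace_reduction_algebra], intro ballI impI)
    fix y assume y: "y \<in> ?L" "\<rho> y = 0"
    have w: "normal_map \<nu> y = (2 * pi) *\<^sub>R of_int_vec 0" using y(1) by (simp add: reduction_algebra_def)
    have off: "y $ j = 0" if "j \<notin> ?J" for j
      using y(2) that by (simp add: \<rho>_def vec_eq_iff) metis
    have "y $ j = 0" for j
      using dual_on_coordinate[OF \<mu> _ w, of j] off by (cases "j \<in> ?J") (simp_all add: int_dot_def)
    then show "y = 0" by (simp add: vec_eq_iff)
  qed
  obtain P where P: "range P \<subseteq> ?L" "linear P" "\<And>y. y \<in> ?L \<Longrightarrow> P (\<rho> y) = y"
    using linear_exists_left_inverse_on[OF lin\<rho> subspace_reduction_algebra inj\<rho>] by blast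
  have PL: "P y \<in> ?L" for y using P(1) by blast
  have contP: "continuous_on S P" for S
    using P(2) linear_continuous_on linear_conv_bounded_linear by blast
  obtain \<eta> where \<eta>: "\<eta> > 0" "\<And>c. dist c 1 < \<eta> \<Longrightarrow> \<bar>Arg c\<bar> < \<epsilon> / 2" "\<And>c :: complex. dist c 1 < \<eta> \<Longrightarrow> c \<notin> \<real>\<^sub>\<le>\<^sub>0"
  proof -
    have "isCont Arg 1" by (rule continuous_at_Arg) auto
    then obtain \<eta> where \<eta>: "\<eta> > 0" "\<And>c. dist c 1 < \<eta> \<Longrightarrow> dist (Arg c) (Arg 1) < \<epsilon> / 2"
      using \<epsilon> unfolding continuous_at_eps_delta by (metis half_gt_zero)
    have pos: "c \<notin> \<real>\<^sub>\<le>\<^sub>0" if "dist c 1 < 1" for c :: complex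
    proof
      assume "c \<in> \<real>\<^sub>\<le>\<^sub>0"
      then have "Re c \<le> 0" by (auto elim: nonpos_Reals_cases)
      then show False using abs_Re_le_cmod[of "c - 1"] that by (simp add: dist_norm)
    qed
    show thesis by (rule that[of "min \<eta> 1"]) (use \<eta> pos in \<open>auto simp: dist_real_def\<close>)
  qed
  define a where "a z = (\<chi> j. if j \<in> ?J then 0 else Arg (z $ j / z0 $ j))" for z
  define N where "N = {z \<in> zero_level \<nu>. \<forall>j\<in>- ?J. dist (z $ j / z0 $ j) 1 < \<eta>}"
  define s where "s z = torus_act (- P (a z)) z" for z
  have "N = zero_level \<nu> \<inter> (\<Inter>j\<in>- ?J. {z. dist (z $ j / z0 $ j) 1 < \<eta>})"
    by (auto simp: N_def)
  moreover have "open (\<Inter>j\<in>- ?J. {z. dist (z $ j / z0 $ j) 1 < \<eta>})"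
    by (intro open_INT ballI open_Collect_less continuous_intros) (auto simp: zero_set_def)
  ultimately have openN: "openin (top_of_set (zero_level \<nu>)) N" by (simp add: openin_open_Int)
  have z0N: "z0 \<in> N" using z0 \<eta>(1) by (auto simp: N_def zero_set_def)
  have "continuous_on N (\<lambda>z. if j \<in> ?J then 0 else Arg (z $ j / z0 $ j))" for j
  proof (cases "j \<in> ?J")
    case False
    then have "z0 $ j \<noteq> 0" by (simp add: zero_set_def)
    then show ?thesis using False \<eta>(3) by (auto simp: N_def intro!: continuous_intros)
  qed simp
  then have "continuous_on N a" unfolding a_def by (intro continuous_on_vec_lambda)
  then have conts: "continuous_on N s"
    unfolding s_def torus_act_phase by (intro continuous_intros continuous_on_compose2[OF contP[of UNIV]]) auto
  have orb: "reduction_orbit \<nu> (s z) = reduction_orbit \<nu> z" for z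
  proof -
    have "- P (a z) \<in> reduction_group \<nu>"
      using PL subspace_neg[OF subspace_reduction_algebra] reduction_algebra_subset by blast
    then show ?thesis unfolding s_def by (metis reduction_orbit_eq_iff)
  qed
  have sZ: "s ` N \<subseteq> zero_level \<nu>"
    by (auto simp: s_def N_def intro: torus_act_zero_level)
  have same: "s z = s z'" if zz': "z \<in> N" "z' \<in> N" "reduction_orbit \<nu> z = reduction_orbit \<nu> z'" for z z'
  proof -
    obtain k0 where k0: "k0 \<in> reduction_group \<nu>" "z' = torus_act k0 z"
      using zz'(3) by (auto simp: reduction_orbit_eq_iff)
    \<comment> \<open>The representative of the group element whose coordinates outside \<open>?J\<close> are small.\<close>
    define k where "k = (\<chi> j. if j \<in> ?J then k0 $ j else a z' $ j - a z $ j)"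
    have "cis (k $ j) = cis (k0 $ j)" for j
    proof (cases "j \<in> ?J")
      case False
      let ?c = "z $ j / z0 $ j" and ?c' = "z' $ j / z0 $ j"
      have "?c \<noteq> 0" "?c' \<noteq> 0" using zz'(1,2) \<eta>(3)[of ?c] \<eta>(3)[of ?c'] False by (auto simp: N_def)
      then have "cis (k $ j) = sgn ?c' / sgn ?c"
        using False by (simp add: k_def a_def cis_divide[symmetric] cis_Arg)
      also have "?c' = cis (k0 $ j) * ?c" by (simp add: k0(2) torus_act_def)
      finally show ?thesis using \<open>?c \<noteq> 0\<close> by (simp add: sgn_mult sgn_zero_iff)
    qed (simp add: k_def)
    then have ph: "phase k = phase k0" by (simp add: phase_def)
    then have "k \<in> reduction_group \<nu>" using k0(1) by (rule reduction_group_phase_cong)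
    moreover have "\<bar>k $ j\<bar> < \<epsilon>" if "j \<notin> ?J" for j
    proof -
      have "\<bar>a z $ j\<bar> < \<epsilon> / 2" "\<bar>a z' $ j\<bar> < \<epsilon> / 2"
        using zz'(1,2) that \<eta>(2) by (auto simp: a_def N_def)
      then show ?thesis using that by (simp add: k_def)
    qed
    ultimately obtain l where l: "l \<in> ?L" "\<And>j. j \<notin> ?J \<Longrightarrow> l $ j = k $ j" "phase l = phase k"
      using small by blast
    have "a z' - a z = \<rho> l" using l(2) by (auto simp: vec_eq_iff \<rho>_def a_def k_def)
    then have "P (a z') - P (a z) = l" using P(3)[OF l(1)] linear_diff[OF P(2)] by metis
    then have "- P (a z') = - P (a z) - l" by (simp add: algebra_simps)
    moreover have "z' = torus_act l z" using k0(2) l(3) ph by (simp add: torus_act_phase)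
    ultimately have "s z' = torus_act (- P (a z) - l + l) z" unfolding s_def by (simp only: torus_act_add)
    then show ?thesis by (simp add: s_def)
  qed
  show ?thesis using that[OF openN z0N conts orb sZ same] by blast
qed

text \<open>
  The representative chosen by \<open>local_slice\<close> descends to the orbit space because the quotient map
  is open.
\<close>

theorem local_section:
  fixes C :: "(real ^ 'n::finite option) set" and \<nu> :: "'d::finite \<Rightarrow> int ^ 'n option"
  assumes good: "good_cone C \<nu>" and w: "w \<in> topspace (toric_symplectic_cone \<nu>)"
  obtains U \<sigma> where "openin (toric_symplectic_cone \<nu>) U" "w \<in> U"
    "continuous_map (subtopology (toric_symplectic_cone \<nu>) U) (top_of_set (zero_level \<nu>)) \<sigma>"
    "\<And>v. v \<in> U \<Longrightarrow> reduction_orbit \<nu> (\<sigma> v) = v"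
proof -
  let ?q = "reduction_orbit \<nu>" and ?W = "toric_symplectic_cone \<nu>" and ?Z = "zero_level \<nu>"
  obtain z0 where z0: "z0 \<in> ?Z" "w = ?q z0" using w by (auto simp: topspace_toric_symplectic_cone)
  obtain N s where N: "openin (top_of_set ?Z) N" "z0 \<in> N" and conts: "continuous_on N s"
    and orb: "\<And>z. z \<in> N \<Longrightarrow> ?q (s z) = ?q z" and sZ: "s ` N \<subseteq> ?Z"
    and same: "\<And>z z'. z \<in> N \<Longrightarrow> z' \<in> N \<Longrightarrow> ?q z = ?q z' \<Longrightarrow> s z = s z'"
    by (rule local_slice[OF good z0(1)]) blast
  define \<sigma> where "\<sigma> v = s (SOME z. z \<in> N \<and> ?q z = v)" for v
  have \<sigma>: "\<sigma> (?q z) = s z" if "z \<in> N" for z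
  proof -
    have "(SOME z'. z' \<in> N \<and> ?q z' = ?q z) \<in> N \<and> ?q (SOME z'. z' \<in> N \<and> ?q z' = ?q z) = ?q z"
      by (rule someI[of "\<lambda>z'. z' \<in> N \<and> ?q z' = ?q z" z]) (use that in simp)
    then show ?thesis unfolding \<sigma>_def using same that by blast
  qed
  have openU: "openin ?W (?q ` N)" using N(1) by (rule openin_reduction_orbit_image)
  have "continuous_map (subtopology ?W (?q ` N)) (top_of_set ?Z) \<sigma>"
    unfolding continuous_map_def
  proof (intro conjI allI impI)
    show "\<sigma> \<in> topspace (subtopology ?W (?q ` N)) \<rightarrow> topspace (top_of_set ?Z)"
      using \<sigma> sZ by auto
    fix V assume V: "openin (top_of_set ?Z) V"
    have "openin (top_of_set N) (N \<inter> s -` V)"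
      using conts _ V by (rule continuous_openin_preimage) (use sZ in auto)
    then have "openin (top_of_set ?Z) (N \<inter> s -` V)" using N(1) openin_trans by blast
    then have "openin ?W (?q ` (N \<inter> s -` V))" by (rule openin_reduction_orbit_image)
    moreover have "{v \<in> topspace (subtopology ?W (?q ` N)). \<sigma> v \<in> V} = ?q ` (N \<inter> s -` V)"
      using openin_subset[OF openU] \<sigma> by auto
    ultimately show "openin (subtopology ?W (?q ` N)) {v \<in> topspace (subtopology ?W (?q ` N)). \<sigma> v \<in> V}"
      by (auto simp: openin_open_subtopology[OF openU])
  qed
  moreover have "?q (\<sigma> v) = v" if "v \<in> ?q ` N" for v
    using that \<sigma> orb by auto
  moreover have "w \<in> ?q ` N" using N(2) z0(2) by blast
  ultimately show ?thesis using that[OF openU] by blast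
qed

section \<open>Components of the reduction group\<close>

text \<open>
  The component of \<open>u\<close> in the reduction group, read off through \<open>\<beta>\<close> from the lattice point that the
  normal map assigns to a lift of \<open>u\<close>, divided by \<open>2\<pi>\<close>.
\<close>

definition deck_class :: "('d::finite \<Rightarrow> int ^ 'm) \<Rightarrow> int ^ 'm \<Rightarrow> nat \<Rightarrow> complex ^ 'd \<Rightarrow> int" where
  "deck_class \<nu> \<beta> N u =
    int_dot \<beta> (SOME w. \<exists>y. u = phase y \<and> normal_map \<nu> y = (2 * pi) *\<^sub>R of_int_vec w) mod int N"

text \<open>
  By \<open>good_cone_lattice_functional\<close>, the normals of a good cone admit such a \<open>\<beta>\<close>; it identifies the
  components of the reduction group with the integers modulo \<open>N\<close>.
\<close>

definition detects_lattice :: "('d::finite \<Rightarrow> int ^ 'm) \<Rightarrow> int ^ 'm \<Rightarrow> nat \<Rightarrow> bool" where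
  "detects_lattice \<nu> \<beta> N \<longleftrightarrow> N > 0 \<and> (\<exists>b. int_dot \<beta> b = 1) \<and>
     (\<forall>v. v \<in> normal_lattice \<nu> \<longleftrightarrow> int N dvd int_dot \<beta> v)"

lemma normal_map_lattice:
  "v \<in> normal_lattice \<nu> \<longleftrightarrow> (\<exists>a. normal_map \<nu> (of_int_vec a) = of_int_vec v)"
  by (auto simp: normal_map_of_int_vec normal_lattice_def)

text \<open>
  Two lifts differ by \<open>2\<pi>\<close> times an integral vector, which changes the lattice point by an element
  of the span of the normals.
\<close>

lemma deck_class_phase:
  assumes det: "detects_lattice \<nu> \<beta> N" and w: "normal_map \<nu> y = (2 * pi) *\<^sub>R of_int_vec w"
  shows "deck_class \<nu> \<beta> N (phase y) = int_dot \<beta> w mod int N"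
proof -
  let ?R = "\<lambda>w. \<exists>y'. phase y = phase y' \<and> normal_map \<nu> y' = (2 * pi) *\<^sub>R of_int_vec w"
  have "?R (SOME w. ?R w)" by (rule someI[of ?R w]) (use w in blast)
  then obtain y' where y': "phase y = phase y'"
      "normal_map \<nu> y' = (2 * pi) *\<^sub>R of_int_vec (SOME w. ?R w)" by blast
  let ?w' = "SOME w. ?R w"
  obtain a where a: "y = y' + (2 * pi) *\<^sub>R of_int_vec a" using y'(1) by (auto simp: phase_eq_iff)
  have "(2 * pi) *\<^sub>R of_int_vec w = (2 * pi) *\<^sub>R (of_int_vec ?w' + normal_map \<nu> (of_int_vec a))"
    using w unfolding a normal_map_add y'(2) normal_map_scaleR by (simp add: scaleR_add_right)
  then have "of_int_vec w = of_int_vec ?w' + normal_map \<nu> (of_int_vec a)"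
    by (subst (asm) scaleR_cancel_left) simp
  then have "normal_map \<nu> (of_int_vec a) = of_int_vec (w - ?w')" by (simp add: of_int_vec_diff)
  then have "w - ?w' \<in> normal_lattice \<nu>" by (auto simp: normal_map_lattice)
  then have "int N dvd int_dot \<beta> w - int_dot \<beta> ?w'"
    using det by (simp add: detects_lattice_def int_dot_diff)
  then show ?thesis by (simp add: deck_class_def mod_eq_dvd_iff dvd_diff_commute)
qed

lemma deck_class_mult:
  assumes det: "detects_lattice \<nu> \<beta> N" and u: "u \<in> phase_group \<nu>" and v: "v \<in> phase_group \<nu>"
  shows "deck_class \<nu> \<beta> N (phase_act u v) = (deck_class \<nu> \<beta> N u + deck_class \<nu> \<beta> N v) mod int N"
proof -
  obtain x w where x: "u = phase x" "normal_map \<nu> x = (2 * pi) *\<^sub>R of_int_vec w"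
    using u by (auto simp: phase_group_def reduction_group_def)
  obtain y w' where y: "v = phase y" "normal_map \<nu> y = (2 * pi) *\<^sub>R of_int_vec w'"
    using v by (auto simp: phase_group_def reduction_group_def)
  have "normal_map \<nu> (x + y) = (2 * pi) *\<^sub>R of_int_vec (w + w')"
    by (simp add: normal_map_add x y of_int_vec_add scaleR_add_right)
  then have "deck_class \<nu> \<beta> N (phase (x + y)) = int_dot \<beta> (w + w') mod int N"
    by (rule deck_class_phase[OF det])
  then show ?thesis
    by (simp add: x y phase_add[symmetric] deck_class_phase[OF det x(2)] deck_class_phase[OF det y(2)]
        int_dot_add mod_add_eq)
qed

lemma deck_class_range:
  "detects_lattice \<nu> \<beta> N \<Longrightarrow> 0 \<le> deck_class \<nu> \<beta> N u \<and> deck_class \<nu> \<beta> N u < int N"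
  by (simp add: deck_class_def detects_lattice_def)

lemma deck_class_algebra:
  assumes "detects_lattice \<nu> \<beta> N" "l \<in> reduction_algebra \<nu>"
  shows "deck_class \<nu> \<beta> N (phase l) = 0"
  using deck_class_phase[OF assms(1), of l 0] assms(2) by (simp add: reduction_algebra_def int_dot_def)

text \<open>
  The lattice points of the two elements differ by a combination of the normals, which an integral
  shift of one of the lifts absorbs.
\<close>

lemma deck_class_eqD:
  assumes det: "detects_lattice \<nu> \<beta> N" and u: "u \<in> phase_group \<nu>" and v: "v \<in> phase_group \<nu>"
    and eq: "deck_class \<nu> \<beta> N u = deck_class \<nu> \<beta> N v"
  obtains l where "l \<in> reduction_algebra \<nu>" "v = phase_act (phase l) u"
proof -
  obtain x w where x: "u = phase x" "normal_map \<nu> x = (2 * pi) *\<^sub>R of_int_vec w"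
    using u by (auto simp: phase_group_def reduction_group_def)
  obtain y w' where y: "v = phase y" "normal_map \<nu> y = (2 * pi) *\<^sub>R of_int_vec w'"
    using v by (auto simp: phase_group_def reduction_group_def)
  have "int N dvd int_dot \<beta> (w' - w)"
    using eq unfolding x(1) y(1) deck_class_phase[OF det x(2)] deck_class_phase[OF det y(2)]
    by (simp add: int_dot_diff mod_eq_dvd_iff dvd_diff_commute)
  then have "w' - w \<in> normal_lattice \<nu>" using det by (simp add: detects_lattice_def)
  then obtain a where a: "normal_map \<nu> (of_int_vec a) = of_int_vec (w' - w)"
    by (auto simp: normal_map_lattice)
  define l where "l = y - x - (2 * pi) *\<^sub>R of_int_vec a"
  have "y = l + x + (2 * pi) *\<^sub>R of_int_vec a" by (simp add: l_def)
  then have "phase y = phase (l + x)" unfolding phase_eq_iff by blast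
  then have "v = phase_act (phase l) u" by (simp add: y x phase_add)
  moreover have "normal_map \<nu> l = 0"
    unfolding l_def linear_diff[OF linear_normal_map] normal_map_scaleR a x(2) y(2) of_int_vec_diff
    by (simp add: scaleR_diff_right)
  ultimately show ?thesis using that by (simp add: reduction_algebra_def)
qed

text \<open>
  A quotient of two nearby elements has a lift with small coordinates, hence one in the Lie algebra.
\<close>

lemma deck_class_near:
  assumes det: "detects_lattice \<nu> \<beta> N"
  obtains \<eta> where "\<eta> > 0"
    "\<And>u v. u \<in> phase_group \<nu> \<Longrightarrow> v \<in> phase_group \<nu> \<Longrightarrow> dist u v < \<eta> \<Longrightarrow> deck_class \<nu> \<beta> N u = deck_class \<nu> \<beta> N v"
proof -
  have "dual_on \<nu> {} undefined" by (simp add: dual_on_def)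
  then obtain \<epsilon> where \<epsilon>: "\<epsilon> > 0" and small: "\<And>k. k \<in> reduction_group \<nu> \<Longrightarrow> (\<And>j. j \<notin> {} \<Longrightarrow> \<bar>k $ j\<bar> < \<epsilon>) \<Longrightarrow>
     \<exists>l\<in>reduction_algebra \<nu>. (\<forall>j. j \<notin> {} \<longrightarrow> l $ j = k $ j) \<and> phase l = phase k"
    by (rule reduction_group_small) blast
  have "isCont Arg 1" by (rule continuous_at_Arg) auto
  then obtain \<eta> where \<eta>: "\<eta> > 0" "\<And>c. dist c 1 < \<eta> \<Longrightarrow> dist (Arg c) (Arg 1) < \<epsilon>"
    using \<epsilon> unfolding continuous_at_eps_delta by metis
  have "deck_class \<nu> \<beta> N u = deck_class \<nu> \<beta> N v"
    if u: "u \<in> phase_group \<nu>" and v: "v \<in> phase_group \<nu>" and uv: "dist u v < \<eta>" for u v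
  proof -
    obtain x where x: "u = phase x" "x \<in> reduction_group \<nu>" using u by (auto simp: phase_group_def)
    obtain y where y: "v = phase y" "y \<in> reduction_group \<nu>" using v by (auto simp: phase_group_def)
    define k where "k = (\<chi> j. Arg (cis (x $ j - y $ j)))"
    have "cis (Arg (cis t)) = cis t" for t using cis_Arg[of "cis t"] by (simp add: sgn_eq)
    then have ph: "phase k = phase (x - y)" by (simp add: phase_def k_def)
    have kr: "k \<in> reduction_group \<nu>"
      by (rule reduction_group_phase_cong[OF ph])
        (use reduction_group_add[OF x(2) reduction_group_minus[OF y(2)]] in simp)
    have "\<bar>k $ j\<bar> < \<epsilon>" for j
    proof -
      have "dist (cis (x $ j - y $ j)) 1 = norm (cis (y $ j) * (cis (x $ j - y $ j) - 1))"
        by (simp add: dist_norm norm_mult)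
      also have "\<dots> = dist (u $ j) (v $ j)"
        by (simp add: x y phase_def dist_norm right_diff_distrib cis_mult)
      also have "\<dots> < \<eta>" using dist_vec_nth_le[of u j v] uv by linarith
      finally have "dist (Arg (cis (x $ j - y $ j))) (Arg 1) < \<epsilon>" by (rule \<eta>(2))
      then show ?thesis by (simp add: k_def dist_real_def)
    qed
    then obtain l where l: "l \<in> reduction_algebra \<nu>" "phase l = phase k" using small[OF kr] by blast
    have "u = phase_act (phase k) v" by (simp add: ph x y phase_add[symmetric])
    then have "deck_class \<nu> \<beta> N u = (deck_class \<nu> \<beta> N (phase l) + deck_class \<nu> \<beta> N v) mod int N"
      using deck_class_mult[OF det _ v, of "phase k"] kr by (simp add: l(2))
    then show ?thesis using deck_class_algebra[OF det l(1)] deck_class_range[OF det, of v] by simp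
  qed
  then show ?thesis using that \<eta>(1) by blast
qed

lemma deck_class_constant:
  fixes u :: "real \<Rightarrow> complex ^ 'd::finite"
  assumes det: "detects_lattice \<nu> \<beta> N"
    and T: "connected T" and u: "continuous_on T u" "u ` T \<subseteq> phase_group \<nu>"
    and st: "s \<in> T" "t \<in> T"
  shows "deck_class \<nu> \<beta> N (u s) = deck_class \<nu> \<beta> N (u t)"
proof (rule connected_local_const[OF T st, of "\<lambda>t. deck_class \<nu> \<beta> N (u t)"], rule ballI)
  fix a assume a: "a \<in> T"
  obtain \<eta> where \<eta>: "\<eta> > 0"
    "\<And>u v. u \<in> phase_group \<nu> \<Longrightarrow> v \<in> phase_group \<nu> \<Longrightarrow> dist u v < \<eta> \<Longrightarrow> deck_class \<nu> \<beta> N u = deck_class \<nu> \<beta> N v"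
    by (rule deck_class_near[OF det]) blast
  have "(u \<longlongrightarrow> u a) (at a within T)" using u(1) a by (auto simp: continuous_on_def)
  then have "\<forall>\<^sub>F t in at a within T. dist (u t) (u a) < \<eta>" using \<eta>(1) by (rule tendstoD)
  moreover have "\<forall>\<^sub>F t in at a within T. t \<in> T" by (simp add: eventually_at_filter)
  ultimately show "\<forall>\<^sub>F t in at a within T. deck_class \<nu> \<beta> N (u a) = deck_class \<nu> \<beta> N (u t)"
    by eventually_elim (rule \<eta>(2), use u(2) a in \<open>auto simp: dist_commute\<close>)
qed

lemma phase_group_free:
  fixes C :: "(real ^ 'n::finite option) set" and \<nu> :: "'d::finite \<Rightarrow> int ^ 'n option"
  assumes "good_cone C \<nu>" "z \<in> zero_level \<nu>" "u \<in> phase_group \<nu>" "v \<in> phase_group \<nu>"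
    "phase_act u z = phase_act v z"
  shows "u = v"
proof -
  obtain x where x: "x \<in> reduction_group \<nu>" "u = phase x" using assms(3) by (auto simp: phase_group_def)
  obtain y where y: "y \<in> reduction_group \<nu>" "v = phase y" using assms(4) by (auto simp: phase_group_def)
  show ?thesis
    using reduction_group_free[OF assms(1,2) x(1) y(1)] assms(5) x(2) y(2) by (simp add: torus_act_phase)
qed

section \<open>Lifting homotopies on strips\<close>

text \<open>
  Local sections lift the homotopy over small rectangles. Adjacent rectangles in a strip overlap in
  a segment \<open>t = b\<close>, where the two lifts differ by a continuous map into the group that depends on
  \<open>s\<close> alone; multiplying one lift by it makes them agree. The starting values are left free and are
  adjusted by a later application of the same device.
\<close>

lemma strip_lift:
  fixes C :: "(real ^ 'n::finite option) set" and \<nu> :: "'d::finite \<Rightarrow> int ^ 'n option"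
    and H :: "real \<times> real \<Rightarrow> (complex ^ 'd) set"
  assumes good: "good_cone C \<nu>"
    and H: "continuous_map (top_of_set ({0..1} \<times> {0..1})) (toric_symplectic_cone \<nu>) H"
    and s0: "s0 \<in> {0..1}"
  obtains \<delta> G where "\<delta> > 0" "continuous_on (({0..1} \<inter> ball s0 \<delta>) \<times> {0..1}) G"
    "\<And>s t. s \<in> {0..1} \<inter> ball s0 \<delta> \<Longrightarrow> t \<in> {0..1} \<Longrightarrow>
       G (s, t) \<in> zero_level \<nu> \<and> reduction_orbit \<nu> (G (s, t)) = H (s, t)"
proof -
  let ?A = "\<lambda>\<delta>. {0..1} \<inter> ball s0 \<delta>"
  define lift where "lift S G \<longleftrightarrow> continuous_on S G \<and>
      (\<forall>p\<in>S. G p \<in> zero_level \<nu> \<and> reduction_orbit \<nu> (G p) = H p)" for S and G :: "real \<times> real \<Rightarrow> complex ^ 'd"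
  have lift_subset: "lift S' G" if "lift S G" "S' \<subseteq> S" for S S' G
    using that continuous_on_subset unfolding lift_def by blast
  define P where "P a b \<longleftrightarrow> (0 \<le> a \<and> b \<le> 1 \<longrightarrow> (\<exists>\<delta>>0. \<exists>G. lift (?A \<delta> \<times> {a..b}) G))" for a b
  have "P 0 1"
  proof (rule Bolzano)
    fix a b c :: real assume ab: "P a b" and bc: "P b c" and le: "a \<le> b" "b \<le> c"
    show "P a c" unfolding P_def
    proof
      assume ac: "0 \<le> a \<and> c \<le> 1"
      obtain \<delta>1 G1 where G1: "\<delta>1 > 0" "lift (?A \<delta>1 \<times> {a..b}) G1" using ab ac le by (auto simp: P_def)
      obtain \<delta>2 G2 where G2: "\<delta>2 > 0" "lift (?A \<delta>2 \<times> {b..c}) G2" using bc ac le by (auto simp: P_def)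
      define \<delta> where "\<delta> = min \<delta>1 \<delta>2"
      have \<delta>: "\<delta> > 0" using G1 G2 by (simp add: \<delta>_def)
      have L1: "lift (?A \<delta> \<times> {a..b}) G1" using G1(2) by (rule lift_subset) (auto simp: \<delta>_def)
      have L2: "lift (?A \<delta> \<times> {b..c}) G2" using G2(2) by (rule lift_subset) (auto simp: \<delta>_def)
      have cp: "continuous_on (?A \<delta>) (\<lambda>s. (s, b))" by (intro continuous_intros)
      have c1: "continuous_on (?A \<delta>) (\<lambda>s. G1 (s, b))"
        by (rule continuous_on_compose2[OF _ cp]) (use L1 le in \<open>auto simp: lift_def\<close>)
      have c2: "continuous_on (?A \<delta>) (\<lambda>s. G2 (s, b))"
        by (rule continuous_on_compose2[OF _ cp]) (use L2 le in \<open>auto simp: lift_def\<close>)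
      obtain u where u: "continuous_on (?A \<delta>) u" "u ` ?A \<delta> \<subseteq> phase_group \<nu>"
          "\<And>s. s \<in> ?A \<delta> \<Longrightarrow> G1 (s, b) = phase_act (u s) (G2 (s, b))"
      proof (rule continuous_lift_difference[OF good c2 _ c1])
        show "(\<lambda>s. G2 (s, b)) ` ?A \<delta> \<subseteq> zero_level \<nu>" using L2 le by (auto simp: lift_def)
        show "reduction_orbit \<nu> (G2 (s, b)) = reduction_orbit \<nu> (G1 (s, b))" if "s \<in> ?A \<delta>" for s
          using L1 L2 le that by (simp add: lift_def)
      qed blast
      \<comment> \<open>The correction \<open>u\<close> is extended to the whole rectangle as a function of \<open>s\<close>.\<close>
      define G where "G p = (if snd p \<le> b then G1 p else phase_act (u (fst p)) (G2 p))" for p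
      have "continuous_on (?A \<delta> \<times> {a..c}) G"
        unfolding G_def
      proof (rule continuous_on_cases_le)
        show "continuous_on {p \<in> ?A \<delta> \<times> {a..c}. snd p \<le> b} G1"
          by (rule continuous_on_subset[of "?A \<delta> \<times> {a..b}"]) (use L1 in \<open>auto simp: lift_def\<close>)
        have "continuous_on {p \<in> ?A \<delta> \<times> {a..c}. b \<le> snd p} G2"
          by (rule continuous_on_subset[of "?A \<delta> \<times> {b..c}"]) (use L2 in \<open>auto simp: lift_def\<close>)
        then show "continuous_on {p \<in> ?A \<delta> \<times> {a..c}. b \<le> snd p} (\<lambda>p. phase_act (u (fst p)) (G2 p))"
          by (intro continuous_intros continuous_on_compose2[OF u(1)]) auto
        show "G1 p = phase_act (u (fst p)) (G2 p)" if "p \<in> ?A \<delta> \<times> {a..c}" "snd p = b" for p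
          using u(3)[of "fst p"] that by (cases p) auto
      qed (intro continuous_intros)
      moreover have "G p \<in> zero_level \<nu> \<and> reduction_orbit \<nu> (G p) = H p" if "p \<in> ?A \<delta> \<times> {a..c}" for p
      proof (cases "snd p \<le> b")
        case True
        then have "p \<in> ?A \<delta> \<times> {a..b}" using that by (cases p) auto
        then have "G1 p \<in> zero_level \<nu> \<and> reduction_orbit \<nu> (G1 p) = H p"
          using L1 unfolding lift_def by blast
        then show ?thesis using True by (simp add: G_def)
      next
        case False
        then have p: "p \<in> ?A \<delta> \<times> {b..c}" "fst p \<in> ?A \<delta>" using that by (cases p, simp)+
        then have "G2 p \<in> zero_level \<nu> \<and> reduction_orbit \<nu> (G2 p) = H p"
          using L2 unfolding lift_def by blast
        moreover have "u (fst p) \<in> phase_group \<nu>" using p(2) u(2) by blast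
        ultimately show ?thesis using False
          by (simp add: G_def phase_act_zero_level reduction_orbit_phase_act)
      qed
      ultimately have "lift (?A \<delta> \<times> {a..c}) G" by (simp add: lift_def)
      then show "\<exists>\<delta>>0. \<exists>G. lift (?A \<delta> \<times> {a..c}) G" using \<delta> by blast
    qed
  next
    fix x :: real assume x: "0 \<le> x" "x \<le> 1"
    let ?Q = "{0..1} \<times> {0..1} :: (real \<times> real) set"
    have sx: "(s0, x) \<in> ?Q" using s0 x by simp
    moreover have "H ` ?Q \<subseteq> topspace (toric_symplectic_cone \<nu>)"
      using continuous_map_image_subset_topspace[OF H] by simp
    ultimately have "H (s0, x) \<in> topspace (toric_symplectic_cone \<nu>)" by blast
    then obtain U \<sigma> where U: "openin (toric_symplectic_cone \<nu>) U" "H (s0, x) \<in> U"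
      and \<sigma>: "continuous_map (subtopology (toric_symplectic_cone \<nu>) U) (top_of_set (zero_level \<nu>)) \<sigma>"
        "\<And>v. v \<in> U \<Longrightarrow> reduction_orbit \<nu> (\<sigma> v) = v"
      by (rule local_section[OF good]) blast
    have "openin (top_of_set ?Q) {p \<in> ?Q. H p \<in> U}"
      using openin_continuous_map_preimage[OF H U(1)] by simp
    moreover have "(s0, x) \<in> {p \<in> ?Q. H p \<in> U}" using U(2) sx by simp
    ultimately have "\<exists>e>0. ball (s0, x) e \<inter> ?Q \<subseteq> {p \<in> ?Q. H p \<in> U}"
      unfolding openin_contains_ball by (elim conjE) (rule bspec)
    then obtain e where e: "e > 0" "ball (s0, x) e \<inter> ?Q \<subseteq> {p \<in> ?Q. H p \<in> U}" by blast
    show "\<exists>d>0. \<forall>a b. a \<le> x \<and> x \<le> b \<and> b - a < d \<longrightarrow> P a b"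
    proof (intro exI[of _ "e / 2"] conjI allI impI)
      fix a b assume ab: "a \<le> x \<and> x \<le> b \<and> b - a < e / 2"
      show "P a b" unfolding P_def
      proof
        assume ab01: "0 \<le> a \<and> b \<le> 1"
        let ?S = "?A (e / 2) \<times> {a..b}"
        have S: "?S \<subseteq> {p \<in> ?Q. H p \<in> U}"
        proof
          fix p assume p: "p \<in> ?S"
          obtain s t where st: "p = (s, t)" by (cases p)
          have "dist (s0, x) (s, t) \<le> dist s0 s + dist x t"
            unfolding dist_prod_def by (simp add: sqrt_sum_squares_le_sum)
          also have "dist s0 s < e / 2" using p by (simp add: st)
          also have "dist x t \<le> b - a" using p ab by (auto simp: st dist_real_def abs_le_iff)
          also have "e / 2 + (b - a) < e" using ab by simp
          finally have "p \<in> ball (s0, x) e" by (simp add: st)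
          moreover have "p \<in> ?Q" using p ab01 by (auto simp: st)
          ultimately show "p \<in> {p \<in> ?Q. H p \<in> U}" using e(2) by blast
        qed
        have "continuous_map (top_of_set ?S) (toric_symplectic_cone \<nu>) H"
          using continuous_map_from_subtopology_mono[OF H, of ?S] S by auto
        then have "continuous_map (top_of_set ?S) (subtopology (toric_symplectic_cone \<nu>) U) H"
          using S by (auto simp: continuous_map_in_subtopology)
        then have "continuous_map (top_of_set ?S) (top_of_set (zero_level \<nu>)) (\<sigma> \<circ> H)"
          using \<sigma>(1) by (rule continuous_map_compose)
        then have "continuous_on ?S (\<sigma> \<circ> H)" "\<And>p. p \<in> ?S \<Longrightarrow> (\<sigma> \<circ> H) p \<in> zero_level \<nu>"
          by auto
        then have "lift ?S (\<sigma> \<circ> H)" using S \<sigma>(2) by (auto simp: lift_def)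
        then show "\<exists>\<delta>>0. \<exists>G. lift (?A \<delta> \<times> {a..b}) G" using e(1) by (intro exI[of _ "e / 2"]) auto
      qed
    qed (use e in simp)
  qed simp
  then have "\<exists>\<delta>>0. \<exists>G. lift (?A \<delta> \<times> {0..1}) G" by (simp only: P_def) simp
  then obtain \<delta> G where \<delta>: "\<delta> > 0" and G: "lift (?A \<delta> \<times> {0..1}) G" by blast
  have "continuous_on (?A \<delta> \<times> {0..1}) G" using G unfolding lift_def by blast
  moreover have "G (s, t) \<in> zero_level \<nu> \<and> reduction_orbit \<nu> (G (s, t)) = H (s, t)"
    if "s \<in> ?A \<delta>" "t \<in> {0..1}" for s t
    using G that unfolding lift_def by blast
  ultimately show ?thesis using that[OF \<delta>] by blast
qed

section \<open>Recognising a finite cyclic fundamental group\<close>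

lemma cyclic_integer_mod_group:
  assumes "N > 0"
  shows "cyclic_group (integer_mod_group N)"
proof -
  have "i \<in> range (\<lambda>i::int. i mod int N)" if "i \<in> {0..<int N}" for i
    using that by (intro image_eqI[of _ _ i]) simp_all
  then have "{0..<int N} = range (\<lambda>i::int. i mod int N)" using assms by auto
  then show ?thesis
    using assms unfolding group.cyclic_group[OF group_integer_mod_group]
    by (intro bexI[of _ "1 mod int N"])
      (simp_all add: carrier_integer_mod_group int_pow_integer_mod_group mod_mult_right_eq)
qed

text \<open>
  Homotopy classes are the fibres of \<open>m\<close>, so the multiplication of classes is addition modulo \<open>N\<close>
  of their values. The group axioms are inherited from the group of integers modulo \<open>N\<close>.
\<close>

theorem fundamental_group_cyclic_by_invariant:
  fixes X :: "'a topology" and m :: "(real \<Rightarrow> 'a) \<Rightarrow> int"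
  assumes x: "x \<in> topspace X" and N: "N > 0"
    and range: "\<And>p. p \<in> loops_at X x \<Longrightarrow> m p \<in> {0..<int N}"
    and surj: "\<And>c. c \<in> {0..<int N} \<Longrightarrow> \<exists>p\<in>loops_at X x. m p = c"
    and join: "\<And>p q. p \<in> loops_at X x \<Longrightarrow> q \<in> loops_at X x \<Longrightarrow>
      join_loops p q \<in> loops_at X x \<and> m (join_loops p q) = (m p + m q) mod int N"
    and complete: "\<And>p q. p \<in> loops_at X x \<Longrightarrow> q \<in> loops_at X x \<Longrightarrow>
      (p, q) \<in> loop_homotopy X x \<longleftrightarrow> m p = m q"
  shows "group (fundamental_group X x)" "cyclic_group (fundamental_group X x)"
    "finite (carrier (fundamental_group X x))" "order (fundamental_group X x) = N"
proof -
  let ?G = "fundamental_group X x" and ?R = "loop_homotopy X x" and ?L = "loops_at X x"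
  let ?Z = "integer_mod_group N"
  define F where "F c = {p \<in> ?L. m p = c}" for c
  have carZ: "carrier ?Z = {0..<int N}" using N by (simp add: carrier_integer_mod_group)
  have R: "?R `` {p} = F (m p)" if p: "p \<in> ?L" for p
  proof -
    have "q \<in> ?L" if "(p, q) \<in> ?R" for q using that by (simp add: loop_homotopy_def)
    then have "(p, q) \<in> ?R \<longleftrightarrow> q \<in> F (m p)" for q using complete[OF p, of q] by (auto simp: F_def)
    then show ?thesis by auto
  qed
  have carG: "carrier ?G = F ` {0..<int N}"
  proof
    show "carrier ?G \<subseteq> F ` {0..<int N}"
      using R range by (auto simp: fundamental_group_def quotient_def)
    show "F ` {0..<int N} \<subseteq> carrier ?G"
    proof
      fix A assume "A \<in> F ` {0..<int N}"
      then obtain p where "p \<in> ?L" "A = F (m p)" using surj by blast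
      then show "A \<in> carrier ?G" using R by (auto simp: fundamental_group_def quotient_def)
    qed
  qed
  have injF: "inj_on F {0..<int N}"
  proof (rule inj_onI)
    fix a b assume ab: "a \<in> {0..<int N}" "F a = F b"
    obtain p where p: "p \<in> ?L" "m p = a" using surj[OF ab(1)] by blast
    then have "p \<in> F b" using ab(2) by (auto simp: F_def)
    then show "a = b" using p by (simp add: F_def)
  qed
  have mult: "F a \<otimes>\<^bsub>?G\<^esub> F b = F ((a + b) mod int N)"
    if ab: "a \<in> {0..<int N}" "b \<in> {0..<int N}" for a b
  proof -
    have eq: "?R `` {join_loops p q} = F ((a + b) mod int N)" if "p \<in> F a" "q \<in> F b" for p q
      using that join[of p q] R[of "join_loops p q"] by (simp add: F_def)
    obtain p0 q0 where "p0 \<in> F a" "q0 \<in> F b" using surj ab by (fastforce simp: F_def)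
    then have "(\<Union>p\<in>F a. \<Union>q\<in>F b. ?R `` {join_loops p q}) = F ((a + b) mod int N)"
      using eq by auto
    then show ?thesis by (simp add: fundamental_group_def)
  qed
  have const: "(\<lambda>_. x) \<in> ?L" using x by (simp add: loops_at_def pathin_def)
  have "join_loops (\<lambda>_. x) (\<lambda>_. x) = (\<lambda>_. x)" by (auto simp: join_loops_def)
  then have "m (\<lambda>_. x) = (m (\<lambda>_. x) + m (\<lambda>_. x)) mod int N" using join[OF const const] by simp
  then have "m (\<lambda>_. x) mod int N = (m (\<lambda>_. x) + m (\<lambda>_. x)) mod int N" by (metis mod_mod_trivial)
  then have "int N dvd m (\<lambda>_. x)" by (simp add: mod_eq_dvd_iff)
  then have "m (\<lambda>_. x) = 0" using range[OF const] by (auto dest: zdvd_imp_le)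
  then have one: "\<one>\<^bsub>?G\<^esub> = F 0" using R[OF const] by (simp add: fundamental_group_def)
  have iso: "F \<in> iso ?Z ?G"
    unfolding iso_def hom_def bij_betw_def using carG carZ injF mult by auto
  have "group (?G\<lparr>one := F \<one>\<^bsub>?Z\<^esub>\<rparr>)"
    using group.iso_imp_img_group[OF group_integer_mod_group iso] .
  moreover have "?G\<lparr>one := F \<one>\<^bsub>?Z\<^esub>\<rparr> = ?G" using one by (simp add: fundamental_group_def)
  ultimately show grp: "group ?G" by simp
  have "?Z \<cong> ?G" using iso by (auto simp: is_iso_def)
  then show "cyclic_group ?G"
    using isomorphic_group_cyclicity[of ?Z ?G] grp cyclic_integer_mod_group[OF N] by simp
  show "finite (carrier ?G)" by (simp add: carG)
  show "order ?G = N" using injF by (simp add: order_def carG card_image)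
qed

section \<open>Monodromy\<close>

definition lift_of :: "('d::finite \<Rightarrow> int ^ 'm) \<Rightarrow> (real \<Rightarrow> (complex ^ 'd) set) \<Rightarrow> (real \<Rightarrow> complex ^ 'd) \<Rightarrow> bool" where
  "lift_of \<nu> p f \<longleftrightarrow> continuous_on {0..1} f \<and>
     (\<forall>t\<in>{0..1}. f t \<in> zero_level \<nu> \<and> reduction_orbit \<nu> (f t) = p t)"

text \<open>
  The component of the group relating the end of a lift of \<open>p\<close> starting at \<open>z\<close> to its start. The
  choice of the lift does not matter by \<open>monodromy_eq\<close>.
\<close>

definition monodromy :: "('d::finite \<Rightarrow> int ^ 'm) \<Rightarrow> int ^ 'm \<Rightarrow> nat \<Rightarrow> complex ^ 'd \<Rightarrow> (real \<Rightarrow> (complex ^ 'd) set) \<Rightarrow> int" where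
  "monodromy \<nu> \<beta> N z p = (SOME c. \<exists>f u. lift_of \<nu> p f \<and> f 0 = z \<and> u \<in> phase_group \<nu> \<and>
     f 1 = phase_act u z \<and> c = deck_class \<nu> \<beta> N u)"

lemma phase_act_0 [simp]: "phase_act (phase 0) z = z"
  by (simp add: torus_act_phase[symmetric])

lemma zero_in_reduction_algebra [simp]: "0 \<in> reduction_algebra \<nu>"
  using subspace_reduction_algebra by (rule subspace_0)

lemma zero_in_reduction_group [simp]: "0 \<in> reduction_group \<nu>"
  using reduction_algebra_subset by (rule subsetD) simp

lemma lift_of_phase_act:
  "lift_of \<nu> p f \<Longrightarrow> u \<in> phase_group \<nu> \<Longrightarrow> lift_of \<nu> p (\<lambda>t. phase_act u (f t))"
  unfolding lift_of_def
  by (auto simp: phase_act_zero_level reduction_orbit_phase_act intro!: continuous_intros)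

lemma orbit_phase_act:
  assumes "reduction_orbit \<nu> z = reduction_orbit \<nu> z'"
  obtains u where "u \<in> phase_group \<nu>" "z' = phase_act u z"
  using assms by (auto simp: reduction_orbit_eq_iff phase_group_def torus_act_phase)

text \<open>
  Two lifts with the same start differ by a path in the group that begins at the identity and so
  remains in the identity component.
\<close>

lemma monodromy_eq:
  fixes C :: "(real ^ 'n::finite option) set" and \<nu> :: "'d::finite \<Rightarrow> int ^ 'n option"
  assumes good: "good_cone C \<nu>" and det: "detects_lattice \<nu> \<beta> N" and z: "z \<in> zero_level \<nu>"
    and f: "lift_of \<nu> p f" "f 0 = z" "u \<in> phase_group \<nu>" "f 1 = phase_act u z"
  shows "monodromy \<nu> \<beta> N z p = deck_class \<nu> \<beta> N u"
proof -
  have "\<exists>f u. lift_of \<nu> p f \<and> f 0 = z \<and> u \<in> phase_group \<nu> \<and>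
     f 1 = phase_act u z \<and> monodromy \<nu> \<beta> N z p = deck_class \<nu> \<beta> N u"
    unfolding monodromy_def by (rule someI_ex) (use f in blast)
  then obtain g v where g: "lift_of \<nu> p g" "g 0 = z" "v \<in> phase_group \<nu>" "g 1 = phase_act v z"
    and m: "monodromy \<nu> \<beta> N z p = deck_class \<nu> \<beta> N v" by blast
  have cf: "continuous_on {0..1} f" and cg: "continuous_on {0..1} g"
    and fZ: "f ` {0..1} \<subseteq> zero_level \<nu>"
    and eq: "\<And>t. t \<in> {0..1} \<Longrightarrow> reduction_orbit \<nu> (f t) = reduction_orbit \<nu> (g t)"
    using f(1) g(1) by (auto simp: lift_of_def)
  obtain w where w: "continuous_on {0..1} w" "w ` {0..1} \<subseteq> phase_group \<nu>"
    "\<And>t. t \<in> {0..1} \<Longrightarrow> g t = phase_act (w t) (f t)"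
    by (rule continuous_lift_difference[OF good cf fZ cg eq]) blast+
  have w01: "w 0 \<in> phase_group \<nu>" "w 1 \<in> phase_group \<nu>" using w(2) by auto
  have "w 0 = phase 0"
    using w(3)[of 0] f(2) g(2) by (intro phase_group_free[OF good z w01(1)]) simp_all
  then have "deck_class \<nu> \<beta> N (w 0) = 0"
    using deck_class_algebra[OF det, of 0] by simp
  then have w1: "deck_class \<nu> \<beta> N (w 1) = 0"
    using deck_class_constant[OF det connected_Icc w(1,2), of 0 1] by simp
  have "v = phase_act (w 1) u"
    using w(3)[of 1] f(4) g(4)
    by (intro phase_group_free[OF good z g(3) phase_group_mult[OF w01(2) f(3)]]) (simp add: phase_act_assoc)
  then show ?thesis
    using m deck_class_mult[OF det w01(2) f(3)] w1 deck_class_range[OF det, of u] by simp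
qed

lemma path_lift:
  fixes C :: "(real ^ 'n::finite option) set" and \<nu> :: "'d::finite \<Rightarrow> int ^ 'n option"
  assumes good: "good_cone C \<nu>" and p: "pathin (toric_symplectic_cone \<nu>) p"
    and z: "z \<in> zero_level \<nu>" "reduction_orbit \<nu> z = p 0"
  obtains f where "lift_of \<nu> p f" "f 0 = z"
proof -
  have "continuous_map (top_of_set ({0..1} \<times> {0..1})) (top_of_set {0..1}) (snd :: real \<times> real \<Rightarrow> real)"
    by (auto intro!: continuous_intros)
  then have "continuous_map (top_of_set ({0..1} \<times> {0..1})) (toric_symplectic_cone \<nu>) (p \<circ> (snd :: real \<times> real \<Rightarrow> real))"
    using p unfolding pathin_def by (rule continuous_map_compose)
  then obtain \<delta> G where \<delta>: "\<delta> > 0" and G: "continuous_on (({0..1} \<inter> ball (0::real) \<delta>) \<times> {0..1}) G"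
    "\<And>s t. s \<in> {0..1} \<inter> ball 0 \<delta> \<Longrightarrow> t \<in> {0..1} \<Longrightarrow>
       G (s, t) \<in> zero_level \<nu> \<and> reduction_orbit \<nu> (G (s, t)) = (p \<circ> snd) (s, t)"
    by (rule strip_lift[OF good _, where ?s0.0 = 0]) auto
  have "continuous_on {0..1} (\<lambda>t. G (0, t))"
    by (rule continuous_on_compose2[OF G(1)]) (use \<delta> in \<open>auto intro!: continuous_intros\<close>)
  then have lift: "lift_of \<nu> p (\<lambda>t. G (0, t))" using G(2)[of 0] \<delta> by (simp add: lift_of_def)
  then have "reduction_orbit \<nu> (G (0, 0)) = reduction_orbit \<nu> z" using z by (simp add: lift_of_def)
  then obtain u where u: "u \<in> phase_group \<nu>" "z = phase_act u (G (0, 0))" by (rule orbit_phase_act)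
  show ?thesis
    using that[of "\<lambda>t. phase_act u (G (0, t))"] lift_of_phase_act[OF lift u(1)] u(2) by simp
qed

lemma loop_lift:
  fixes C :: "(real ^ 'n::finite option) set" and \<nu> :: "'d::finite \<Rightarrow> int ^ 'n option"
  assumes good: "good_cone C \<nu>" and z: "z \<in> zero_level \<nu>"
    and p: "p \<in> loops_at (toric_symplectic_cone \<nu>) (reduction_orbit \<nu> z)"
  obtains f u where "lift_of \<nu> p f" "f 0 = z" "u \<in> phase_group \<nu>" "f 1 = phase_act u z"
proof -
  have p': "pathin (toric_symplectic_cone \<nu>) p" "reduction_orbit \<nu> z = p 0" "p 1 = reduction_orbit \<nu> z"
    using p by (auto simp: loops_at_def)
  obtain f where f: "lift_of \<nu> p f" "f 0 = z" by (rule path_lift[OF good p'(1) z p'(2)])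
  have "reduction_orbit \<nu> z = reduction_orbit \<nu> (f 1)" using f p'(3) by (simp add: lift_of_def)
  then obtain u where "u \<in> phase_group \<nu>" "f 1 = phase_act u z" by (rule orbit_phase_act)
  then show ?thesis using that f by blast
qed

lemma lift_of_pathin:
  assumes "lift_of \<nu> p f"
  shows "pathin (toric_symplectic_cone \<nu>) p"
proof -
  have "continuous_map (top_of_set {0..1}) (top_of_set (zero_level \<nu>)) f"
    using assms by (auto simp: lift_of_def)
  then have "continuous_map (top_of_set {0..1}) (toric_symplectic_cone \<nu>) (reduction_orbit \<nu> \<circ> f)"
    using continuous_map_reduction_orbit by (rule continuous_map_compose)
  then show ?thesis
    unfolding pathin_def by (rule continuous_map_eq) (use assms in \<open>simp add: lift_of_def\<close>)
qed

text \<open>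
  The lift of the second loop must start where that of the first ends, so it is translated by the
  group element \<open>u\<close>.
\<close>

lemma monodromy_join:
  fixes C :: "(real ^ 'n::finite option) set" and \<nu> :: "'d::finite \<Rightarrow> int ^ 'n option"
  assumes good: "good_cone C \<nu>" and det: "detects_lattice \<nu> \<beta> N" and z: "z \<in> zero_level \<nu>"
    and p: "p \<in> loops_at (toric_symplectic_cone \<nu>) (reduction_orbit \<nu> z)"
    and q: "q \<in> loops_at (toric_symplectic_cone \<nu>) (reduction_orbit \<nu> z)"
  shows "join_loops p q \<in> loops_at (toric_symplectic_cone \<nu>) (reduction_orbit \<nu> z) \<and>
    monodromy \<nu> \<beta> N z (join_loops p q) = (monodromy \<nu> \<beta> N z p + monodromy \<nu> \<beta> N z q) mod int N"
proof -
  obtain f u where f: "lift_of \<nu> p f" "f 0 = z" "u \<in> phase_group \<nu>" "f 1 = phase_act u z"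
    by (rule loop_lift[OF good z p])
  obtain g v where g: "lift_of \<nu> q g" "g 0 = z" "v \<in> phase_group \<nu>" "g 1 = phase_act v z"
    by (rule loop_lift[OF good z q])
  let ?g = "\<lambda>t. phase_act u (g t)"
  have g': "lift_of \<nu> q ?g" using g(1) f(3) by (rule lift_of_phase_act)
  have lift: "lift_of \<nu> (join_loops p q) (f +++ ?g)"
    unfolding lift_of_def
  proof (intro conjI ballI)
    have "path (f +++ ?g)"
      using f g g' by (intro path_join_imp) (auto simp: lift_of_def path_def pathstart_def pathfinish_def)
    then show "continuous_on {0..1} (f +++ ?g)" by (simp add: path_def)
    fix t :: real assume t: "t \<in> {0..1}"
    show "(f +++ ?g) t \<in> zero_level \<nu>" "reduction_orbit \<nu> ((f +++ ?g) t) = join_loops p q t"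
      using f(1) g' t by (auto simp: lift_of_def joinpaths_def join_loops_def)
  qed
  have start: "(f +++ ?g) 0 = z" and finish: "(f +++ ?g) 1 = phase_act (phase_act u v) z"
    using f g by (simp_all add: joinpaths_def phase_act_assoc)
  have uv: "phase_act u v \<in> phase_group \<nu>" using f(3) g(3) by (rule phase_group_mult)
  have "join_loops p q \<in> loops_at (toric_symplectic_cone \<nu>) (reduction_orbit \<nu> z)"
    using lift_of_pathin[OF lift] p q by (simp add: loops_at_def join_loops_def)
  then show ?thesis
    using monodromy_eq[OF good det z lift start uv finish] deck_class_mult[OF det f(3) g(3)]
      monodromy_eq[OF good det z f] monodromy_eq[OF good det z g] by simp
qed

text \<open>
  On a strip the lifts can be normalised to start at \<open>z\<close>; their ends then are \<open>v s\<close> times \<open>z\<close> with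
  \<open>v\<close> continuous, so the class of \<open>v s\<close> is locally constant in \<open>s\<close>.
\<close>

lemma monodromy_homotopic:
  fixes C :: "(real ^ 'n::finite option) set" and \<nu> :: "'d::finite \<Rightarrow> int ^ 'n option"
  assumes good: "good_cone C \<nu>" and det: "detects_lattice \<nu> \<beta> N" and z: "z \<in> zero_level \<nu>"
    and pq: "(p, q) \<in> loop_homotopy (toric_symplectic_cone \<nu>) (reduction_orbit \<nu> z)"
  shows "monodromy \<nu> \<beta> N z p = monodromy \<nu> \<beta> N z q"
proof -
  let ?W = "toric_symplectic_cone \<nu>" and ?x = "reduction_orbit \<nu> z"
  obtain H :: "real \<times> real \<Rightarrow> (complex ^ 'd) set" where
    H: "continuous_map (prod_topology (top_of_set {0..1}) (top_of_set {0..1})) ?W H"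
    and H01: "\<And>t. H (0, t) = p t" "\<And>t. H (1, t) = q t"
    and Hx: "\<And>s. s \<in> {0..1} \<Longrightarrow> H (s, 0) = ?x \<and> H (s, 1) = ?x"
    using pq by (auto simp: loop_homotopy_def homotopic_with_def)
  have H': "continuous_map (top_of_set ({0..1} \<times> {0..1})) ?W H"
    using H by (simp add: prod_topology_subtopology_eu)
  let ?m = "\<lambda>s. monodromy \<nu> \<beta> N z (\<lambda>t. H (s, t))"
  have "?m 0 = ?m 1"
  proof (rule connected_local_const[of "{0..1::real}" 0 1 ?m], simp, simp, simp, rule ballI)
    fix s0 :: real assume s0: "s0 \<in> {0..1}"
    obtain \<delta> G where \<delta>: "\<delta> > 0" and G: "continuous_on (({0..1} \<inter> ball s0 \<delta>) \<times> {0..1}) G"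
      "\<And>s t. s \<in> {0..1} \<inter> ball s0 \<delta> \<Longrightarrow> t \<in> {0..1} \<Longrightarrow>
         G (s, t) \<in> zero_level \<nu> \<and> reduction_orbit \<nu> (G (s, t)) = H (s, t)"
      by (rule strip_lift[OF good H' s0]) blast
    let ?A = "{0..1} \<inter> ball s0 \<delta>"
    have conA: "connected ?A" by (intro convex_connected convex_Int) auto
    have cont_slice: "continuous_on ?A (\<lambda>s. G (s, t))" if "t \<in> {0..1}" for t
      by (rule continuous_on_compose2[OF G(1)]) (use that in \<open>auto intro!: continuous_intros\<close>)
    obtain u where u: "continuous_on ?A u" "u ` ?A \<subseteq> phase_group \<nu>"
      "\<And>s. s \<in> ?A \<Longrightarrow> z = phase_act (u s) (G (s, 0))"
    proof (rule continuous_lift_difference[OF good cont_slice[of 0], of "\<lambda>_. z"])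
      show "(\<lambda>s. G (s, 0)) ` ?A \<subseteq> zero_level \<nu>" using G(2) by auto
      show "reduction_orbit \<nu> (G (s, 0)) = reduction_orbit \<nu> z" if "s \<in> ?A" for s
        using G(2)[OF that, of 0] Hx that by simp
    qed (simp_all)
    have us: "u s \<in> phase_group \<nu>" if "s \<in> ?A" for s using u(2) that by blast
    have c1: "continuous_on ?A (\<lambda>s. phase_act (u s) (G (s, 1)))"
      by (intro continuous_intros u(1) cont_slice) simp
    obtain v where v: "continuous_on ?A v" "v ` ?A \<subseteq> phase_group \<nu>"
      "\<And>s. s \<in> ?A \<Longrightarrow> phase_act (u s) (G (s, 1)) = phase_act (v s) z"
    proof (rule continuous_lift_difference[OF good _ _ c1, of "\<lambda>_. z"])
      show "(\<lambda>_. z) ` ?A \<subseteq> zero_level \<nu>" using z by auto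
      show "reduction_orbit \<nu> z = reduction_orbit \<nu> (phase_act (u s) (G (s, 1)))" if "s \<in> ?A" for s
        using G(2)[OF that, of 1] Hx that reduction_orbit_phase_act[OF us[OF that]] by simp
    qed (simp_all)
    have m: "?m s = deck_class \<nu> \<beta> N (v s)" if s: "s \<in> ?A" for s
    proof -
      have "continuous_on {0..1} (\<lambda>t. G (s, t))"
        by (rule continuous_on_compose2[OF G(1)]) (use s in \<open>auto intro!: continuous_intros\<close>)
      then have "lift_of \<nu> (\<lambda>t. H (s, t)) (\<lambda>t. G (s, t))" using G(2)[OF s] by (simp add: lift_of_def)
      then have "lift_of \<nu> (\<lambda>t. H (s, t)) (\<lambda>t. phase_act (u s) (G (s, t)))"
        using us[OF s] by (rule lift_of_phase_act)
      then show ?thesis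
        by (rule monodromy_eq[OF good det z]) (use u(3)[OF s] v(2,3) s in auto)
    qed
    have "?m s0 = ?m s" if "s \<in> ?A" for s
      using m[OF that] m[of s0] deck_class_constant[OF det conA v(1,2), of s0 s] that s0 \<delta> by simp
    moreover have "\<forall>\<^sub>F s in at s0 within {0..1}. s \<in> ?A"
      using \<delta> by (auto simp: eventually_at dist_commute intro!: exI[of _ \<delta>])
    ultimately show "\<forall>\<^sub>F s in at s0 within {0..1}. ?m s0 = ?m s"
      by (auto elim: eventually_mono)
  qed
  then show ?thesis by (simp add: H01)
qed

text \<open>
  The ends of the two lifts differ by an element of the identity component, the exponential of some
  \<open>l\<close> in the Lie algebra. Rotating one lift gradually by \<open>t *\<^sub>R l\<close> changes its end but not its image in
  the quotient. The lifts now have the same ends and are homotopic in the simply connected zero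
  level.
\<close>

lemma monodromy_complete:
  fixes C :: "(real ^ 'n::finite option) set" and \<nu> :: "'d::finite \<Rightarrow> int ^ 'n option"
  assumes good: "good_cone C \<nu>" and det: "detects_lattice \<nu> \<beta> N" and z: "z \<in> zero_level \<nu>"
    and p: "p \<in> loops_at (toric_symplectic_cone \<nu>) (reduction_orbit \<nu> z)"
    and q: "q \<in> loops_at (toric_symplectic_cone \<nu>) (reduction_orbit \<nu> z)"
    and eq: "monodromy \<nu> \<beta> N z p = monodromy \<nu> \<beta> N z q"
  shows "(p, q) \<in> loop_homotopy (toric_symplectic_cone \<nu>) (reduction_orbit \<nu> z)"
proof -
  let ?W = "toric_symplectic_cone \<nu>" and ?x = "reduction_orbit \<nu> z" and ?Z = "zero_level \<nu>"
  obtain f u where f: "lift_of \<nu> p f" "f 0 = z" "u \<in> phase_group \<nu>" "f 1 = phase_act u z"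
    by (rule loop_lift[OF good z p])
  obtain g v where g: "lift_of \<nu> q g" "g 0 = z" "v \<in> phase_group \<nu>" "g 1 = phase_act v z"
    by (rule loop_lift[OF good z q])
  have "deck_class \<nu> \<beta> N v = deck_class \<nu> \<beta> N u"
    using eq monodromy_eq[OF good det z f] monodromy_eq[OF good det z g] by simp
  then obtain l where l: "l \<in> reduction_algebra \<nu>" "u = phase_act (phase l) v"
    by (rule deck_class_eqD[OF det g(3) f(3)])
  define h where "h t = phase_act (phase (t *\<^sub>R l)) (g t)" for t
  have ph: "phase (t *\<^sub>R l) \<in> phase_group \<nu>" for t
    using subspace_scale[OF subspace_reduction_algebra l(1)] reduction_algebra_subset by auto
  have h: "lift_of \<nu> q h"
    using g(1) ph unfolding lift_of_def h_def
    by (auto simp: phase_act_zero_level reduction_orbit_phase_act intro!: continuous_intros)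
  have h01: "h 0 = f 0" "h 1 = f 1"
    using f g l by (simp_all add: h_def phase_act_assoc)
  have paths: "path f" "path_image f \<subseteq> ?Z" "path h" "path_image h \<subseteq> ?Z"
    using f(1) h by (auto simp: lift_of_def path_def path_image_def)
  have ends: "pathstart h = pathstart f" "pathfinish h = pathfinish f"
    using h01 by (simp_all add: pathstart_def pathfinish_def)
  have "homotopic_paths ?Z f h"
    using simply_connected_zero_level[OF good, unfolded simply_connected_eq_homotopic_paths] paths ends
    by blast
  then obtain K :: "real \<times> real \<Rightarrow> complex ^ 'd" where K: "continuous_map (prod_topology (top_of_set {0..1}) (top_of_set {0..1})) (top_of_set ?Z) K"
    and K01: "\<forall>t. K (0, t) = f t" "\<forall>t. K (1, t) = h t"
    and Kend: "\<forall>s\<in>{0..1}. pathstart (\<lambda>t. K (s, t)) = pathstart f \<and> pathfinish (\<lambda>t. K (s, t)) = pathfinish f"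
    unfolding homotopic_paths_def homotopic_with_def by blast
  have "homotopic_with (\<lambda>r. r 0 = ?x \<and> r 1 = ?x) (top_of_set {0..1}) ?W p q"
  proof (subst homotopic_with)
    fix h k :: "real \<Rightarrow> (complex ^ 'd) set"
    assume "\<And>t. t \<in> topspace (top_of_set {0..1}) \<Longrightarrow> h t = k t"
    from this[of 0] this[of 1] show "(h 0 = ?x \<and> h 1 = ?x) = (k 0 = ?x \<and> k 1 = ?x)" by simp
  next
    let ?H = "\<lambda>st. reduction_orbit \<nu> (K st)"
    have "continuous_map (prod_topology (top_of_set {0..1}) (top_of_set {0..1})) ?W ?H"
      using continuous_map_compose[OF K continuous_map_reduction_orbit] by (simp add: o_def)
    moreover have "?H (0, t) = p t" "?H (1, t) = q t" if "t \<in> topspace (top_of_set {0..1})" for t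
      using that K01 f(1) h by (simp_all add: lift_of_def)
    moreover have "?H (s, 0) = ?x \<and> ?H (s, 1) = ?x" if "s \<in> {0..1}" for s
      using Kend that f reduction_orbit_phase_act[OF f(3)] by (simp add: pathstart_def pathfinish_def)
    ultimately show "\<exists>H :: real \<times> real \<Rightarrow> (complex ^ 'd) set. continuous_map (prod_topology (top_of_set {0..1}) (top_of_set {0..1})) ?W H \<and>
        (\<forall>t\<in>topspace (top_of_set {0..1}). H (0, t) = p t) \<and>
        (\<forall>t\<in>topspace (top_of_set {0..1}). H (1, t) = q t) \<and>
        (\<forall>s\<in>{0..1}. H (s, 0) = ?x \<and> H (s, 1) = ?x)"
      by (intro exI[of _ ?H]) blast
  qed
  then show ?thesis using p q by (simp add: loop_homotopy_def)
qed

text \<open>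
  Join \<open>z\<close> to its translate by the required group element inside the path connected zero level.
  The element is the one whose lattice point is \<open>c\<close> times a vector on which \<open>\<beta>\<close> is \<open>1\<close>; it has
  a lift because \<open>N\<close> times that vector is a combination of the normals.
\<close>

lemma monodromy_surj:
  fixes C :: "(real ^ 'n::finite option) set" and \<nu> :: "'d::finite \<Rightarrow> int ^ 'n option"
  assumes good: "good_cone C \<nu>" and det: "detects_lattice \<nu> \<beta> N" and z: "z \<in> zero_level \<nu>"
    and c: "c \<in> {0..<int N}"
  shows "\<exists>p\<in>loops_at (toric_symplectic_cone \<nu>) (reduction_orbit \<nu> z). monodromy \<nu> \<beta> N z p = c"
proof -
  obtain b where b: "int_dot \<beta> b = 1" using det by (auto simp: detects_lattice_def)
  have N: "N > 0" using det by (simp add: detects_lattice_def)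
  have "int N *s b \<in> normal_lattice \<nu>"
    using det by (simp add: detects_lattice_def int_dot_smult)
  then obtain a where a: "normal_map \<nu> (of_int_vec a) = of_int_vec (int N *s b)"
    by (auto simp: normal_map_lattice)
  define y where "y = (2 * pi * c / N) *\<^sub>R of_int_vec a"
  have y: "normal_map \<nu> y = (2 * pi) *\<^sub>R of_int_vec (c *s b)"
    using N by (simp add: y_def normal_map_scaleR a of_int_vec_smult)
  then have u: "phase y \<in> phase_group \<nu>" by (auto simp: reduction_group_def)
  have "path_connected (zero_level \<nu>)"
    using simply_connected_zero_level[OF good] by (rule simply_connected_imp_path_connected)
  then obtain f where f: "path f" "path_image f \<subseteq> zero_level \<nu>" "pathstart f = z" "pathfinish f = phase_act (phase y) z"
    using z phase_act_zero_level[OF u z] unfolding path_connected_def by blast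
  let ?p = "reduction_orbit \<nu> \<circ> f"
  have lift: "lift_of \<nu> ?p f"
    using f(1,2) by (auto simp: lift_of_def path_def path_image_def)
  have f01: "f 0 = z" "f 1 = phase_act (phase y) z" using f(3,4) by (simp_all add: pathstart_def pathfinish_def)
  have "?p \<in> loops_at (toric_symplectic_cone \<nu>) (reduction_orbit \<nu> z)"
    using lift_of_pathin[OF lift] f01 reduction_orbit_phase_act[OF u] by (simp add: loops_at_def)
  moreover have "monodromy \<nu> \<beta> N z ?p = c"
    using monodromy_eq[OF good det z lift f01(1) u f01(2)] deck_class_phase[OF det y] b c
    by (simp add: int_dot_smult)
  ultimately show ?thesis by blast
qed

section \<open>The fundamental group and the greatest common divisor\<close>

lemma of_int_det: "real_of_int (det A) = det (\<chi> r c. real_of_int (A $ r $ c))"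
  by (simp add: det_def)

lemma volume_simplex_of_normals:
  fixes \<nu> :: "'d \<Rightarrow> int ^ 'n::finite option" and v :: "'d \<Rightarrow> real ^ 'n"
  assumes v: "inj v" and lift: "\<And>j. of_int_vec (\<nu> j) = lift_vec (v j)" and i: "inj i"
  shows "fact CARD('n) * measure lebesgue (convex hull (v ` range i)) =
    real (nat \<bar>det (normal_matrix \<nu> i)\<bar>)"
proof -
  have "inj (\<lambda>c. v (i c))" using v i by (auto simp: inj_def)
  then have "fact CARD('n) * measure lebesgue (convex hull (range (\<lambda>c. v (i c)))) =
      \<bar>det (\<chi> r c. lift_vec (v (i c)) $ r)\<bar>"
    by (rule measure_simplex_lift_vec)
  also have "(\<chi> r c. lift_vec (v (i c)) $ r) = (\<chi> r c. real_of_int (normal_matrix \<nu> i $ r $ c))"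
    by (simp add: lift[symmetric] of_int_vec_def normal_matrix_def)
  also have "\<bar>det \<dots>\<bar> = real (nat \<bar>det (normal_matrix \<nu> i)\<bar>)"
    by (simp add: of_int_det[symmetric])
  finally show ?thesis by (simp add: image_image)
qed

theorem fundamental_group_toric_symplectic_cone:
  fixes C :: "(real ^ 'n::finite option) set" and \<nu> :: "'d::finite \<Rightarrow> int ^ 'n option"
  assumes good: "good_cone C \<nu>" and det: "detects_lattice \<nu> \<beta> N"
    and x: "x \<in> topspace (toric_symplectic_cone \<nu>)"
  shows "group (fundamental_group (toric_symplectic_cone \<nu>) x)"
    "cyclic_group (fundamental_group (toric_symplectic_cone \<nu>) x)"
    "finite (carrier (fundamental_group (toric_symplectic_cone \<nu>) x))"
    "order (fundamental_group (toric_symplectic_cone \<nu>) x) = N"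
proof -
  obtain z where z: "z \<in> zero_level \<nu>" "x = reduction_orbit \<nu> z"
    using x by (auto simp: topspace_toric_symplectic_cone)
  let ?m = "monodromy \<nu> \<beta> N z"
  let ?L = "loops_at (toric_symplectic_cone \<nu>) x"
  have N: "N > 0" using det by (simp add: detects_lattice_def)
  have range: "?m p \<in> {0..<int N}" if p: "p \<in> ?L" for p
  proof -
    obtain f u where "lift_of \<nu> p f" "f 0 = z" "u \<in> phase_group \<nu>" "f 1 = phase_act u z"
      by (rule loop_lift[OF good z(1) p[unfolded z(2)]])
    then have "?m p = deck_class \<nu> \<beta> N u" by (rule monodromy_eq[OF good det z(1)])
    then show ?thesis using deck_class_range[OF det, of u] by simp
  qed
  have surj: "\<exists>p\<in>?L. ?m p = c" if "c \<in> {0..<int N}" for c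
    using monodromy_surj[OF good det z(1) that] by (simp add: z(2))
  have join: "join_loops p q \<in> ?L \<and> ?m (join_loops p q) = (?m p + ?m q) mod int N"
    if "p \<in> ?L" "q \<in> ?L" for p q
    using monodromy_join[OF good det z(1)] that by (simp add: z(2))
  have complete: "(p, q) \<in> loop_homotopy (toric_symplectic_cone \<nu>) x \<longleftrightarrow> ?m p = ?m q"
    if "p \<in> ?L" "q \<in> ?L" for p q
    using monodromy_complete[OF good det z(1)] monodromy_homotopic[OF good det z(1)] that z(2) by blast
  note * = fundamental_group_cyclic_by_invariant[where m = ?m, OF x N range surj join complete]
  show "group (fundamental_group (toric_symplectic_cone \<nu>) x)" by (rule *(1))
  show "cyclic_group (fundamental_group (toric_symplectic_cone \<nu>) x)" by (rule *(2))
  show "finite (carrier (fundamental_group (toric_symplectic_cone \<nu>) x))" by (rule *(3))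
  show "order (fundamental_group (toric_symplectic_cone \<nu>) x) = N" by (rule *(4))
qed

theorem proposition2p10:
  fixes C :: "(real ^ 'n::finite option) set"
    and \<nu> :: "'d::finite \<Rightarrow> int ^ 'n option"
    and N :: nat
  assumes good: "good_cone C \<nu>"
    and N: "int N = Gcd {det (normal_matrix \<nu> i) | i. inj i}"
  shows "(\<forall>x \<in> topspace (toric_symplectic_cone \<nu>).
            group (fundamental_group (toric_symplectic_cone \<nu>) x) \<and>
            cyclic_group (fundamental_group (toric_symplectic_cone \<nu>) x) \<and>
            finite (carrier (fundamental_group (toric_symplectic_cone \<nu>) x)) \<and>
            order (fundamental_group (toric_symplectic_cone \<nu>) x) = N) \<and>
         (\<forall>(D :: (real ^ 'n) set) (v :: 'd \<Rightarrow> real ^ 'n).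
            toric_diagram D \<and> D = convex hull (range v) \<and>
            bij_betw v UNIV {w. w extreme_point_of D} \<and>
            (\<forall>j. of_int_vec (\<nu> j) = lift_vec (v j)) \<longrightarrow>
            (\<forall>I. card I = CARD('n) + 1 \<longrightarrow> fact CARD('n) * measure lebesgue (convex hull (v ` I)) \<in> \<nat>) \<and>
            N = Gcd {m :: nat. \<exists>I. card I = CARD('n) + 1 \<and>
                               real m = fact CARD('n) * measure lebesgue (convex hull (v ` I))})"
proof (intro conjI ballI allI impI)
  obtain \<beta> where "\<And>v. v \<in> normal_lattice \<nu> \<longleftrightarrow> int N dvd int_dot \<beta> v" "\<exists>b. int_dot \<beta> b = 1" "N > 0"
    using good_cone_lattice_functional[OF good N] by metis
  then have det: "detects_lattice \<nu> \<beta> N" by (simp add: detects_lattice_def)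
  fix x assume x: "x \<in> topspace (toric_symplectic_cone \<nu>)"
  show "group (fundamental_group (toric_symplectic_cone \<nu>) x)"
    "cyclic_group (fundamental_group (toric_symplectic_cone \<nu>) x)"
    "finite (carrier (fundamental_group (toric_symplectic_cone \<nu>) x))"
    "order (fundamental_group (toric_symplectic_cone \<nu>) x) = N"
    by (rule fundamental_group_toric_symplectic_cone[OF good det x])+
next
  fix D :: "(real ^ 'n) set" and v :: "'d \<Rightarrow> real ^ 'n"
  assume D: "toric_diagram D \<and> D = convex hull (range v) \<and>
    bij_betw v UNIV {w. w extreme_point_of D} \<and> (\<forall>j. of_int_vec (\<nu> j) = lift_vec (v j))"
  then have v: "inj v" and lift: "\<And>j. of_int_vec (\<nu> j) = lift_vec (v j)" by (auto simp: bij_betw_def)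
  have card: "CARD('n option) = CARD('n) + 1" by simp
  have enum: "\<exists>i :: 'n option \<Rightarrow> 'd. inj i \<and> I = range i" if "card I = CARD('n) + 1" for I
  proof -
    have "CARD('n option) = card I" using that card by simp
    then obtain i :: "'n option \<Rightarrow> 'd" where "bij_betw i UNIV I"
      using finite_same_card_bij[of "UNIV :: 'n option set" I] by auto
    then show ?thesis by (auto simp: bij_betw_def)
  qed
  have vol: "fact CARD('n) * measure lebesgue (convex hull (v ` range i)) =
      real (nat \<bar>det (normal_matrix \<nu> i)\<bar>)" if "inj i" for i
    using v lift that by (rule volume_simplex_of_normals)
  {
    fix I :: "'d set" assume "card I = CARD('n) + 1"
    then obtain i :: "'n option \<Rightarrow> 'd" where "inj i" "I = range i" using enum by blast
    then show "fact CARD('n) * measure lebesgue (convex hull (v ` I)) \<in> \<nat>"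
      by (simp only: vol of_nat_in_Nats)
  }
  have "{m. \<exists>I. card I = CARD('n) + 1 \<and> real m = fact CARD('n) * measure lebesgue (convex hull (v ` I))} =
      (nat \<circ> abs) ` {det (normal_matrix \<nu> i) | i. inj i}" (is "?M = ?M'")
  proof (intro equalityI subsetI)
    fix m assume "m \<in> ?M"
    then obtain I where I: "card I = CARD('n) + 1"
        "real m = fact CARD('n) * measure lebesgue (convex hull (v ` I))" by blast
    obtain i :: "'n option \<Rightarrow> 'd" where i: "inj i" "I = range i" using enum[OF I(1)] by blast
    then have "m = nat \<bar>det (normal_matrix \<nu> i)\<bar>" using I(2) vol[OF i(1)] by simp
    then show "m \<in> ?M'" using i(1) by auto
  next
    fix m assume "m \<in> ?M'"
    then obtain i where i: "inj i" "m = nat \<bar>det (normal_matrix \<nu> i)\<bar>" by auto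
    then have "card (range i) = CARD('n) + 1" "real m = fact CARD('n) * measure lebesgue (convex hull (v ` range i))"
      using vol[OF i(1)] card by (simp_all add: card_image)
    then show "m \<in> ?M" by blast
  qed
  then have "int N = int (Gcd ?M)" by (simp only: N Gcd_int_def image_comp)
  then show "N = Gcd ?M" by (simp only: of_nat_eq_iff)
qed

end
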